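(* Let $A(z)=h(z)e^{P(z)}$ be a transcendental entire function, where $P(z)$ is a non-constant polynomial of degree $n$ and $h(z)$ is an entire function with $\rho(h)>n$. Assume that $h(z)$ is bounded away from zero in $E^+$ and exponentially blows up in $E^-$. Let $B(z)$ be a transcendental entire function satisfying (i) $\rho(B)<\rho(A)$, or (ii) $\mu(B)<\rho(A)$. Then all non-trivial solutions of the equation $$f''+A(z)f'+B(z)f=0$$ are of infinite order.
   Context: All functions are functions of a complex variable $z$; since the coefficients are entire, all solutions of the equation are entire, and a solution is non-trivial if it is not identically zero. For an entire function $g$, let $M(r,g)=\max_{|z|=r}|g(z)|$. The order and lower order of $g$ are $$\rho(g)=\limsup_{r\to\infty}\frac{\log^+\log^+ M(r,g)}{\log r},\qquad \mu(g)=\liminf_{r\to\infty}\frac{\log^+\log^+ M(r,g)}{\log r}.$$ A function $f$ is of infinite order if $\rho(f)=\infty$. Write $P(z)=(\alpha+\iota\beta)z^n+p_{n-1}(z)$ with $\alpha,\beta$ real, $\iota=\sqrt{-1}$ and $\deg p_{n-1}\le n-1$, and set $\delta(P,\theta)=\alpha\cos n\theta-\beta\sin n\theta$. Put $$E^+=\{\theta\in[0,2\pi]:\delta(P,\theta)>0\},\qquad E^-=\{\theta\in[0,2\pi]:\delta(P,\theta)<0\}.$$ "$h$ is bounded away from zero in $E^+$" means that there is a constant $c>0$ with $|h(re^{\iota\theta})|\ge c$ for all $\theta\in E^+$ and all $r>0$. "$h$ exponentially blows up in $E^-$" means that for every $\theta\in E^-$, $$\lim_{r\to\infty}\frac{\log\log|h(re^{\iota\theta})|}{\log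 r}=\rho(h).$$ *)

theory Defs
  imports "HOL-Complex_Analysis.Complex_Analysis"
begin

definition transcendental_entire :: "(complex \<Rightarrow> complex) \<Rightarrow> bool" where
  "transcendental_entire g \<longleftrightarrow>
     g holomorphic_on UNIV \<and> \<not> (\<exists>p :: complex poly. \<forall>z. g z = poly p z)"

definition log_plus :: "real \<Rightarrow> real" where
  "log_plus x = max 0 (ln x)"

text \<open>For continuous \<open>g\<close> and \<open>r \<ge> 0\<close> the supremum over the compact circle is attained,
  so this is the maximum modulus.\<close>

definition max_modulus :: "real \<Rightarrow> (complex \<Rightarrow> complex) \<Rightarrow> real" where
  "max_modulus r g = (SUP z\<in>sphere 0 r. norm (g z))"

definition growth_order :: "(complex \<Rightarrow> complex) \<Rightarrow> ereal" where
  "growth_order g =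
     Limsup at_top (\<lambda>r :: real. ereal (log_plus (log_plus (max_modulus r g)) / ln r))"

definition lower_growth_order :: "(complex \<Rightarrow> complex) \<Rightarrow> ereal" where
  "lower_growth_order g =
     Liminf at_top (\<lambda>r :: real. ereal (log_plus (log_plus (max_modulus r g)) / ln r))"

definition infinite_order :: "(complex \<Rightarrow> complex) \<Rightarrow> bool" where
  "infinite_order g \<longleftrightarrow> growth_order g = \<infinity>"

definition delta :: "complex poly \<Rightarrow> real \<Rightarrow> real" where
  "delta P \<theta> = Re (lead_coeff P) * cos (real (degree P) * \<theta>)
             - Im (lead_coeff P) * sin (real (degree P) * \<theta>)"

definition E_plus :: "complex poly \<Rightarrow> real set" where
  "E_plus P = {\<theta> \<in> {0..2 * pi}. delta P \<theta> > 0}"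

definition E_minus :: "complex poly \<Rightarrow> real set" where
  "E_minus P = {\<theta> \<in> {0..2 * pi}. delta P \<theta> < 0}"

definition bounded_away_from_zero_in :: "(complex \<Rightarrow> complex) \<Rightarrow> real set \<Rightarrow> bool" where
  "bounded_away_from_zero_in h E \<longleftrightarrow>
     (\<exists>c > 0. \<forall>\<theta>\<in>E. \<forall>r > 0. norm (h (of_real r * cis \<theta>)) \<ge> c)"

text \<open>Since \<^const>\<open>ln\<close> is total and satisfies \<open>ln (- x) = ln x\<close> on the reals, the limit alone would
  also admit functions decaying like \<open>exp (- (r powr \<rho>))\<close>. The first conjunct says that
  the iterated logarithm is genuinely defined for large \<open>r\<close>.  The limit is taken in
  \<^typ>\<open>ereal\<close> because the order may be infinite.\<close>

definition exponentially_blows_up_in :: "(complex \<Rightarrow> complex) \<Rightarrow> real set \<Rightarrow> bool" where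
  "exponentially_blows_up_in h E \<longleftrightarrow>
     (\<forall>\<theta>\<in>E.
        (\<forall>\<^sub>F r :: real in at_top. norm (h (of_real r * cis \<theta>)) > 1) \<and>
        ((\<lambda>r :: real. ereal (ln (ln (norm (h (of_real r * cis \<theta>)))) / ln r))
           \<longlongrightarrow> growth_order h) at_top)"

end

theory Submission
  imports Defs
begin

text \<open>
  Let \<open>f\<close> be a nontrivial solution of finite order and write
  \<open>\<rho>\<close> for the order of \<open>h\<close>, so that \<open>\<rho>(A) \<le> \<rho>\<close> and, in both cases, \<open>\<mu>(B) < \<rho>\<close>. On a ray of \<^term>\<open>E_minus P\<close>
  the coefficient \<open>A\<close> is at least \<open>exp (r powr s)\<close> for every \<open>s < \<rho>\<close>, and on a dense set of rays \<open>f'/f\<close> and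
  \<open>f''/f'\<close> are polynomially bounded. Since \<open>\<mu>(B) < \<rho>\<close>, there are arbitrarily large \<open>R\<close> such that \<open>A\<close>
  dominates \<open>B\<close> on these rays for \<open>R powr k0 \<le> r \<le> R\<close>; there the equation forces \<open>f'/f\<close> to be of size
  \<open>exp (- (r powr s))\<close>. A Phragmen-Lindelof argument in thin sectors between finitely many such rays shows
  that \<open>f\<close> is nearly constant, and \<open>f'\<close> relatively tiny, in the whole sector over this range. As the sector has opening
  \<open>\<pi>/n > \<pi>/\<rho>\<close>, the two-constants theorem transports the smallness from \<open>r\<close> near \<open>R\<close> to smaller \<open>r\<close>,
  with a loss \<open>(r/R) powr p\<close>, \<open>p < \<rho>\<close>; hence at radius \<open>r1 = R powr k1\<close> the relative size of
  \<open>f'\<close> is below \<open>exp (- (r1 powr \<nu>))\<close> with \<open>\<nu> > \<rho>\<close>, and so is \<open>B = - (f'' + A f')/f\<close>. On the sides of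
  the sector \<open>B\<close> has size at most \<open>exp (r powr \<sigma>)\<close> with \<open>\<rho> < \<sigma> < \<nu>\<close>, and
  letting \<open>R\<close> grow, a harmonic comparison gives \<open>B = 0\<close>. If \<open>\<rho>\<close> is infinite, \<open>s\<close> can be taken beyond the order
  of \<open>f\<close>, and the same comparison applies directly to \<open>f'\<close>.

  All estimates are carried out in the coordinate \<open>\<zeta> = x + iy\<close> with \<open>z = exp \<zeta>\<close>, in which sectors become strips
  and the comparison functions are exponentials.
\<close>

section \<open>Logarithmic derivatives of entire functions\<close>

lemma entire_linear_factor:
  fixes G :: "complex \<Rightarrow> complex"
  assumes "G holomorphic_on UNIV" "G a = 0"
  obtains G' where "G' holomorphic_on UNIV" "\<And>z. G z = (z - a) * G' z"
proof
  show "(\<lambda>z. if z = a then deriv G a else (G z - G a) / (z - a)) holomorphic_on UNIV"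
    using pole_lemma[OF assms(1), of a] by simp
qed (use assms(2) in auto)

lemma norm_prod_list_diff_ge:
  fixes z :: complex
  assumes "\<And>a. a \<in> set as \<Longrightarrow> r \<le> norm (z - a)" "0 \<le> r"
  shows "r ^ length as \<le> norm (\<Prod>a\<leftarrow>as. z - a)"
  using assms by (induction as) (auto simp: norm_mult intro!: mult_mono)

lemma norm_prod_list_diff_le:
  fixes z :: complex
  assumes "\<And>a. a \<in> set as \<Longrightarrow> norm (z - a) \<le> r"
  shows "norm (\<Prod>a\<leftarrow>as. z - a) \<le> r ^ length as"
  using assms
proof (induction as)
  case (Cons a as)
  have "0 \<le> r" using order_trans[OF norm_ge_zero Cons.prems[of a]] by simp
  with Cons show ?case by (auto simp: norm_mult intro!: mult_mono)
qed auto

lemma entire_max_principle_cball: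
  fixes g :: "complex \<Rightarrow> complex"
  assumes "g holomorphic_on UNIV" "\<And>z. z \<in> sphere c r \<Longrightarrow> norm (g z) \<le> B" "w \<in> cball c r"
  shows "norm (g w) \<le> B"
proof (rule maximum_modulus_frontier[of g "cball c r"])
  show "continuous_on (closure (cball c r)) g"
    using assms(1) holomorphic_on_imp_continuous_on holomorphic_on_subset by blast
  show "g holomorphic_on interior (cball c r)" using assms(1) holomorphic_on_subset by blast
qed (use assms(2,3) in auto)

text \<open>Each factor \<open>z - a\<close> has modulus at least \<open>4 * \<rho>\<close> on the
  circle of radius \<open>6 * \<rho>\<close> but at most \<open>2 * \<rho>\<close> at the centre, so
  every zero split off gains a factor 2 in the maximum principle for \<open>G\<close>. At
  \<open>w = c\<close> this bounds the number of zeros, in the manner of Jensen's inequality; at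
  general \<open>w\<close> it bounds the remaining factor \<open>G\<close>.\<close>

lemma factor_bound:
  fixes g G :: "complex \<Rightarrow> complex"
  assumes G: "G holomorphic_on UNIV" and fac: "\<And>z. g z = (\<Prod>a\<leftarrow>as. z - a) * G z"
    and as: "set as \<subseteq> cball c (2*\<rho>)" and "\<rho> > 0" and gc: "g c \<noteq> 0"
    and M: "\<And>z. z \<in> cball c (6*\<rho>) \<Longrightarrow> norm (g z) \<le> norm (g c) * exp L"
    and w: "w \<in> cball c (6*\<rho>)"
  shows "2 ^ length as * norm (G w) \<le> norm (G c) * exp L"
proof -
  let ?n = "length as"
  have *: "norm (G z) \<le> norm (g c) * exp L / (4*\<rho>) ^ ?n" if z: "z \<in> sphere c (6*\<rho>)" for z
  proof -
    have "4*\<rho> \<le> norm (z - a)" if "a \<in> set as" for a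
    proof -
      have "dist c a \<le> 2*\<rho>" "dist c z = 6*\<rho>" using as that z by auto
      then show ?thesis using dist_triangle[of c z a] by (simp add: dist_norm norm_minus_commute)
    qed
    then have "(4*\<rho>) ^ ?n \<le> norm (\<Prod>a\<leftarrow>as. z - a)"
      using \<open>\<rho> > 0\<close> by (intro norm_prod_list_diff_ge) auto
    then have "(4*\<rho>) ^ ?n * norm (G z) \<le> norm (g z)"
      by (simp add: fac norm_mult mult_right_mono)
    also have "\<dots> \<le> norm (g c) * exp L" using M z by auto
    finally show ?thesis using \<open>\<rho> > 0\<close> by (simp add: field_simps)
  qed
  have "norm (G w) \<le> norm (g c) * exp L / (4*\<rho>) ^ ?n"
    by (rule entire_max_principle_cball[OF G * w])
  also have "norm (g c) \<le> (2*\<rho>) ^ ?n * norm (G c)"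
  proof -
    have "norm (\<Prod>a\<leftarrow>as. c - a) \<le> (2*\<rho>) ^ ?n"
      using as by (intro norm_prod_list_diff_le) (auto simp: dist_norm)
    then show ?thesis by (simp add: fac norm_mult mult_right_mono)
  qed
  finally have "norm (G w) \<le> (2*\<rho>) ^ ?n * norm (G c) * exp L / (4*\<rho>) ^ ?n"
    using \<open>\<rho> > 0\<close> by (simp add: divide_right_mono mult_right_mono)
  also have "\<dots> = norm (G c) * exp L / 2 ^ ?n"
  proof -
    have "(4*\<rho>) ^ ?n = 2 ^ ?n * (2*\<rho>) ^ ?n" using power_mult_distrib[of 2 "2*\<rho>" ?n] by simp
    then show ?thesis using \<open>\<rho> > 0\<close> by (simp add: divide_simps)
  qed
  finally show ?thesis by (simp add: field_simps)
qed

lemma real_nat_le_of_power_two_le_exp: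
  assumes "2 ^ n \<le> exp L" shows "real n \<le> 2 * L"
proof -
  have "ln ((2::real) ^ n) \<le> ln (exp L)" using assms by (subst ln_le_cancel_iff) auto
  then have "real n * ln 2 \<le> L" by (simp add: ln_realpow)
  moreover have "real n * (1/2) \<le> real n * ln 2"
    using ln2_ge_two_thirds by (intro mult_left_mono) auto
  ultimately show ?thesis by simp
qed

text \<open>By the preceding bound only boundedly many linear factors can be split off, so a maximal list of
  them contains all zeros, with multiplicity.\<close>

lemma entire_factor_zeros:
  fixes g :: "complex \<Rightarrow> complex"
  assumes g: "g holomorphic_on UNIV" and "\<rho> > 0" and gc: "g c \<noteq> 0"
    and M: "\<And>z. z \<in> cball c (6*\<rho>) \<Longrightarrow> norm (g z) \<le> norm (g c) * exp L"
  obtains as G where "G holomorphic_on UNIV" "\<And>z. g z = (\<Prod>a\<leftarrow>as. z - a) * G z"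
    "set as = {z \<in> cball c (2*\<rho>). g z = 0}" "\<And>z. z \<in> cball c (2*\<rho>) \<Longrightarrow> G z \<noteq> 0"
    "real (length as) \<le> 2 * L"
proof -
  define P where "P n \<longleftrightarrow> (\<exists>as G. length as = n \<and> G holomorphic_on UNIV \<and>
     (\<forall>z. g z = (\<Prod>a\<leftarrow>as. z - a) * G z) \<and> set as \<subseteq> cball c (2*\<rho>))" for n
  have "P 0" unfolding P_def using g by (intro exI[of _ "[]"] exI[of _ g]) auto
  have bound: "real n \<le> 2 * L" if "P n" for n
  proof -
    from that obtain as G where as: "length as = n" "G holomorphic_on UNIV"
      "\<And>z. g z = (\<Prod>a\<leftarrow>as. z - a) * G z" "set as \<subseteq> cball c (2*\<rho>)" unfolding P_def by blast
    have "2 ^ length as * norm (G c) \<le> norm (G c) * exp L"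
      by (rule factor_bound[OF as(2-4) \<open>\<rho> > 0\<close> gc M]) (use \<open>\<rho> > 0\<close> in auto)
    moreover have "G c \<noteq> 0" using as(3)[of c] gc by auto
    ultimately have "2 ^ n \<le> exp L" using as(1) by simp
    then show ?thesis by (rule real_nat_le_of_power_two_le_exp)
  qed
  then have "\<forall>n. P n \<longrightarrow> n \<le> nat \<lceil>2 * L\<rceil>" by (metis real_nat_ceiling_ge of_nat_le_iff order_trans le_of_int_ceiling nat_mono nat_int)
  then obtain n where n: "P n" "\<And>m. P m \<Longrightarrow> m \<le> n" using GreatestI_nat[of P 0] Greatest_le_nat[of P] \<open>P 0\<close> by metis
  then obtain as G where as: "length as = n" "G holomorphic_on UNIV"
      "\<And>z. g z = (\<Prod>a\<leftarrow>as. z - a) * G z" "set as \<subseteq> cball c (2*\<rho>)" unfolding P_def by blast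
  have G0: "G z \<noteq> 0" if z: "z \<in> cball c (2*\<rho>)" for z
  proof
    assume "G z = 0"
    then obtain G' where "G' holomorphic_on UNIV" "\<And>w. G w = (w - z) * G' w"
      using entire_linear_factor[OF as(2)] by metis
    then have "P (Suc n)" unfolding P_def using as z
      by (intro exI[of _ "z # as"] exI[of _ G']) auto
    with n(2) show False by fastforce
  qed
  have "set as = {z \<in> cball c (2*\<rho>). g z = 0}"
    using as(4) G0 by (auto simp: as(3) prod_list_zero_iff)
  moreover have "real (length as) \<le> 2 * L" using bound[OF n(1)] as(1) by simp
  ultimately show ?thesis using that[OF as(2) as(3)] G0 by simp
qed

text \<open>The Borel-Caratheodory inequality: \<open>u / (2 * L - u)\<close> maps the unit disc
  into itself when \<open>Re u < L\<close>, so the Schwarz lemma bounds \<open>l\<close> on a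
  smaller disc. Cauchy's inequality with radius \<open>\<rho> / 2\<close> then bounds the derivative
  on \<open>ball c \<rho>\<close>.\<close>

lemma deriv_bound_of_Re_less:
  fixes l :: "complex \<Rightarrow> complex"
  assumes l: "l holomorphic_on ball c (2*\<rho>)" and lc: "l c = 0" and "\<rho> > 0" "L > 0"
    and Re: "\<And>z. z \<in> ball c (2*\<rho>) \<Longrightarrow> Re (l z) < L" and z: "z \<in> ball c \<rho>"
  shows "norm (deriv l z) \<le> 12 * L / \<rho>"
proof -
  define u where "u \<zeta> = l (c + of_real (2*\<rho>) * \<zeta>)" for \<zeta>
  define w where "w \<zeta> = u \<zeta> / (of_real (2*L) - u \<zeta>)" for \<zeta>
  have in_ball: "c + of_real (2*\<rho>) * \<zeta> \<in> ball c (2*\<rho>)" if "norm \<zeta> < 1" for \<zeta>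
    using that \<open>\<rho> > 0\<close> by (simp add: dist_norm norm_mult)
  have uh: "u holomorphic_on ball 0 1"
  proof -
    have 1: "(\<lambda>\<zeta>. c + of_real (2*\<rho>) * \<zeta>) holomorphic_on ball 0 1" by (intro holomorphic_intros)
    have 2: "(\<lambda>\<zeta>. c + of_real (2*\<rho>) * \<zeta>) ` ball 0 1 \<subseteq> ball c (2*\<rho>)"
      using in_ball by (simp add: image_subset_iff)
    show ?thesis using holomorphic_on_compose_gen[OF 1 l 2] by (simp add: o_def u_def[abs_def])
  qed
  have uRe: "Re (u \<zeta>) < L" if "norm \<zeta> < 1" for \<zeta> unfolding u_def using Re in_ball that by auto
  have nz: "of_real (2*L) - u \<zeta> \<noteq> 0" if "norm \<zeta> < 1" for \<zeta>
  proof -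
    have "Re (of_real (2*L) - u \<zeta>) > 0" using uRe[OF that] \<open>L > 0\<close> by simp
    then show ?thesis by (metis less_irrefl zero_complex.sel(1))
  qed
  have w1: "norm (w \<zeta>) \<le> norm \<zeta>" if "norm \<zeta> < 1" for \<zeta>
  proof (rule Schwarz_Lemma(1)[where f = w, OF _ _ _ that])
    show "w holomorphic_on ball 0 1" unfolding w_def
      by (intro holomorphic_intros uh nz) simp
    show "w 0 = 0" unfolding w_def u_def by (simp add: lc)
    show "norm (w \<zeta>) < 1" if "norm \<zeta> < 1" for \<zeta>
    proof -
      have "(Re (u \<zeta>))\<^sup>2 < (2*L - Re (u \<zeta>))\<^sup>2"
        using uRe[OF that] \<open>L > 0\<close> by (intro power2_strict_mono) auto
      then have "norm (u \<zeta>) < norm (of_real (2*L) - u \<zeta>)"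
        by (simp add: cmod_def)
      then show ?thesis unfolding w_def by (simp add: norm_divide divide_simps)
    qed
  qed
  \<comment> \<open>After rescaling, such a point has modulus at most 3/4; solving
    \<open>t <= 3/4 * (2 * L + t)\<close> for \<open>t\<close> gives \<open>6 * L\<close>.\<close>
  have lb: "norm (l v) \<le> 6 * L" if v: "dist c v \<le> 3/2 * \<rho>" for v
  proof -
    define \<zeta> where "\<zeta> = (v - c) / of_real (2*\<rho>)"
    have n\<zeta>: "norm \<zeta> \<le> 3/4" using v \<open>\<rho> > 0\<close>
      by (simp add: \<zeta>_def norm_divide dist_norm norm_minus_commute divide_simps norm_mult)
    have u: "u \<zeta> = l v" using \<open>\<rho> > 0\<close> by (simp add: u_def \<zeta>_def)
    have "norm (w \<zeta>) \<le> 3/4" using w1[of \<zeta>] n\<zeta> by linarith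
    moreover have "norm (of_real (2*L) - l v) > 0" using nz[of \<zeta>] n\<zeta> u by simp
    ultimately have "norm (l v) \<le> 3/4 * norm (of_real (2*L) - l v)"
      by (simp only: w_def u norm_divide pos_divide_le_eq)
    also have "\<dots> \<le> 3/4 * (2 * L + norm (l v))"
      using norm_triangle_ineq4[of "of_real (2*L)" "l v"] \<open>L > 0\<close> by simp
    finally show ?thesis by simp
  qed
  have "norm ((deriv ^^ 1) l z) \<le> fact 1 * (6 * L) / (\<rho>/2) ^ 1"
  proof (rule Cauchy_inequality)
    have sub: "cball z (\<rho>/2) \<subseteq> ball c (2*\<rho>)"
    proof
      fix v assume "v \<in> cball z (\<rho>/2)"
      then show "v \<in> ball c (2*\<rho>)" using z dist_triangle[of c v z] \<open>\<rho> > 0\<close> by auto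
    qed
    show "l holomorphic_on ball z (\<rho>/2)" using l sub ball_subset_cball holomorphic_on_subset by blast
    show "continuous_on (cball z (\<rho>/2)) l" using l sub holomorphic_on_subset holomorphic_on_imp_continuous_on by blast
    show "norm (l v) \<le> 6 * L" if "norm (z - v) = \<rho>/2" for v
      using that z dist_triangle[of c v z] by (intro lb) (auto simp: dist_norm)
  qed (use \<open>\<rho> > 0\<close> in auto)
  then show ?thesis by simp
qed

lemma deriv_prod_list_diff:
  fixes z :: complex
  assumes "z \<notin> set as"
  shows "((\<lambda>z. \<Prod>a\<leftarrow>as. z - a) has_field_derivative (\<Prod>a\<leftarrow>as. z - a) * (\<Sum>a\<leftarrow>as. 1 / (z - a))) (at z)"
  using assms
proof (induction as)
  case (Cons a as)
  have "((\<lambda>z. (z - a) * (\<Prod>a\<leftarrow>as. z - a)) has_field_derivative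
     1 * (\<Prod>a\<leftarrow>as. z - a) + ((\<Prod>a\<leftarrow>as. z - a) * (\<Sum>a\<leftarrow>as. 1 / (z - a))) * (z - a)) (at z)"
    using Cons by (intro DERIV_mult) (auto intro!: derivative_eq_intros)
  moreover have "1 * (\<Prod>a\<leftarrow>as. z - a) + ((\<Prod>a\<leftarrow>as. z - a) * (\<Sum>a\<leftarrow>as. 1 / (z - a))) * (z - a)
      = (z - a) * (\<Prod>a\<leftarrow>as. z - a) * (1 / (z - a) + (\<Sum>a\<leftarrow>as. 1 / (z - a)))"
    using Cons.prems by (simp add: field_simps)
  ultimately show ?case by simp
qed auto

text \<open>Write \<open>g\<close> as the product over its zeros in the disc of radius
  \<open>2 * \<rho>\<close> times a function \<open>G\<close> without zeros there. The logarithmic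
  derivative of the product has at most \<open>2 * L\<close> terms, each at most
  \<open>1 / d\<close>; that of \<open>G\<close> is \<open>deriv l\<close> for a logarithm
  \<open>l\<close> of \<open>G / G c\<close>, to which the Borel-Caratheodory estimate
  applies.\<close>

lemma norm_deriv_le_of_zero_distance:
  fixes g :: "complex \<Rightarrow> complex"
  assumes g: "g holomorphic_on UNIV" and "\<rho> > 0" "L > 0" "d > 0" and gc: "g c \<noteq> 0"
    and M: "\<And>z. z \<in> cball c (6*\<rho>) \<Longrightarrow> norm (g z) \<le> norm (g c) * exp L"
    and z: "z \<in> ball c \<rho>" and d: "\<And>a. g a = 0 \<Longrightarrow> d \<le> norm (z - a)"
  shows "norm (deriv g z) \<le> (2 * L / d + 24 * L / \<rho>) * norm (g z)"
proof -
  obtain as G where G: "G holomorphic_on UNIV" "\<And>z. g z = (\<Prod>a\<leftarrow>as. z - a) * G z"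
    "set as = {z \<in> cball c (2*\<rho>). g z = 0}" "\<And>z. z \<in> cball c (2*\<rho>) \<Longrightarrow> G z \<noteq> 0"
    "real (length as) \<le> 2 * L"
    by (rule entire_factor_zeros[OF g \<open>\<rho> > 0\<close> gc, of L]) (use M in blast)+
  have Gc: "G c \<noteq> 0" using G(4)[of c] \<open>\<rho> > 0\<close> by auto
  have G1: "G holomorphic_on ball c (2*\<rho>)" using G(1) holomorphic_on_subset by blast
  have G2: "G x \<noteq> 0" if "x \<in> ball c (2*\<rho>)" for x using G(4)[of x] that by simp
  have "c \<in> ball c (2*\<rho>)" using \<open>\<rho> > 0\<close> by simp
  from holomorphic_logarithm_exists[OF convex_ball open_ball G1 G2 this]
  obtain l0 where l0: "l0 holomorphic_on ball c (2*\<rho>)" "\<And>x. x \<in> ball c (2*\<rho>) \<Longrightarrow> exp (l0 x) = G x"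
    by metis
  define l where "l x = l0 x - l0 c" for x
  have lh: "l holomorphic_on ball c (2*\<rho>)" unfolding l_def by (intro holomorphic_intros l0)
  have el: "exp (l x) = G x / G c" if "x \<in> ball c (2*\<rho>)" for x
    using l0(2)[OF that] l0(2)[of c] \<open>\<rho> > 0\<close> by (simp add: l_def exp_diff)
  have zb: "z \<in> ball c (2*\<rho>)" using z \<open>\<rho> > 0\<close> by auto
  \<comment> \<open>The estimate demands a strict bound on \<open>Re l\<close>, while the
    factorisation gives \<open>Re l <= L\<close>; hence its use with \<open>2 * L\<close>.\<close>
  have dl: "norm (deriv l z) \<le> 12 * (2 * L) / \<rho>"
  proof (rule deriv_bound_of_Re_less[OF lh _ \<open>\<rho> > 0\<close> _ _ z])
    fix x assume x: "x \<in> ball c (2*\<rho>)"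
    have "2 ^ length as * norm (G x) \<le> norm (G c) * exp L"
      by (rule factor_bound[OF G(1,2) _ \<open>\<rho> > 0\<close> gc M]) (use G(3) x \<open>\<rho> > 0\<close> in auto)
    moreover have "norm (G x) \<le> 2 ^ length as * norm (G x)"
      using mult_right_mono[of 1 "2 ^ length as" "norm (G x)"] by simp
    ultimately have "norm (G x) \<le> norm (G c) * exp L" by linarith
    then have "norm (exp (l x)) \<le> exp L" unfolding el[OF x] using Gc by (simp add: norm_divide divide_simps mult.commute)
    then have "Re (l x) \<le> L" by simp
    then show "Re (l x) < 2 * L" using \<open>L > 0\<close> by simp
  qed (use \<open>L > 0\<close> in \<open>simp_all add: l_def\<close>)
  moreover have "deriv G z = G z * deriv l z"
  proof -
    have "((\<lambda>x. G c * exp (l x)) has_field_derivative G c * (exp (l z) * deriv l z)) (at z)"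
      by (auto intro!: derivative_eq_intros holomorphic_derivI[OF lh _ zb])
    then have "(G has_field_derivative G c * (exp (l z) * deriv l z)) (at z)"
      by (rule has_field_derivative_transform_within_open[of _ _ _ "ball c (2*\<rho>)"]) (use zb el Gc in auto)
    then show ?thesis using el[OF zb] Gc by (simp add: DERIV_imp_deriv)
  qed
  moreover have zas: "z \<notin> set as" using G(3) d[of z] \<open>d > 0\<close> by auto
  have "deriv g z = g z * (\<Sum>a\<leftarrow>as. 1 / (z - a)) + (\<Prod>a\<leftarrow>as. z - a) * deriv G z"
  proof -
    have *: "(G has_field_derivative deriv G z) (at z)" using holomorphic_derivI[OF G(1)] by auto
    have "g = (\<lambda>z. (\<Prod>a\<leftarrow>as. z - a) * G z)" using G(2) by auto
    then have "(g has_field_derivative (\<Prod>a\<leftarrow>as. z - a) * (\<Sum>a\<leftarrow>as. 1 / (z - a)) * G z + deriv G z * (\<Prod>a\<leftarrow>as. z - a)) (at z)"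
      using DERIV_mult[OF deriv_prod_list_diff[OF zas] *] by simp
    then show ?thesis by (simp add: DERIV_imp_deriv G(2) mult_ac)
  qed
  ultimately have "deriv g z = g z * ((\<Sum>a\<leftarrow>as. 1 / (z - a)) + deriv l z)"
    by (simp add: G(2) algebra_simps)
  moreover have "norm (\<Sum>a\<leftarrow>as. 1 / (z - a)) \<le> 2 * L / d"
  proof -
    have "norm (\<Sum>a\<leftarrow>bs. 1 / (z - a)) \<le> length bs / d" if "set bs \<subseteq> set as" for bs
      using that
    proof (induction bs)
      case (Cons b bs)
      have "norm (1 / (z - b)) \<le> 1 / d" using d[of b] Cons.prems G(3) \<open>d > 0\<close>
        by (auto simp: norm_divide intro!: divide_left_mono mult_pos_pos)
      then show ?case using Cons norm_triangle_ineq[of "1 / (z - b)" "\<Sum>a\<leftarrow>bs. 1 / (z - a)"]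
        by (simp add: add_divide_distrib)
    qed auto
    from this[of as] have "norm (\<Sum>a\<leftarrow>as. 1 / (z - a)) \<le> length as / d" by simp
    also have "\<dots> \<le> 2 * L / d" using G(5) \<open>d > 0\<close> by (intro divide_right_mono) auto
    finally show ?thesis .
  qed
  ultimately have "norm (deriv g z) \<le> norm (g z) * (2 * L / d + 24 * L / \<rho>)"
    using dl by (auto simp: norm_mult intro!: mult_left_mono order.trans[OF norm_triangle_ineq])
  then show ?thesis by (simp add: mult.commute)
qed

section \<open>Comparison principles in rectangles\<close>

lemma eventually_exp_dominates:
  fixes \<alpha> \<beta> :: real
  assumes "\<alpha> < \<beta>" "0 < \<beta>" "0 < k"
  shows "\<forall>\<^sub>F x in at_top. a * exp (\<alpha> * x) + b \<le> k * exp (\<beta> * x)"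
proof -
  have lim0: "((\<lambda>x. exp (- (u * x))) \<longlongrightarrow> 0) at_top" if "0 < u" for u :: real
    using that by (intro filterlim_compose[OF exp_at_bot] filterlim_compose[OF filterlim_uminus_at_bot_at_top]
      filterlim_tendsto_pos_mult_at_top[OF tendsto_const] filterlim_ident)
  have "((\<lambda>x. a * exp (- ((\<beta> - \<alpha>) * x)) + b * exp (- (\<beta> * x))) \<longlongrightarrow> a * 0 + b * 0) at_top"
    using assms by (intro tendsto_intros lim0) auto
  then have "\<forall>\<^sub>F x in at_top. a * exp (- ((\<beta> - \<alpha>) * x)) + b * exp (- (\<beta> * x)) < k"
    using assms by (intro order_tendstoD(2)) auto
  then show ?thesis
  proof eventually_elim
    case (elim x)
    have "(a * exp (- ((\<beta> - \<alpha>) * x)) + b * exp (- (\<beta> * x))) * exp (\<beta> * x) \<le> k * exp (\<beta> * x)"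
      using elim by (intro mult_right_mono) auto
    moreover have "(a * exp (- ((\<beta> - \<alpha>) * x)) + b * exp (- (\<beta> * x))) * exp (\<beta> * x) = a * exp (\<alpha> * x) + b"
      by (simp add: distrib_right mult.assoc flip: exp_add) (simp add: algebra_simps)
    ultimately show ?case by simp
  qed
qed

section \<open>Harmonic majorants made of exponentials\<close>

lemma Re_exp_shift:
  "Re (exp (of_real k * (Complex x y - Complex a b))) = exp (k * (x - a)) * cos (k * (y - b))"
  by (simp add: Re_exp)

lemma Re_exp_shift_neg:
  "Re (exp (of_real (- k) * (Complex x y - Complex a b))) = exp (- (k * (x - a))) * cos (k * (y - b))"
  unfolding Re_exp_shift using cos_minus[of "k * (y - b)"] by simp

lemma Re_of_real_mult: "Re (of_real u * z) = u * Re z"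
  by simp

lemma abs_diff_midpoint_le:
  fixes y :: real
  shows "y \<in> {y0..y1} \<Longrightarrow> \<bar>y - (y0 + y1) / 2\<bar> \<le> (y1 - y0) / 2"
  unfolding abs_le_iff atLeastAtMost_iff by argo

lemma abs_diff_midpoint_less:
  fixes y :: real
  shows "y0 < y \<Longrightarrow> y < y1 \<Longrightarrow> \<bar>y - (y0 + y1) / 2\<bar> < (y1 - y0) / 2"
  unfolding abs_less_iff by argo

text \<open>The maximum modulus principle for \<open>g * exp (- \<Phi>)\<close>: the harmonic
  function \<open>Re \<Phi>\<close> plays the role of a majorant of \<open>ln (norm g)\<close>, and
  zeros of \<open>g\<close> cause no trouble because no logarithm is taken.\<close>

lemma norm_le_exp_Re_on_rectangle:
  fixes g \<Phi> :: "complex \<Rightarrow> complex"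
  assumes "g holomorphic_on UNIV" "\<Phi> holomorphic_on UNIV"
    and bd: "\<And>x y. x \<in> {x0..x1} \<Longrightarrow> y \<in> {y0..y1} \<Longrightarrow> x = x0 \<or> x = x1 \<or> y = y0 \<or> y = y1 \<Longrightarrow>
      norm (g (Complex x y)) \<le> exp (Re (\<Phi> (Complex x y)))"
    and xy: "x \<in> {x0..x1}" "y \<in> {y0..y1}"
  shows "norm (g (Complex x y)) \<le> exp (Re (\<Phi> (Complex x y)))"
proof -
  define S where "S = cbox (Complex x0 y0) (Complex x1 y1)"
  define F where "F z = g z * exp (- \<Phi> z)" for z
  have F: "F holomorphic_on UNIV" unfolding F_def by (intro holomorphic_intros assms)
  have "norm (F (Complex x y)) \<le> 1"
  proof (rule maximum_modulus_frontier[of F S])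
    show "F holomorphic_on interior S" using F holomorphic_on_subset by blast
    show "continuous_on (closure S) F" using F holomorphic_on_imp_continuous_on holomorphic_on_subset by blast
    show "bounded S" unfolding S_def by (rule bounded_cbox)
    show "Complex x y \<in> S" using xy by (simp add: S_def in_cbox_complex_iff)
    fix z assume "z \<in> frontier S"
    then have z: "z \<in> S" "z \<notin> box (Complex x0 y0) (Complex x1 y1)"
      by (auto simp: S_def frontier_cbox)
    then have "norm (g (Complex (Re z) (Im z))) \<le> exp (Re (\<Phi> (Complex (Re z) (Im z))))"
      by (intro bd) (auto simp: S_def in_cbox_complex_iff in_box_complex_iff)
    then show "norm (F z) \<le> 1"
      by (simp add: F_def norm_mult norm_divide norm_inverse exp_minus divide_simps)
  qed
  then show ?thesis by (simp add: F_def norm_mult norm_divide norm_inverse exp_minus divide_simps)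
qed

text \<open>A Phragmen-Lindelof estimate: an excess \<open>E\<close> at the two ends decays inwards
  at the exponential rate \<open>q\<close>. The width condition keeps the argument of the cosine
  within \<open>pi / 3\<close> of 0, so the cosine is at least 1/2, and the factor 2 in
  \<open>2 * E\<close> makes up for it. Narrower rectangles permit a larger rate.\<close>

lemma norm_le_in_thin_rectangle:
  fixes g :: "complex \<Rightarrow> complex"
  assumes g: "g holomorphic_on UNIV" and q: "q > 0" "q * (y1 - y0) \<le> 2 * pi / 3" and E: "E \<ge> 0"
    and sides: "\<And>x. x \<in> {x0..x1} \<Longrightarrow> norm (g (Complex x y0)) \<le> exp m \<and> norm (g (Complex x y1)) \<le> exp m"
    and ends: "\<And>y. y \<in> {y0..y1} \<Longrightarrow> norm (g (Complex x0 y)) \<le> exp (m + E) \<and> norm (g (Complex x1 y)) \<le> exp (m + E)"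
    and xy: "x \<in> {x0..x1}" "y \<in> {y0..y1}"
  shows "norm (g (Complex x y)) \<le> exp (m + 2 * E * (exp (- (q * (x - x0))) + exp (- (q * (x1 - x)))))"
proof -
  define b where "b = (y0 + y1) / 2"
  define \<Phi> where "\<Phi> z = of_real m + of_real (2 * E) *
    (exp (of_real (- q) * (z - Complex x0 b)) + exp (of_real q * (z - Complex x1 b)))" for z
  have Re: "Re (\<Phi> (Complex x y)) = m + 2 * E * ((exp (- (q * (x - x0))) + exp (- (q * (x1 - x)))) * cos (q * (y - b)))" for x y
  proof -
    have "q * (x - x1) = - (q * (x1 - x))" by (simp add: algebra_simps)
    then show ?thesis
      unfolding \<Phi>_def plus_complex.sel Re_of_real_mult Re_complex_of_real Re_exp_shift_neg Re_exp_shift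
      by (simp add: distrib_right)
  qed
  have cos: "1/2 \<le> cos (q * (y - b))" if y: "y \<in> {y0..y1}" for y
  proof -
    have "\<bar>y - b\<bar> \<le> (y1 - y0) / 2" unfolding b_def by (rule abs_diff_midpoint_le[OF y])
    then have "q * \<bar>y - b\<bar> \<le> q * ((y1 - y0) / 2)" using q by (intro mult_left_mono) auto
    also have "\<dots> \<le> pi / 3" using q by linarith
    finally have "\<bar>q * (y - b)\<bar> \<le> pi / 3" using q by (simp add: abs_mult)
    then have "cos (pi / 3) \<le> cos \<bar>q * (y - b)\<bar>" by (intro cos_monotone_0_pi_le) auto
    then show ?thesis by (simp add: cos_60)
  qed
  have "norm (g (Complex x y)) \<le> exp (Re (\<Phi> (Complex x y)))"
  proof (rule norm_le_exp_Re_on_rectangle[OF g _ _ xy])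
    show "\<Phi> holomorphic_on UNIV" unfolding \<Phi>_def by (intro holomorphic_intros)
    fix x y assume x: "x \<in> {x0..x1}" and y: "y \<in> {y0..y1}" and bd: "x = x0 \<or> x = x1 \<or> y = y0 \<or> y = y1"
    let ?e = "exp (- (q * (x - x0))) + exp (- (q * (x1 - x)))"
    have pos: "0 \<le> ?e * cos (q * (y - b))" using cos[OF y] by (intro mult_nonneg_nonneg add_nonneg_nonneg) auto
    show "norm (g (Complex x y)) \<le> exp (Re (\<Phi> (Complex x y)))"
    proof (cases "y = y0 \<or> y = y1")
      case True
      then have "norm (g (Complex x y)) \<le> exp m" using sides[OF x] by auto
      also have "\<dots> \<le> exp (Re (\<Phi> (Complex x y)))" unfolding Re using E pos by simp
      finally show ?thesis .
    next
      case False
      then have "norm (g (Complex x y)) \<le> exp (m + E)" using ends[OF y] bd by auto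
      moreover have "1 \<le> ?e" using False bd by auto
      then have "1 * (1/2) \<le> ?e * cos (q * (y - b))" using cos[OF y] by (intro mult_mono) auto
      then have "2 * E * (1/2) \<le> 2 * E * (?e * cos (q * (y - b)))" using E by (intro mult_left_mono) auto
      then have "exp (m + E) \<le> exp (Re (\<Phi> (Complex x y)))" unfolding Re by simp
      ultimately show ?thesis by linarith
    qed
  qed
  also have "\<dots> \<le> exp (m + 2 * E * (exp (- (q * (x - x0))) + exp (- (q * (x1 - x)))))"
    unfolding Re using E cos_le_one[of "q * (y - b)"] by (simp add: mult_left_mono mult_left_le add_nonneg_nonneg)
  finally show ?thesis .
qed

text \<open>A two-constants estimate: smallness on the right end spreads to the left with the loss
  rate \<open>p\<close> that belongs to the full width. The subtracted comparison function is built
  from one exponential minus its reflection in the line \<open>x = x0\<close>, whence the point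
  \<open>2 * x0 - x1\<close>; its real part vanishes on the left end and on both sides.\<close>

lemma norm_le_in_wide_rectangle:
  fixes g :: "complex \<Rightarrow> complex"
  assumes g: "g holomorphic_on UNIV" and "y0 < y1" and p: "p = pi / (y1 - y0)" and b: "b = (y0 + y1) / 2" and E: "E \<ge> 0"
    and all: "\<And>x y. x \<in> {x0..x1} \<Longrightarrow> y \<in> {y0..y1} \<Longrightarrow> norm (g (Complex x y)) \<le> exp m"
    and right: "\<And>y. y \<in> {y0..y1} \<Longrightarrow> norm (g (Complex x1 y)) \<le> exp (m - E)"
    and xy: "x \<in> {x0..x1}" "y \<in> {y0..y1}"
  shows "norm (g (Complex x y)) \<le> exp (m - E * ((exp (- (p * (x1 - x))) - exp (- (p * (x + x1 - 2 * x0)))) * cos (p * (y - b))))"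
proof -
  define \<Phi> where "\<Phi> z = of_real m - of_real E *
    (exp (of_real p * (z - Complex x1 b)) - exp (of_real (- p) * (z - Complex (2 * x0 - x1) b)))" for z
  have Re: "Re (\<Phi> (Complex x y)) = m - E * ((exp (- (p * (x1 - x))) - exp (- (p * (x + x1 - 2 * x0)))) * cos (p * (y - b)))" for x y
  proof -
    have "p * (x - x1) = - (p * (x1 - x))" "x - (2 * x0 - x1) = x + x1 - 2 * x0" by (simp_all add: algebra_simps)
    then show ?thesis
      unfolding \<Phi>_def minus_complex.sel Re_of_real_mult Re_complex_of_real Re_exp_shift_neg Re_exp_shift
      by (simp add: left_diff_distrib)
  qed
  have "0 < p" using p \<open>y0 < y1\<close> by simp
  have arg: "\<bar>p * (y - b)\<bar> \<le> pi / 2" if y: "y \<in> {y0..y1}" for y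
  proof -
    have "\<bar>y - b\<bar> \<le> (y1 - y0) / 2" unfolding b by (rule abs_diff_midpoint_le[OF y])
    then have "p * \<bar>y - b\<bar> \<le> p * ((y1 - y0) / 2)" using \<open>0 < p\<close> by (intro mult_left_mono) auto
    also have "\<dots> = pi / 2" using p \<open>y0 < y1\<close> by simp
    finally show ?thesis using \<open>0 < p\<close> by (simp add: abs_mult)
  qed
  have "norm (g (Complex x y)) \<le> exp (Re (\<Phi> (Complex x y)))"
  proof (rule norm_le_exp_Re_on_rectangle[OF g _ _ xy])
    show "\<Phi> holomorphic_on UNIV" unfolding \<Phi>_def by (intro holomorphic_intros)
    fix x y assume x: "x \<in> {x0..x1}" and y: "y \<in> {y0..y1}" and bd: "x = x0 \<or> x = x1 \<or> y = y0 \<or> y = y1"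
    have c0: "0 \<le> cos (p * (y - b))" using arg[OF y] by (intro cos_ge_zero) auto
    consider "x = x0" | "x = x1" | "y = y0" | "y = y1" using bd by blast
    then show "norm (g (Complex x y)) \<le> exp (Re (\<Phi> (Complex x y)))"
    proof cases
      case 1
      have z: "exp (- (p * (x1 - x))) - exp (- (p * (x + x1 - 2 * x0))) = 0" unfolding 1 by (simp add: algebra_simps)
      show ?thesis unfolding Re z using all[OF x y] by simp
    next
      case 2
      have "(exp (- (p * (x1 - x))) - exp (- (p * (x + x1 - 2 * x0)))) * cos (p * (y - b)) \<le> 1 * 1"
        using c0 x \<open>0 < p\<close> unfolding 2 by (intro mult_mono) auto
      then have "E * ((exp (- (p * (x1 - x))) - exp (- (p * (x + x1 - 2 * x0)))) * cos (p * (y - b))) \<le> E * 1"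
        using E by (intro mult_left_mono) auto
      then have "exp (m - E) \<le> exp (Re (\<Phi> (Complex x y)))" unfolding Re by simp
      then show ?thesis using right[OF y] unfolding 2 by linarith
    next
      case 3
      have "p * (y - b) = - (pi / 2)" using p \<open>y0 < y1\<close> by (simp add: 3 b field_simps)
      then have "cos (p * (y - b)) = 0" by (simp only: cos_minus cos_pi_half)
      then show ?thesis unfolding Re using all[OF x y] by simp
    next
      case 4
      have "p * (y - b) = pi / 2" using p \<open>y0 < y1\<close> by (simp add: 4 b field_simps)
      then have "cos (p * (y - b)) = 0" by (simp only: cos_minus cos_pi_half)
      then show ?thesis unfolding Re using all[OF x y] by simp
    qed
  qed
  then show ?thesis unfolding Re .
qed

text \<open>The comparison function has a term with exponent \<open>p' < p\<close>, whose cosine stays positive on the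
  closed strip and so dominates the sides, and one with exponent \<open>p\<close>, which vanishes on the sides and on the
  left end and carries the decay; the latter wins because \<open>\<nu> - p > \<sigma> - p'\<close>.\<close>

lemma zero_in_strip_of_rapid_decay:
  fixes g :: "complex \<Rightarrow> complex"
  assumes g: "g holomorphic_on UNIV" and "y0 < y1" and p: "pi / (y1 - y0) \<le> \<sigma>" and "\<sigma> < \<nu>"
    and sides: "\<And>x. x0 \<le> x \<Longrightarrow> norm (g (Complex x y0)) \<le> exp (exp (\<sigma> * x)) \<and> norm (g (Complex x y1)) \<le> exp (exp (\<sigma> * x))"
    and arcs: "\<exists>\<^sub>F X in at_top. \<forall>y\<in>{y0..y1}. norm (g (Complex X y)) \<le> exp (- exp (\<nu> * X))"
    and x: "x0 < x" and y: "y0 < y" "y < y1"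
  shows "g (Complex x y) = 0"
proof (rule ccontr)
  assume nz: "g (Complex x y) \<noteq> 0"
  define p where "p = pi / (y1 - y0)"
  define b where "b = (y0 + y1) / 2"
  \<comment> \<open>The amount \<open>d\<close> keeps \<open>p' = p - d\<close> positive and, being
    less than \<open>\<nu> - \<sigma>\<close>, gives \<open>\<sigma> - p' < \<nu> - p\<close>, as
    \<open>\<sigma> - p' = \<sigma> - p + d\<close>.\<close>
  define d where "d = min (p / 2) ((\<nu> - \<sigma>) / 2)"
  define p' where "p' = p - d"
  define c where "c = cos (p' * ((y1 - y0) / 2))"
  have "0 < p" using \<open>y0 < y1\<close> by (simp add: p_def)
  then have d: "0 < d" "d \<le> p / 2" "d < \<nu> - \<sigma>" using \<open>\<sigma> < \<nu>\<close> by (auto simp: d_def min_def)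
  have p': "0 < p'" "p' < p" "\<sigma> - p' < \<nu> - p" "0 < \<sigma> - p'" using d \<open>0 < p\<close> p[folded p_def] unfolding p'_def by auto
  have half: "\<bar>k * (t - b)\<bar> \<le> k * ((y1 - y0) / 2)" if "t \<in> {y0..y1}" "0 < k" for k t
  proof -
    have "\<bar>t - b\<bar> \<le> (y1 - y0) / 2" unfolding b_def by (rule abs_diff_midpoint_le[OF that(1)])
    then show ?thesis using that by (simp add: abs_mult)
  qed
  have phalf: "p * ((y1 - y0) / 2) = pi / 2" using \<open>y0 < y1\<close> by (simp add: p_def)
  have p'half: "p' * ((y1 - y0) / 2) < pi / 2"
  proof -
    have "p' * ((y1 - y0) / 2) < p * ((y1 - y0) / 2)" using p' \<open>y0 < y1\<close> by (intro mult_strict_right_mono) auto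
    with phalf show ?thesis by linarith
  qed
  have "0 < c" unfolding c_def using p' p'half \<open>y0 < y1\<close> by (intro cos_gt_zero_pi) (auto intro: order.strict_trans[of _ 0])
  have cosc: "c \<le> cos (p' * (t - b))" if "t \<in> {y0..y1}" for t
  proof -
    have "c \<le> cos \<bar>p' * (t - b)\<bar>"
      unfolding c_def using half[OF that p'(1)] p'half pi_gt_zero by (intro cos_monotone_0_pi_le) linarith+
    then show ?thesis by simp
  qed
  have cos0: "0 \<le> cos (p * (t - b))" if "t \<in> {y0..y1}" for t
    using half[OF that \<open>0 < p\<close>] phalf by (intro cos_ge_zero) auto
  have "continuous_on {y0..y1} (\<lambda>t. g (Complex x0 t))"
    by (rule continuous_on_compose2[OF holomorphic_on_imp_continuous_on[OF g]])
       (auto simp: Complex_eq intro!: continuous_intros)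
  then have "bounded ((\<lambda>t. g (Complex x0 t)) ` {y0..y1})"
    by (intro compact_imp_bounded compact_continuous_image) auto
  then obtain M0 where M0: "M0 > 0" "\<And>t. t \<in> {y0..y1} \<Longrightarrow> norm (g (Complex x0 t)) \<le> M0"
    unfolding bounded_pos by auto
  define M where "M = max 0 (ln M0)"
  have M: "0 \<le> M" "norm (g (Complex x0 t)) \<le> exp M" if "t \<in> {y0..y1}" for t
  proof -
    have "exp (ln M0) \<le> exp M" by (subst exp_le_cancel_iff) (simp add: M_def)
    then have "M0 \<le> exp M" using M0(1) by simp
    then show "0 \<le> M" "norm (g (Complex x0 t)) \<le> exp M" using M0(2)[OF that] by (auto simp: M_def)
  qed
  \<comment> \<open>The decaying term at the fixed point, without its weight. It is positive in the
    interior of the strip, so as \<open>X\<close> grows \<open>k * exp ((\<nu> - p) * X)\<close>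
    overwhelms the other terms and the bound at the fixed point tends to 0.\<close>
  define k where "k = (exp (p * x) - exp (- (p * (x - 2 * x0)))) * cos (p * (y - b))"
  have "0 < k"
  proof -
    have "p * (x + x) > p * (x0 + x0)" using x \<open>0 < p\<close> by (intro mult_strict_left_mono) auto
    then have "exp (- (p * (x - 2 * x0))) < exp (p * x)" by (simp add: algebra_simps)
    moreover have "\<bar>y - b\<bar> < (y1 - y0) / 2" unfolding b_def by (rule abs_diff_midpoint_less[OF y])
    then have "\<bar>p * (y - b)\<bar> < pi / 2"
      using \<open>0 < p\<close> phalf mult_strict_left_mono[of "\<bar>y - b\<bar>" "(y1 - y0) / 2" p] by (simp add: abs_mult)
    then have "0 < cos (p * (y - b))" by (intro cos_gt_zero_pi) auto
    ultimately show ?thesis unfolding k_def by simp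
  qed
  have bound: "norm (g (Complex x y)) \<le> exp (M + exp (p' * x) / c * exp ((\<sigma> - p') * X) - k * exp ((\<nu> - p) * X))"
    if X: "x \<le> X" and arc: "\<forall>y\<in>{y0..y1}. norm (g (Complex X y)) \<le> exp (- exp (\<nu> * X))" for X
  proof -
    define \<Phi> where "\<Phi> z = of_real M + of_real (exp ((\<sigma> - p') * X) / c) * exp (of_real p' * (z - Complex 0 b))
       - of_real (exp ((\<nu> - p) * X)) * (exp (of_real p * (z - Complex 0 b)) - exp (of_real (- p) * (z - Complex (2 * x0) b)))" for z
    have Re: "Re (\<Phi> (Complex s t)) = M + exp ((\<sigma> - p') * X) / c * (exp (p' * s) * cos (p' * (t - b)))
      - exp ((\<nu> - p) * X) * ((exp (p * s) - exp (- (p * (s - 2 * x0)))) * cos (p * (t - b)))" for s t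
      unfolding \<Phi>_def minus_complex.sel plus_complex.sel Re_of_real_mult Re_complex_of_real Re_exp_shift_neg Re_exp_shift
      by (simp add: left_diff_distrib)
    have "norm (g (Complex x y)) \<le> exp (Re (\<Phi> (Complex x y)))"
    proof (rule norm_le_exp_Re_on_rectangle[OF g, of \<Phi> x0 X y0 y1])
      show "\<Phi> holomorphic_on UNIV" unfolding \<Phi>_def by (intro holomorphic_intros)
      fix s t assume s: "s \<in> {x0..X}" and t: "t \<in> {y0..y1}" and bd: "s = x0 \<or> s = X \<or> t = y0 \<or> t = y1"
      have second: "exp ((\<sigma> - p') * X + p' * s) \<le> exp ((\<sigma> - p') * X) / c * (exp (p' * s) * cos (p' * (t - b)))"
      proof -
        have "exp ((\<sigma> - p') * X + p' * s) = exp ((\<sigma> - p') * X) / c * (exp (p' * s) * c)"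
          using \<open>0 < c\<close> by (simp add: exp_add)
        also have "\<dots> \<le> exp ((\<sigma> - p') * X) / c * (exp (p' * s) * cos (p' * (t - b)))"
          using \<open>0 < c\<close> cosc[OF t] by (intro mult_left_mono) auto
        finally show ?thesis .
      qed
      have nonneg: "0 \<le> exp ((\<sigma> - p') * X) / c * (exp (p' * s) * cos (p' * (t - b)))"
        by (rule order.trans[OF _ second]) simp
      consider "s = x0" | "s = X" | "t = y0 \<or> t = y1" using bd by blast
      then show "norm (g (Complex s t)) \<le> exp (Re (\<Phi> (Complex s t)))"
      proof cases
        case 1
        have z: "exp (p * s) - exp (- (p * (s - 2 * x0))) = 0" unfolding 1 by (simp add: algebra_simps)
        have "M \<le> Re (\<Phi> (Complex s t))" unfolding Re z mult_zero_left mult_zero_right using nonneg by linarith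
        then have "exp M \<le> exp (Re (\<Phi> (Complex s t)))" by simp
        then show ?thesis using M(2)[OF t] unfolding 1 by linarith
      next
        case 2
        have "exp (p * s) * 1 \<ge> (exp (p * s) - exp (- (p * (s - 2 * x0)))) * cos (p * (t - b))"
          using cos0[OF t] by (intro mult_mono) auto
        then have "exp ((\<nu> - p) * X) * exp (p * s) \<ge> exp ((\<nu> - p) * X) * ((exp (p * s) - exp (- (p * (s - 2 * x0)))) * cos (p * (t - b)))"
          by (intro mult_left_mono) auto
        moreover have "exp ((\<nu> - p) * X) * exp (p * s) = exp (\<nu> * X)" unfolding 2 by (simp add: algebra_simps flip: exp_add)
        ultimately have "- exp (\<nu> * X) \<le> Re (\<Phi> (Complex s t))" unfolding Re using nonneg M(1)[OF t]
          by linarith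
        then have "exp (- exp (\<nu> * X)) \<le> exp (Re (\<Phi> (Complex s t)))" by simp
        then show ?thesis using bspec[OF arc t] unfolding 2 by linarith
      next
        case 3
        have "\<bar>t - b\<bar> = (y1 - y0) / 2" using 3 \<open>y0 < y1\<close> unfolding b_def by argo
        then have "\<bar>p * (t - b)\<bar> = pi / 2" using phalf \<open>0 < p\<close> by (simp only: abs_mult abs_of_pos)
        then have "cos \<bar>p * (t - b)\<bar> = 0" by (metis cos_pi_half)
        then have c0: "cos (p * (t - b)) = 0" by simp
        \<comment> \<open>Since \<open>s <= X\<close> and \<open>p' < \<sigma>\<close>, the weight
          \<open>exp ((\<sigma> - p') * X)\<close> lifts \<open>exp (p' * s)\<close> above the bound
          \<open>exp (\<sigma> * s)\<close> given on the sides.\<close>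
        have "\<sigma> * s \<le> (\<sigma> - p') * X + p' * s" using mult_left_mono[of s X "\<sigma> - p'"] s p' by (simp add: algebra_simps)
        then have "exp (\<sigma> * s) \<le> exp ((\<sigma> - p') * X + p' * s)" by simp
        then have "exp (\<sigma> * s) \<le> Re (\<Phi> (Complex s t))" unfolding Re c0 mult_zero_right using second M(1)[OF t] by linarith
        then have "exp (exp (\<sigma> * s)) \<le> exp (Re (\<Phi> (Complex s t)))" by simp
        moreover have "norm (g (Complex s t)) \<le> exp (exp (\<sigma> * s))" using 3 sides[of s] s by auto
        ultimately show ?thesis by linarith
      qed
    qed (use x y X in auto)
    also have "Re (\<Phi> (Complex x y)) \<le> M + exp (p' * x) / c * exp ((\<sigma> - p') * X) - k * exp ((\<nu> - p) * X)"
    proof -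
      have "exp ((\<sigma> - p') * X) / c * (exp (p' * x) * cos (p' * (y - b))) \<le> exp ((\<sigma> - p') * X) / c * (exp (p' * x) * 1)"
        using \<open>0 < c\<close> by (intro mult_left_mono) auto
      then show ?thesis unfolding Re k_def by (simp add: algebra_simps)
    qed
    finally show ?thesis by simp
  qed
  have "\<forall>\<^sub>F X in at_top. exp (p' * x) / c * exp ((\<sigma> - p') * X) + (M + 1 - ln (norm (g (Complex x y)))) \<le> k * exp ((\<nu> - p) * X)"
    using p' \<open>0 < k\<close> by (intro eventually_exp_dominates) auto
  moreover have "\<forall>\<^sub>F X in at_top. x \<le> X" by (rule eventually_ge_at_top)
  ultimately have "\<forall>\<^sub>F X in at_top. \<not> (\<forall>y\<in>{y0..y1}. norm (g (Complex X y)) \<le> exp (- exp (\<nu> * X)))"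
  proof eventually_elim
    case (elim X)
    show ?case
    proof
      assume "\<forall>y\<in>{y0..y1}. norm (g (Complex X y)) \<le> exp (- exp (\<nu> * X))"
      note bound[OF elim(2) this]
      also have "exp (M + exp (p' * x) / c * exp ((\<sigma> - p') * X) - k * exp ((\<nu> - p) * X)) < exp (ln (norm (g (Complex x y))))"
        using elim(1) by (subst exp_less_cancel_iff) linarith
      finally show False using nz by simp
    qed
  qed
  with arcs show False by (simp add: frequently_def)
qed

section \<open>Functions of finite order and good rays\<close>

text \<open>With \<open>r = exp x\<close> the bound is \<open>exp (r powr C)\<close> on the disc of
  radius \<open>r\<close>. For entire functions it follows from order less than \<open>C\<close> and
  implies order at most \<open>C\<close> when \<open>0 <= C\<close>, without iterated logarithms.
  Stating it on discs rather than circles lets it be applied at every point of smaller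
  modulus.\<close>

definition power_growth :: "(complex \<Rightarrow> complex) \<Rightarrow> real \<Rightarrow> bool" where
  "power_growth g C \<longleftrightarrow> (\<forall>\<^sub>F x in at_top. \<forall>z. norm z \<le> exp x \<longrightarrow> norm (g z) \<le> exp (exp (C * x)))"

text \<open>Passing to a larger exponent absorbs a constant factor, a square and the enlargement of
  the radius by the factor \<open>exp s\<close>; the closure properties below live on this
  slack.\<close>

lemma power_growth_shift:
  assumes "power_growth g C" "C < C'" "0 < C'"
  shows "\<forall>\<^sub>F x in at_top. \<forall>z. norm z \<le> exp (x + s) \<longrightarrow> b * exp (exp (C * (x + s))) * exp (exp (C * (x + s))) \<le> exp (exp (C' * x))
    \<and> norm (g z) \<le> exp (exp (C * (x + s)))"
proof -
  have "filterlim (\<lambda>x::real. x + s) at_top at_top"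
    using filterlim_tendsto_add_at_top[OF tendsto_const filterlim_ident, of s] by (simp add: add.commute)
  then have 1: "\<forall>\<^sub>F x in at_top. \<forall>z. norm z \<le> exp (x + s) \<longrightarrow> norm (g z) \<le> exp (exp (C * (x + s)))"
    using assms(1) unfolding power_growth_def by (rule eventually_compose_filterlim[rotated])
  have "\<forall>\<^sub>F x in at_top. (2 * exp (C * s)) * exp (C * x) + ln (max 1 b) \<le> 1 * exp (C' * x)"
    using assms by (intro eventually_exp_dominates) auto
  with 1 show ?thesis
  proof eventually_elim
    case (elim x)
    have "b * exp (exp (C * (x + s))) * exp (exp (C * (x + s))) \<le> exp (ln (max 1 b)) * (exp (exp (C * (x + s))) * exp (exp (C * (x + s))))"
      by (simp add: mult_right_mono)
    also have "\<dots> = exp ((2 * exp (C * s)) * exp (C * x) + ln (max 1 b))"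
      unfolding exp_add[symmetric] by (simp add: exp_add[symmetric] algebra_simps)
    also have "\<dots> \<le> exp (exp (C' * x))" using elim by simp
    finally show ?case using elim by auto
  qed
qed

lemma power_growth_mono:
  assumes "power_growth g C" "C \<le> C'"
  shows "power_growth g C'"
  using assms(1) eventually_ge_at_top[of 0] unfolding power_growth_def
proof eventually_elim
  case (elim x)
  have "exp (exp (C * x)) \<le> exp (exp (C' * x))" using elim(2) assms(2) by (simp add: mult_right_mono)
  then show ?case using elim(1) by (auto intro: order_trans)
qed

lemma power_growth_mult:
  assumes "power_growth g C" "power_growth h C" "C < C'" "0 < C'"
  shows "power_growth (\<lambda>z. g z * h z) C'"
  using power_growth_shift[OF assms(1,3,4), of 0 1] power_growth_shift[OF assms(2-4), of 0 1]
  unfolding power_growth_def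
proof eventually_elim
  case (elim x)
  show ?case
  proof (intro allI impI)
    fix z :: complex assume z: "norm z \<le> exp x"
    have "norm (g z * h z) \<le> exp (exp (C * x)) * exp (exp (C * x))"
      using elim z unfolding norm_mult by (intro mult_mono) auto
    also have "\<dots> \<le> exp (exp (C' * x))" using elim z by auto
    finally show "norm (g z * h z) \<le> exp (exp (C' * x))" .
  qed
qed

lemma norm_deriv_le_entire:
  fixes g :: "complex \<Rightarrow> complex"
  assumes "g holomorphic_on UNIV" "0 < r" "\<And>w. dist z w = r \<Longrightarrow> norm (g w) \<le> B"
  shows "norm (deriv g z) \<le> B / r"
proof -
  have "norm ((deriv ^^ 1) g z) \<le> fact 1 * B / r ^ 1"
  proof (rule Cauchy_inequality)
    show "g holomorphic_on ball z r" using assms(1) holomorphic_on_subset by blast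
    show "continuous_on (cball z r) g"
      using assms(1) holomorphic_on_imp_continuous_on holomorphic_on_subset by blast
  qed (use assms in \<open>auto simp: dist_norm\<close>)
  then show ?thesis by simp
qed

lemma exp_add_one_le: "0 \<le> x \<Longrightarrow> exp x + 1 \<le> exp (x + (1::real))"
proof -
  assume "0 \<le> x"
  have "2 \<le> exp (1::real)" using exp_ge_add_one_self[of 1] by simp
  then have "exp x * 2 \<le> exp x * exp 1" by (intro mult_left_mono) auto
  moreover have "1 \<le> exp x" using \<open>0 \<le> x\<close> by simp
  ultimately show ?thesis unfolding exp_add by linarith
qed

lemma two_power_le_exp: "2 ^ n \<le> exp (real n)"
proof -
  have "2 \<le> exp (1::real)" using exp_ge_add_one_self[of 1] by simp
  then have "2 ^ n \<le> exp (1::real) ^ n" by (intro power_mono) auto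
  then show ?thesis by (simp flip: exp_of_nat_mult)
qed

lemma power_growth_deriv:
  assumes g: "g holomorphic_on UNIV" and "power_growth g C" "C < C'" "0 < C'"
  shows "power_growth (deriv g) C'"
  using power_growth_shift[OF assms(2-4), of 1 1] eventually_ge_at_top[of 0] unfolding power_growth_def
proof eventually_elim
  case (elim x)
  show ?case
  proof (intro allI impI)
    fix z :: complex assume z: "norm z \<le> exp x"
    have *: "norm w \<le> exp (x + 1)" if "dist z w = 1" for w
    proof -
      have "norm w \<le> norm z + 1" using norm_triangle_ineq2[of w z] that by (simp add: dist_norm norm_minus_commute)
      then show ?thesis using z exp_add_one_le[OF elim(2)] by linarith
    qed
    have "norm (deriv g z) \<le> exp (exp (C * (x + 1))) / 1"
      using elim(1) * by (intro norm_deriv_le_entire[OF g]) auto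
    also have "\<dots> \<le> 1 * exp (exp (C * (x + 1))) * exp (exp (C * (x + 1)))" by simp
    \<comment> \<open>The inequality between the two bounds stands under the quantifier over
      \<open>z\<close>; the point 0 serves to extract it.\<close>
    also have "\<dots> \<le> exp (exp (C' * x))" using elim(1) by (auto dest: spec[of _ 0])
    finally show "norm (deriv g z) \<le> exp (exp (C' * x))" .
  qed
qed

text \<open>Brings a growth bound into the form \<open>norm (g c) * exp L\<close> that the
  factorisation around \<open>c\<close> requires. The shift \<open>s\<close> makes room for a disc
  centred at \<open>c\<close> instead of 0, and \<open>k\<close> for the numerical factors that
  multiply \<open>L\<close> later.\<close>

lemma power_growth_relative:
  assumes "power_growth g C" "C < C'" "0 < C'" "g c \<noteq> 0" "0 < k"
  shows "\<forall>\<^sub>F x in at_top. \<exists>L>0. k * L \<le> exp (C' * x) \<and> norm c \<le> exp x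
     \<and> (\<forall>z. norm z \<le> exp (x + s) \<longrightarrow> norm (g z) \<le> norm (g c) * exp L)"
proof -
  have "\<forall>\<^sub>F x in at_top. (k * exp (C * s)) * exp (C * x) + k * (\<bar>ln (norm (g c))\<bar> + 1) \<le> 1 * exp (C' * x)"
    using assms by (intro eventually_exp_dominates) auto
  moreover have "\<forall>\<^sub>F x in at_top. ln (norm c + 1) \<le> x" by (rule eventually_ge_at_top)
  ultimately show ?thesis using power_growth_shift[OF assms(1-3), of s 1]
  proof eventually_elim
    case (elim x)
    define L where "L = exp (C * (x + s)) + \<bar>ln (norm (g c))\<bar> + 1"
    have "0 < L" unfolding L_def by (intro add_nonneg_pos add_nonneg_nonneg) auto
    moreover have "k * L = (k * exp (C * s)) * exp (C * x) + k * (\<bar>ln (norm (g c))\<bar> + 1)"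
      unfolding L_def by (simp add: algebra_simps exp_add)
    then have "k * L \<le> exp (C' * x)" using elim(1) by simp
    moreover have "norm c \<le> exp x"
    proof -
      have "0 < norm c + 1" by (simp add: add_nonneg_pos)
      then have "norm c + 1 = exp (ln (norm c + 1))" by simp
      also have "\<dots> \<le> exp x" using elim(2) by (subst exp_le_cancel_iff)
      finally show ?thesis by simp
    qed
    moreover have "norm (g z) \<le> norm (g c) * exp L" if "norm z \<le> exp (x + s)" for z
    proof -
      have "norm (g z) \<le> exp (exp (C * (x + s)))" using elim(3) that by auto
      also have "\<dots> \<le> exp (ln (norm (g c)) + L)" unfolding L_def by (subst exp_le_cancel_iff) linarith
      also have "\<dots> = norm (g c) * exp L" using assms(4) by (simp add: exp_add)
      finally show ?thesis .
    qed
    ultimately show ?case by blast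
  qed
qed

text \<open>Once \<open>norm c <= exp x\<close>, the disc \<open>norm a <= exp x\<close> lies in the
  disc of radius \<open>2 * exp x\<close> around \<open>c\<close>, whose zeros number at most
  \<open>2 * L\<close>. The bound on \<open>g\<close> is needed on the disc of radius
  \<open>6 * exp x\<close> around \<open>c\<close>, hence up to modulus
  \<open>7 * exp x <= exp (x + 3)\<close>.\<close>

lemma zero_count_power_growth:
  assumes g: "g holomorphic_on UNIV" and gc: "g c \<noteq> 0" and pg: "power_growth g C" "C < C'" "0 < C'"
  shows "\<forall>\<^sub>F x in at_top. finite {a. norm a \<le> exp x \<and> g a = 0} \<and> real (card {a. norm a \<le> exp x \<and> g a = 0}) \<le> exp (C' * x)"
  using power_growth_relative[OF pg gc, of 2 3, OF zero_less_numeral]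
proof (elim eventually_mono)
  fix x :: real
  assume "\<exists>L>0. 2 * L \<le> exp (C' * x) \<and> norm c \<le> exp x
     \<and> (\<forall>z. norm z \<le> exp (x + 3) \<longrightarrow> norm (g z) \<le> norm (g c) * exp L)"
  then obtain L where L: "L > 0" "2 * L \<le> exp (C' * x)" "norm c \<le> exp x"
    "\<And>z. norm z \<le> exp (x + 3) \<Longrightarrow> norm (g z) \<le> norm (g c) * exp L" by blast
  have e2: "7 \<le> exp (3::real)" using two_power_le_exp[of 3] by simp
  have M: "norm (g z) \<le> norm (g c) * exp L" if "z \<in> cball c (6 * exp x)" for z
  proof (rule L(4))
    have "norm z \<le> 7 * exp x" using that L(3) norm_triangle_ineq2[of z c] by (simp add: dist_norm norm_minus_commute)
    also have "\<dots> \<le> exp 3 * exp x" using e2 by (intro mult_right_mono) auto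
    finally show "norm z \<le> exp (x + 3)" by (simp add: exp_add mult.commute)
  qed
  obtain as G where as: "set as = {z \<in> cball c (2*exp x). g z = 0}" "real (length as) \<le> 2 * L"
    by (rule entire_factor_zeros[OF g exp_gt_zero gc, of x L]) (use M in blast)+
  have sub: "{a. norm a \<le> exp x \<and> g a = 0} \<subseteq> set as"
  proof
    fix a assume a: "a \<in> {a. norm a \<le> exp x \<and> g a = 0}"
    have "dist c a \<le> norm c + norm a" by (simp add: dist_norm norm_triangle_ineq4)
    then show "a \<in> set as" using a as(1) L(3) by auto
  qed
  have "real (card {a. norm a \<le> exp x \<and> g a = 0}) \<le> real (length as)"
    using card_mono[OF _ sub] card_length[of as] by simp
  then show "finite {a. norm a \<le> exp x \<and> g a = 0} \<and> real (card {a. norm a \<le> exp x \<and> g a = 0}) \<le> exp (C' * x)"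
    using finite_subset[OF sub] as(2) L(2) by auto
qed

text \<open>The bound in terms of the zero distance, taken with radius \<open>3 * exp x\<close>
  around \<open>c\<close>; its largest disc reaches to modulus
  \<open>19 * exp x <= exp (x + 5)\<close>. The constant 26 collects the terms \<open>2 * L\<close>
  and \<open>24 * L\<close>.\<close>

lemma log_deriv_power_growth:
  assumes g: "g holomorphic_on UNIV" and gc: "g c \<noteq> 0" and pg: "power_growth g C" "C < C'" "0 < C'" and "0 \<le> K"
  shows "\<forall>\<^sub>F x in at_top. \<forall>z. norm z = exp x \<longrightarrow> (\<forall>a. g a = 0 \<longrightarrow> exp (- (K * x)) \<le> norm (z - a)) \<longrightarrow>
     norm (deriv g z) \<le> exp ((C' + K) * x) * norm (g z)"
  using power_growth_relative[OF pg gc, of 26 5, OF zero_less_numeral] eventually_gt_at_top[of 0]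
proof eventually_elim
  case (elim x)
  then obtain L where L: "L > 0" "26 * L \<le> exp (C' * x)" "norm c \<le> exp x"
    "\<And>z. norm z \<le> exp (x + 5) \<Longrightarrow> norm (g z) \<le> norm (g c) * exp L" by auto
  have e4: "19 \<le> exp (5::real)" using two_power_le_exp[of 5] by simp
  have M: "norm (g z) \<le> norm (g c) * exp L" if "z \<in> cball c (6 * (3 * exp x))" for z
  proof (rule L(4))
    have "norm z \<le> 19 * exp x" using that L(3) norm_triangle_ineq2[of z c] by (simp add: dist_norm norm_minus_commute)
    also have "\<dots> \<le> exp 5 * exp x" using e4 by (intro mult_right_mono) auto
    finally show "norm z \<le> exp (x + 5)" by (simp add: exp_add mult.commute)
  qed
  show ?case
  proof (intro allI impI)
    fix z assume z: "norm z = exp x" and d: "\<forall>a. g a = 0 \<longrightarrow> exp (- (K * x)) \<le> norm (z - a)"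
    have zc: "z \<in> ball c (3 * exp x)"
    proof -
      have "dist c z \<le> exp x + exp x" using norm_triangle_ineq4[of c z] L(3) z by (simp add: dist_norm)
      then show ?thesis by (simp add: less_le_trans order.strict_trans1)
    qed
    have "norm (deriv g z) \<le> (2 * L / exp (- (K * x)) + 24 * L / (3 * exp x)) * norm (g z)"
      by (rule norm_deriv_le_of_zero_distance[OF g _ L(1) _ gc M zc]) (use d in auto)
    also have "\<dots> \<le> exp ((C' + K) * x) * norm (g z)"
    proof (intro mult_right_mono)
      have K1: "1 \<le> exp (K * x)" using elim(2) \<open>0 \<le> K\<close> by simp
      have "1 \<le> exp x" using elim(2) by simp
      then have "1 \<le> 3 * exp x" by linarith
      then have "24 * L / (3 * exp x) \<le> 24 * L / 1" using L(1) by (intro divide_left_mono) auto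
      also have "\<dots> \<le> 24 * L * exp (K * x)" using L(1) K1 by simp
      finally have "2 * L / exp (- (K * x)) + 24 * L / (3 * exp x) \<le> 26 * L * exp (K * x)"
        by (simp add: exp_minus divide_simps)
      also have "\<dots> \<le> exp (C' * x) * exp (K * x)" using L(2) by (intro mult_right_mono) auto
      finally show "2 * L / exp (- (K * x)) + 24 * L / (3 * exp x) \<le> exp ((C' + K) * x)"
        by (simp add: distrib_right exp_add)
    qed auto
    finally show "norm (deriv g z) \<le> exp ((C' + K) * x) * norm (g z)" .
  qed
qed

section \<open>Rays that stay away from the zeros\<close>

lemma interval_not_covered:
  fixes F :: "nat \<Rightarrow> real set"
  assumes F: "\<And>j. F j \<in> sets lborel" "\<And>j. emeasure lborel (F j) \<le> ennreal (c j)" "\<And>j. 0 \<le> c j"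
    and s: "c sums s" "s < \<beta> - \<alpha>"
  shows "\<exists>\<theta>\<in>{\<alpha><..<\<beta>}. \<forall>j. \<theta> \<notin> F j"
proof (rule ccontr)
  assume "\<not> ?thesis"
  then have "{\<alpha><..<\<beta>} \<subseteq> (\<Union>j. F j)" by auto
  then have "emeasure lborel {\<alpha><..<\<beta>} \<le> emeasure lborel (\<Union>j. F j)"
    using F(1) by (intro emeasure_mono) auto
  also have "\<dots> \<le> (\<Sum>j. emeasure lborel (F j))" using F(1) by (intro emeasure_subadditive_countably) auto
  also have "\<dots> \<le> (\<Sum>j. ennreal (c j))" using F(2) by (intro suminf_le) auto
  also have "\<dots> = ennreal s" using suminf_ennreal_eq[OF F(3) s(1)] .
  finally have le: "emeasure lborel {\<alpha><..<\<beta>} \<le> ennreal s" .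
  have "0 \<le> s" using F(3) s(1) sums_unique suminf_nonneg sums_summable by metis
  then have "\<alpha> \<le> \<beta>" using s(2) by linarith
  then have "ennreal (\<beta> - \<alpha>) \<le> ennreal s" using le by simp
  then show False using s(2) \<open>0 \<le> s\<close> by (simp add: ennreal_le_iff)
qed

lemma abs_sin_ge_half:
  fixes t :: real assumes "\<bar>t\<bar> \<le> 1" shows "\<bar>t\<bar> / 2 \<le> \<bar>sin t\<bar>"
proof -
  have *: "t / 2 \<le> sin t" if t: "0 \<le> t" "t \<le> 1" for t :: real
  proof -
    have "sin 0 - 0 / 2 \<le> sin t - t / 2"
    proof (rule DERIV_nonneg_imp_nondecreasing[OF t(1)])
      fix u :: real assume u: "0 \<le> u" "u \<le> t"
      have "cos (pi / 3) \<le> cos u" using u t pi_gt3 by (intro cos_monotone_0_pi_le) auto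
      then have "0 \<le> cos u - 1 / 2" by (simp add: cos_60)
      moreover have "((\<lambda>t. sin t - t / 2) has_real_derivative cos u - 1 / 2) (at u)"
        by (auto intro!: derivative_eq_intros)
      ultimately show "\<exists>D. ((\<lambda>t. sin t - t / 2) has_real_derivative D) (at u) \<and> 0 \<le> D" by blast
    qed
    then show ?thesis by simp
  qed
  show ?thesis using *[of t] *[of "- t"] assms by (cases "0 \<le> t") auto
qed

text \<open>The distance from a point of the first ray to the line of the second is
  \<open>exp x * \<bar>sin (\<theta> - \<theta>')\<bar>\<close>, visible as an imaginary part after
  rotation by \<open>- \<theta>'\<close>; it is below \<open>2 * \<delta>\<close> if both points lie
  near \<open>a\<close>. It remains to use \<open>1 <= exp x\<close> and that the sine is at least
  half its argument.\<close>

lemma angles_near_point: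
  fixes a :: complex
  assumes "\<bar>\<theta> - \<theta>'\<bar> \<le> 1" "0 \<le> x" "norm (exp (Complex x \<theta>) - a) < \<delta>" "norm (exp (Complex x' \<theta>') - a) < \<delta>"
  shows "\<bar>\<theta> - \<theta>'\<bar> \<le> 4 * \<delta>"
proof -
  let ?w = "(exp (Complex x \<theta>) - exp (Complex x' \<theta>')) * exp (Complex 0 (- \<theta>'))"
  have "Im ?w = exp x * sin (\<theta> - \<theta>')"
    by (simp add: left_diff_distrib flip: exp_add) (simp add: Im_exp)
  then have "exp x * \<bar>sin (\<theta> - \<theta>')\<bar> = \<bar>Im ?w\<bar>" by (simp add: abs_mult)
  also have "\<dots> \<le> norm ?w" by (rule abs_Im_le_cmod)
  also have "\<dots> = norm (exp (Complex x \<theta>) - exp (Complex x' \<theta>'))" by (simp add: norm_mult)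
  also have "\<dots> < 2 * \<delta>" using norm_triangle_ineq4[of "exp (Complex x \<theta>) - a" "exp (Complex x' \<theta>') - a"] assms by simp
  finally have "exp x * \<bar>sin (\<theta> - \<theta>')\<bar> < 2 * \<delta>" .
  moreover have "1 * \<bar>sin (\<theta> - \<theta>')\<bar> \<le> exp x * \<bar>sin (\<theta> - \<theta>')\<bar>" using assms(2) by (intro mult_right_mono) auto
  ultimately have "\<bar>\<theta> - \<theta>'\<bar> / 2 < 2 * \<delta>" using abs_sin_ge_half[OF assms(1)] by (simp only: mult_1)
  then show ?thesis by simp
qed

text \<open>A Borel-Cantelli argument: the rays passing too close to a point of \<open>Z\<close> at height \<open>x \<ge> J\<close> have angles
  in a set whose measure is summable and tends to 0 with \<open>J\<close>.\<close>

lemma exists_ray_avoiding: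
  fixes Z :: "complex set"
  assumes count: "\<forall>\<^sub>F x in at_top. finite {a\<in>Z. norm a \<le> exp x} \<and> real (card {a\<in>Z. norm a \<le> exp x}) \<le> exp (K * x)"
    and "0 < K" and "\<alpha> < \<beta>"
  shows "\<exists>\<theta>\<in>{\<alpha><..<\<beta>}. \<forall>\<^sub>F x in at_top. \<forall>a\<in>Z. exp (- ((K + 1) * x)) \<le> norm (exp (Complex x \<theta>) - a)"
proof -
  \<comment> \<open>The interval is shortened to length at most 1 because the sine is compared with
    its argument only for arguments up to 1.\<close>
  define \<beta>' where "\<beta>' = min \<beta> (\<alpha> + 1)"
  have \<beta>': "\<alpha> < \<beta>'" "\<beta>' \<le> \<beta>" "\<beta>' - \<alpha> \<le> 1" using \<open>\<alpha> < \<beta>\<close> unfolding \<beta>'_def by auto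
  define q where "q = exp (- 1 :: real)"
  have q: "0 < q" "q < 1" unfolding q_def by auto
  \<comment> \<open>\<open>c * q ^ J\<close> is the total measure allowed for the excluded angles:
    for each \<open>j\<close> there are at most \<open>exp (K * (j + J + 2))\<close> intervals of
    length \<open>8 * \<delta> j\<close>, which amounts to
    \<open>8 * exp (2 * K) * q ^ (j + J)\<close>.\<close>
  define c where "c = 8 * exp (2 * K) / (1 - q)"
  have "(\<lambda>J. c * q ^ J) \<longlonglongrightarrow> c * 0" using q by (intro tendsto_intros LIMSEQ_power_zero) auto
  then have ev: "\<forall>\<^sub>F J in sequentially. c * q ^ J < \<beta>' - \<alpha>" using \<beta>' by (intro order_tendstoD(2)) auto
  obtain x0 where x0: "\<And>x. x0 \<le> x \<Longrightarrow> finite {a\<in>Z. norm a \<le> exp x} \<and> real (card {a\<in>Z. norm a \<le> exp x}) \<le> exp (K * x)"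
    using count unfolding eventually_at_top_linorder by blast
  have "\<forall>\<^sub>F J in sequentially. x0 \<le> real J" by real_asymp
  then have "\<forall>\<^sub>F J in sequentially. c * q ^ J < \<beta>' - \<alpha> \<and> x0 \<le> real J"
    using ev by eventually_elim auto
  then obtain J where J: "c * q ^ J < \<beta>' - \<alpha>" "x0 \<le> real J" by (auto simp: eventually_sequentially)
  define \<delta> where "\<delta> j = exp (- ((K + 1) * real (j + J)))" for j
  \<comment> \<open>The radius leaves room for points close to the ray: for
    \<open>0 <= x <= j + J + 1\<close> a point within distance 1 of
    \<open>exp (Complex x \<theta>)\<close> has modulus at most
    \<open>exp x + 1 <= exp (x + 1)\<close>.\<close>
  define Zj where "Zj j = {a\<in>Z. norm a \<le> exp (real (j + J) + 2)}" for j
  define T where "T j a = {\<theta>\<in>{\<alpha><..<\<beta>'}. \<exists>x\<in>{real (j + J)..real (j + J) + 1}. norm (exp (Complex x \<theta>) - a) < \<delta> j}" for j a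
  have "\<exists>lo. T j a \<subseteq> {lo - 4 * \<delta> j..lo + 4 * \<delta> j}" for j a
  proof (cases "T j a = {}")
    case False
    then obtain lo where lo: "lo \<in> T j a" by blast
    have "\<bar>\<theta> - lo\<bar> \<le> 4 * \<delta> j" if \<theta>: "\<theta> \<in> T j a" for \<theta>
    proof -
      obtain x x' where "x \<in> {real (j + J)..real (j + J) + 1}" "norm (exp (Complex x \<theta>) - a) < \<delta> j"
         "norm (exp (Complex x' lo) - a) < \<delta> j" using lo \<theta> unfolding T_def by blast
      moreover have "\<bar>\<theta> - lo\<bar> \<le> 1" using lo \<theta> \<beta>'(3) unfolding T_def by auto
      ultimately show ?thesis by (intro angles_near_point[of \<theta> lo x a "\<delta> j" x']) auto
    qed
    then have "T j a \<subseteq> {lo - 4 * \<delta> j..lo + 4 * \<delta> j}" by (fastforce simp: abs_le_iff algebra_simps)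
    then show ?thesis ..
  qed auto
  then obtain lo where lo: "\<And>j a. T j a \<subseteq> {lo j a - 4 * \<delta> j..lo j a + 4 * \<delta> j}" by metis
  define F where "F j = (\<Union>a\<in>Zj j. {lo j a - 4 * \<delta> j..lo j a + 4 * \<delta> j})" for j
  have finZ: "finite (Zj j)" "real (card (Zj j)) \<le> exp (K * (real (j + J) + 2))" for j
    using x0[of "real (j + J) + 2"] J(2) unfolding Zj_def by auto
  have "\<exists>\<theta>\<in>{\<alpha><..<\<beta>'}. \<forall>j. \<theta> \<notin> F j"
  proof (rule interval_not_covered)
    show "F j \<in> sets lborel" for j unfolding F_def using finZ(1) by (intro sets.finite_UN) auto
    show "emeasure lborel (F j) \<le> ennreal (8 * exp (2 * K) * q ^ J * q ^ j)" for j
    proof -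
      have "emeasure lborel (F j) \<le> (\<Sum>a\<in>Zj j. emeasure lborel {lo j a - 4 * \<delta> j..lo j a + 4 * \<delta> j})"
        unfolding F_def using finZ(1) by (intro emeasure_subadditive_finite) auto
      also have "\<dots> = (\<Sum>a\<in>Zj j. ennreal (8 * \<delta> j))" by (intro sum.cong) (auto simp: \<delta>_def)
      also have "\<dots> = ennreal (real (card (Zj j)) * (8 * \<delta> j))" by (simp add: \<delta>_def ennreal_mult' ennreal_of_nat_eq_real_of_nat)
      also have "\<dots> \<le> ennreal (exp (K * (real (j + J) + 2)) * (8 * \<delta> j))"
        using finZ(2)[of j] by (intro ennreal_leI mult_right_mono) (auto simp: \<delta>_def)
      also have "exp (K * (real (j + J) + 2)) * (8 * \<delta> j) = 8 * exp (2 * K) * q ^ J * q ^ j"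
      proof -
        have "q ^ J * q ^ j = exp (- real (j + J))" unfolding q_def
          by (simp add: exp_of_nat_mult[symmetric] exp_add[symmetric])
        then show ?thesis unfolding \<delta>_def by (simp add: mult.assoc exp_add[symmetric] mult.left_commute)
           (simp add: algebra_simps)
      qed
      finally show ?thesis .
    qed
    show "(\<lambda>j. 8 * exp (2 * K) * q ^ J * q ^ j) sums (8 * exp (2 * K) * q ^ J * (1 / (1 - q)))"
      using q by (intro sums_mult geometric_sums) auto
    show "8 * exp (2 * K) * q ^ J * (1 / (1 - q)) < \<beta>' - \<alpha>" using J(1) by (simp add: c_def mult.commute)
  qed (use q in auto)
  then obtain \<theta> where \<theta>: "\<theta> \<in> {\<alpha><..<\<beta>'}" "\<And>j. \<theta> \<notin> F j" by blast
  have "\<forall>\<^sub>F x in at_top. \<forall>a\<in>Z. exp (- ((K + 1) * x)) \<le> norm (exp (Complex x \<theta>) - a)"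
    using eventually_ge_at_top[of "real J"]
  proof eventually_elim
    case (elim x)
    define j where "j = nat \<lfloor>x\<rfloor> - J"
    have "0 \<le> x" using elim by (meson of_nat_0_le_iff order_trans)
    have "J \<le> nat \<lfloor>x\<rfloor>" using elim by (simp add: le_nat_floor)
    then have jx: "real (j + J) \<le> x" "x \<le> real (j + J) + 1" unfolding j_def using \<open>0 \<le> x\<close> by simp_all
    show ?case
    proof (intro ballI)
      fix a assume a: "a \<in> Z"
      show "exp (- ((K + 1) * x)) \<le> norm (exp (Complex x \<theta>) - a)"
      proof (rule ccontr)
        assume "\<not> ?thesis"
        then have lt: "norm (exp (Complex x \<theta>) - a) < exp (- ((K + 1) * x))" by simp
        also have "\<dots> \<le> \<delta> j" unfolding \<delta>_def using jx \<open>0 < K\<close> by simp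
        finally have T: "\<theta> \<in> T j a" using \<theta>(1) jx unfolding T_def by auto
        have "norm a \<le> exp x + exp (- ((K + 1) * x))"
          using lt norm_triangle_ineq3[of "exp (Complex x \<theta>)" a] by (simp add: abs_le_iff)
        also have "\<dots> \<le> exp x + 1" using \<open>0 \<le> x\<close> \<open>0 < K\<close> by simp
        also have "\<dots> \<le> exp (x + 1)" by (rule exp_add_one_le[OF \<open>0 \<le> x\<close>])
        also have "\<dots> \<le> exp (real (j + J) + 2)" using jx by simp
        finally have "a \<in> Zj j" using a unfolding Zj_def by simp
        with T lo[of j a] have "\<theta> \<in> F j" unfolding F_def by blast
        with \<theta>(2) show False by blast
      qed
    qed
  qed
  with \<theta>(1) \<beta>'(2) show ?thesis by (intro bexI[of _ \<theta>]) auto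
qed

text \<open>A ray avoiding the zeros of the product \<open>f * f'\<close> keeps away from those of
  both factors, so both logarithmic derivative bounds hold on it. The exponent \<open>K\<close> is
  fixed before the interval is given: the fineness of a net of such rays is later chosen in terms of
  \<open>K\<close>.\<close>

lemma exists_good_ray:
  fixes f :: "complex \<Rightarrow> complex"
  assumes f: "f holomorphic_on UNIV" "power_growth f C" "0 < C" and nz: "f c \<noteq> 0" "deriv f c' \<noteq> 0"
  shows "\<exists>K>0. \<forall>\<alpha> \<beta>. \<alpha> < \<beta> \<longrightarrow> (\<exists>\<theta>\<in>{\<alpha><..<\<beta>}. \<forall>\<^sub>F x in at_top.
     f (exp (Complex x \<theta>)) \<noteq> 0 \<and>
     norm (deriv f (exp (Complex x \<theta>))) \<le> exp (K * x) * norm (f (exp (Complex x \<theta>))) \<and>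
     norm (deriv (deriv f) (exp (Complex x \<theta>))) \<le> exp (K * x) * norm (deriv f (exp (Complex x \<theta>))))"
proof -
  have df: "deriv f holomorphic_on UNIV" using f(1) holomorphic_deriv by blast
  have pgd: "power_growth (deriv f) (C + 1)" using power_growth_deriv[OF f(1,2)] f(3) by simp
  have pgf: "power_growth f (C + 1)" using power_growth_mono[OF f(2)] by simp
  define g where "g z = f z * deriv f z" for z
  have g: "g holomorphic_on UNIV" unfolding g_def by (intro holomorphic_intros f(1) df)
  have pgg: "power_growth g (C + 2)" unfolding g_def
    using power_growth_mult[OF pgf pgd] f(3) by simp
  \<comment> \<open>If the product vanished identically, \<open>f'\<close> would vanish near a point
    where \<open>f\<close> does not, hence everywhere.\<close>
  have "\<exists>c. g c \<noteq> 0"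
  proof (rule ccontr)
    assume "\<not> ?thesis"
    then have 0: "f z * deriv f z = 0" for z unfolding g_def by auto
    have *: "f z = 0 \<or> deriv f z = 0" for z using 0[of z] by auto
    obtain r where r: "r > 0" "\<And>z. dist c z < r \<Longrightarrow> f z \<noteq> 0"
      using continuous_at_avoid[of c f 0] holomorphic_on_imp_continuous_on[OF f(1)] nz(1)
      by (metis continuous_on_eq_continuous_at open_UNIV UNIV_I)
    have "deriv f c' = 0"
    proof (rule analytic_continuation_open[of "ball c r" UNIV "deriv f" "\<lambda>_. 0"])
      show "deriv f z = 0" if "z \<in> ball c r" for z using * r(2) that by auto
    qed (use r(1) df in auto)
    with nz(2) show False by blast
  qed
  then obtain d where d: "g d \<noteq> 0" by blast
  define K1 where "K1 = C + 3"
  define K where "K = C + 2 + (K1 + 1)"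
  have "0 < K1" "0 < K" using f(3) unfolding K1_def K_def by auto
  have cnt: "\<forall>\<^sub>F x in at_top. finite {a\<in>{a. g a = 0}. norm a \<le> exp x} \<and> real (card {a\<in>{a. g a = 0}. norm a \<le> exp x}) \<le> exp (K1 * x)"
    using zero_count_power_growth[OF g d pgg, of K1] f(3) unfolding K1_def by (simp add: conj_commute)
  have l1: "\<forall>\<^sub>F x in at_top. \<forall>z. norm z = exp x \<longrightarrow> (\<forall>a. f a = 0 \<longrightarrow> exp (- ((K1 + 1) * x)) \<le> norm (z - a)) \<longrightarrow>
     norm (deriv f z) \<le> exp (K * x) * norm (f z)"
    unfolding K_def by (rule log_deriv_power_growth[OF f(1) nz(1) pgf]) (use f(3) in \<open>auto simp: K1_def\<close>)
  have l2: "\<forall>\<^sub>F x in at_top. \<forall>z. norm z = exp x \<longrightarrow> (\<forall>a. deriv f a = 0 \<longrightarrow> exp (- ((K1 + 1) * x)) \<le> norm (z - a)) \<longrightarrow>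
     norm (deriv (deriv f) z) \<le> exp (K * x) * norm (deriv f z)"
    unfolding K_def by (rule log_deriv_power_growth[OF df nz(2) pgd]) (use f(3) in \<open>auto simp: K1_def\<close>)
  show ?thesis
  proof (intro exI[of _ K] conjI allI impI \<open>0 < K\<close>)
    fix \<alpha> \<beta> :: real assume "\<alpha> < \<beta>"
    then obtain \<theta> where \<theta>: "\<theta> \<in> {\<alpha><..<\<beta>}"
      "\<forall>\<^sub>F x in at_top. \<forall>a\<in>{a. g a = 0}. exp (- ((K1 + 1) * x)) \<le> norm (exp (Complex x \<theta>) - a)"
      using exists_ray_avoiding[OF cnt \<open>0 < K1\<close>] by blast
    have "\<forall>\<^sub>F x in at_top.
     f (exp (Complex x \<theta>)) \<noteq> 0 \<and>
     norm (deriv f (exp (Complex x \<theta>))) \<le> exp (K * x) * norm (f (exp (Complex x \<theta>))) \<and>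
     norm (deriv (deriv f) (exp (Complex x \<theta>))) \<le> exp (K * x) * norm (deriv f (exp (Complex x \<theta>)))"
      using \<theta>(2) l1 l2
    proof eventually_elim
      case (elim x)
      let ?z = "exp (Complex x \<theta>)"
      have n: "norm ?z = exp x" by simp
      have a: "exp (- ((K1 + 1) * x)) \<le> norm (?z - a)" if "f a = 0 \<or> deriv f a = 0" for a
        using elim(1) that unfolding g_def by auto
      \<comment> \<open>A zero of \<open>f\<close> at this point would have distance 0 from it,
        contrary to the positive lower bound.\<close>
      have "f ?z \<noteq> 0" using a[of ?z] by (auto simp: not_le)
      then show ?case using elim(2,3) n a by auto
    qed
    with \<theta>(1) show "\<exists>\<theta>\<in>{\<alpha><..<\<beta>}. \<forall>\<^sub>F x in at_top.
     f (exp (Complex x \<theta>)) \<noteq> 0 \<and>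
     norm (deriv f (exp (Complex x \<theta>))) \<le> exp (K * x) * norm (f (exp (Complex x \<theta>))) \<and>
     norm (deriv (deriv f) (exp (Complex x \<theta>))) \<le> exp (K * x) * norm (deriv f (exp (Complex x \<theta>)))" by blast
  qed
qed

section \<open>Order, lower order and the sector of blow-up\<close>

lemma norm_le_max_modulus:
  assumes "g holomorphic_on UNIV" "norm z \<le> r"
  shows "norm (g z) \<le> max_modulus r g"
proof (rule entire_max_principle_cball[OF assms(1), of 0 r])
  fix w :: complex assume w: "w \<in> sphere 0 r"
  have "continuous_on (sphere 0 r) g"
    using assms(1) holomorphic_on_imp_continuous_on holomorphic_on_subset by blast
  then have "compact ((\<lambda>z. norm (g z)) ` sphere 0 r)"
    by (intro compact_continuous_image continuous_on_norm) auto
  then have "bdd_above ((\<lambda>z. norm (g z)) ` sphere 0 r)" by (intro bounded_imp_bdd_above compact_imp_bounded)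
  then show "norm (g w) \<le> max_modulus r g" unfolding max_modulus_def using w by (rule cSUP_upper[rotated])
qed (use assms(2) in auto)

lemma max_modulus_le:
  assumes "\<And>z. norm z = r \<Longrightarrow> norm (g z) \<le> B" "0 \<le> r"
  shows "max_modulus r g \<le> B"
  unfolding max_modulus_def using assms by (intro cSUP_least) auto

lemma le_exp_exp_of_log_plus:
  assumes "0 < x" "log_plus (log_plus M) / x < t" shows "M \<le> exp (exp (t * x))"
proof (cases "M \<le> 1")
  case True
  then show ?thesis using one_le_exp_iff[of "exp (t * x)"] by (meson exp_ge_zero order_trans)
next
  case False
  then have "0 < ln M" by simp
  then have "log_plus M = ln M" unfolding log_plus_def by simp
  moreover have "ln (ln M) \<le> log_plus (ln M)" unfolding log_plus_def by simp
  ultimately have "ln (ln M) \<le> t * x" using assms by (simp add: divide_less_eq)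
  then have "exp (ln (ln M)) \<le> exp (t * x)" by simp
  then have "ln M \<le> exp (t * x)" using \<open>0 < ln M\<close> by simp
  then have "exp (ln M) \<le> exp (exp (t * x))" by (subst exp_le_cancel_iff)
  then show ?thesis using False by simp
qed

lemma log_plus_le_of_le_exp_exp:
  assumes "0 < x" "0 \<le> t" "0 \<le> M" "M \<le> exp (exp (t * x))"
  shows "log_plus (log_plus M) / x \<le> t"
proof -
  have *: "log_plus u \<le> v" if "0 \<le> u" "u \<le> exp v" "0 \<le> v" for u v :: real
  proof (cases "u = 0")
    case False
    then have "ln u \<le> ln (exp v)" using that by (subst ln_le_cancel_iff) auto
    then show ?thesis using that unfolding log_plus_def by simp
  qed (use that in \<open>simp add: log_plus_def\<close>)
  have "log_plus M \<le> exp (t * x)" using assms by (intro *) auto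
  moreover have "0 \<le> log_plus M" unfolding log_plus_def by simp
  ultimately have "log_plus (log_plus M) \<le> t * x" using assms by (intro *) auto
  then show ?thesis using assms by (simp add: divide_le_eq)
qed

lemma power_growth_of_growth_order:
  assumes "g holomorphic_on UNIV" "growth_order g < ereal t"
  shows "power_growth g t"
proof -
  have "\<forall>\<^sub>F r in at_top. ereal (log_plus (log_plus (max_modulus r g)) / ln r) < ereal t"
    using assms(2) unfolding growth_order_def by (rule Limsup_lessD)
  then have "\<forall>\<^sub>F x in at_top. ereal (log_plus (log_plus (max_modulus (exp x) g)) / ln (exp x)) < ereal t"
    by (rule eventually_compose_filterlim) (rule exp_at_top)
  then show ?thesis using eventually_gt_at_top[of 0] unfolding power_growth_def
  proof eventually_elim
    case (elim x)
    then have "max_modulus (exp x) g \<le> exp (exp (t * x))" by (intro le_exp_exp_of_log_plus) auto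
    then show ?case using norm_le_max_modulus[OF assms(1)] order_trans by blast
  qed
qed

text \<open>The lower order controls \<open>g\<close> only at arbitrarily large radii, but by the
  maximum principle the bound at such a radius holds on its whole disc. This lets it be used at
  \<open>exp x\<close> with \<open>x\<close> a fixed proportion of \<open>X\<close>, at the cost of
  a larger exponent.\<close>

lemma frequently_growth_of_lower_growth_order:
  assumes "g holomorphic_on UNIV" "lower_growth_order g < ereal t"
  shows "\<exists>\<^sub>F x in at_top. \<forall>z. norm z \<le> exp x \<longrightarrow> norm (g z) \<le> exp (exp (t * x))"
proof -
  have "\<exists>\<^sub>F r in at_top. ereal (log_plus (log_plus (max_modulus r g)) / ln r) < ereal t"
  proof (rule ccontr)
    assume "\<not> ?thesis"
    then have "\<forall>\<^sub>F r in at_top. ereal t \<le> ereal (log_plus (log_plus (max_modulus r g)) / ln r)"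
      by (simp add: not_frequently not_less)
    then have "ereal t \<le> lower_growth_order g" unfolding lower_growth_order_def by (rule Liminf_bounded)
    with assms(2) show False by simp
  qed
  show ?thesis unfolding frequently_def
  proof
    assume "\<forall>\<^sub>F x in at_top. \<not> (\<forall>z. norm z \<le> exp x \<longrightarrow> norm (g z) \<le> exp (exp (t * x)))"
    then have "\<forall>\<^sub>F r in at_top. \<not> (\<forall>z. norm z \<le> exp (ln r) \<longrightarrow> norm (g z) \<le> exp (exp (t * ln r)))"
      by (rule eventually_compose_filterlim) (rule ln_at_top)
    then have "\<forall>\<^sub>F r in at_top. \<not> ereal (log_plus (log_plus (max_modulus r g)) / ln r) < ereal t"
      using eventually_gt_at_top[of 1]
    proof eventually_elim
      case (elim r)
      show ?case
      proof
        assume "ereal (log_plus (log_plus (max_modulus r g)) / ln r) < ereal t"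
        then have "max_modulus r g \<le> exp (exp (t * ln r))" using elim(2) by (intro le_exp_exp_of_log_plus) auto
        then have "\<forall>z. norm z \<le> r \<longrightarrow> norm (g z) \<le> exp (exp (t * ln r))"
          using norm_le_max_modulus[OF assms(1)] order_trans by blast
        with elim show False by simp
      qed
    qed
    with \<open>\<exists>\<^sub>F r in at_top. ereal (log_plus (log_plus (max_modulus r g)) / ln r) < ereal t\<close>
    show False unfolding frequently_def by blast
  qed
qed

lemma growth_order_le:
  assumes "g holomorphic_on UNIV" "power_growth g t" "0 \<le> t"
  shows "growth_order g \<le> ereal t"
  unfolding growth_order_def
proof (rule Limsup_bounded)
  have "\<forall>\<^sub>F r in at_top. \<forall>z. norm z \<le> exp (ln r) \<longrightarrow> norm (g z) \<le> exp (exp (t * ln r))"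
    using assms(2) unfolding power_growth_def by (rule eventually_compose_filterlim) (rule ln_at_top)
  then show "\<forall>\<^sub>F r in at_top. ereal (log_plus (log_plus (max_modulus r g)) / ln r) \<le> ereal t"
    using eventually_gt_at_top[of 1]
  proof eventually_elim
    case (elim r)
    have "max_modulus r g \<le> exp (exp (t * ln r))" using elim by (intro max_modulus_le) auto
    moreover have "0 \<le> max_modulus r g"
      using order_trans[OF norm_ge_zero norm_le_max_modulus[OF assms(1), of "of_real r" r]] elim(2) by simp
    ultimately show ?case using elim(2) assms(3) by (simp add: log_plus_le_of_le_exp_exp)
  qed
qed

lemma lower_growth_order_le: "lower_growth_order g \<le> growth_order g"
  unfolding lower_growth_order_def growth_order_def by (rule Liminf_le_Limsup) simp

section \<open>Multiplication by the exponential of a polynomial\<close>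

lemma norm_poly_le:
  fixes P :: "complex poly"
  shows "\<exists>Q>0. \<forall>z R. 1 \<le> R \<longrightarrow> norm z \<le> R \<longrightarrow> norm (poly P z) \<le> Q * R ^ degree P"
proof -
  define Q where "Q = (\<Sum>i\<le>degree P. norm (coeff P i)) + 1"
  have "norm (poly P z) \<le> Q * R ^ degree P" if R: "1 \<le> R" "norm z \<le> R" for z R
  proof -
    have "norm (poly P z) \<le> (\<Sum>i\<le>degree P. norm (coeff P i * z ^ i))" unfolding poly_altdef by (rule norm_sum)
    also have "\<dots> \<le> (\<Sum>i\<le>degree P. norm (coeff P i) * R ^ degree P)"
    proof (rule sum_mono)
      fix i assume i: "i \<in> {..degree P}"
      have "norm z ^ i \<le> R ^ i" using R by (intro power_mono) auto
      also have "\<dots> \<le> R ^ degree P" using R i by (intro power_increasing) auto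
      finally show "norm (coeff P i * z ^ i) \<le> norm (coeff P i) * R ^ degree P"
        by (simp add: norm_mult norm_power mult_left_mono)
    qed
    also have "\<dots> \<le> Q * R ^ degree P"
      unfolding Q_def sum_distrib_right[symmetric] using R by (intro mult_right_mono) auto
    finally show ?thesis .
  qed
  moreover have "0 < Q" unfolding Q_def by (intro add_nonneg_pos sum_nonneg) auto
  ultimately show ?thesis by blast
qed

lemma norm_exp_poly_bounds:
  fixes P :: "complex poly"
  shows "\<exists>Q>0. \<forall>x z. 0 \<le> x \<longrightarrow> norm z \<le> exp x \<longrightarrow>
    norm (exp (poly P z)) \<le> exp (Q * exp (real (degree P) * x)) \<and> exp (- (Q * exp (real (degree P) * x))) \<le> norm (exp (poly P z))"
proof -
  obtain Q where Q: "Q > 0" "\<And>z R. 1 \<le> R \<Longrightarrow> norm z \<le> R \<Longrightarrow> norm (poly P z) \<le> Q * R ^ degree P"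
    using norm_poly_le by blast
  have "norm (exp (poly P z)) \<le> exp (Q * exp (real (degree P) * x)) \<and> exp (- (Q * exp (real (degree P) * x))) \<le> norm (exp (poly P z))"
    if "0 \<le> x" "norm z \<le> exp x" for x z
  proof -
    have "norm (poly P z) \<le> Q * exp x ^ degree P" using that by (intro Q(2)) auto
    then have "norm (poly P z) \<le> Q * exp (real (degree P) * x)" by (simp add: exp_of_nat_mult)
    then show ?thesis using abs_Re_le_cmod[of "poly P z"] by (simp add: abs_le_iff)
  qed
  with Q(1) show ?thesis by blast
qed

lemma power_growth_times_exp_poly:
  assumes "power_growth h t" "t < t'" "real (degree P) < t'" 
  shows "power_growth (\<lambda>z. h z * exp (poly P z)) t'"
proof -
  obtain Q where Q: "Q > 0" "\<And>x z. 0 \<le> x \<Longrightarrow> norm z \<le> exp x \<Longrightarrow> norm (exp (poly P z)) \<le> exp (Q * exp (real (degree P) * x))"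
    using norm_exp_poly_bounds[of P] by blast
  have "0 < t'" using assms(3) of_nat_0_le_iff order.strict_trans1 by blast
  then have "\<forall>\<^sub>F x in at_top. 1 * exp (t * x) + 0 \<le> (1/2) * exp (t' * x)"
    "\<forall>\<^sub>F x in at_top. Q * exp (real (degree P) * x) + 0 \<le> (1/2) * exp (t' * x)"
    using assms by (intro eventually_exp_dominates; simp)+
  then show ?thesis using assms(1) eventually_ge_at_top[of 0] unfolding power_growth_def
  proof eventually_elim
    case (elim x)
    show ?case
    proof (intro allI impI)
      fix z :: complex assume z: "norm z \<le> exp x"
      have "norm (h z * exp (poly P z)) \<le> exp (exp (t * x)) * exp (Q * exp (real (degree P) * x))"
        unfolding norm_mult using z elim Q(2)[of x z] by (intro mult_mono) auto
      also have "\<dots> \<le> exp (exp (t' * x))" unfolding exp_add[symmetric] using elim by simp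
      finally show "norm (h z * exp (poly P z)) \<le> exp (exp (t' * x))" .
    qed
  qed
qed

text \<open>The modulus of the exponential factor is at most \<open>exp (Q * r ^ degree P)\<close>,
  which is absorbed by every exponent above the order of \<open>h\<close>; letting that exponent
  decrease to the order gives the claim.\<close>

lemma growth_order_times_exp_poly_le:
  assumes h: "h holomorphic_on UNIV" and gt: "ereal (real (degree P)) < growth_order h"
  shows "growth_order (\<lambda>z. h z * exp (poly P z)) \<le> growth_order h"
proof (rule dense_ge)
  fix y assume y: "growth_order h < y"
  obtain t where t: "growth_order h < ereal t" "ereal t < y" using ereal_dense2[OF y] by blast
  obtain t1 where t1: "growth_order h < ereal t1" "ereal t1 < ereal t" using ereal_dense2[OF t(1)] by blast
  have "ereal (real (degree P)) < ereal t1" using gt t1(1) by (rule less_trans)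
  then have "real (degree P) < t1" by simp
  moreover have "t1 < t" using t1(2) by simp
  ultimately have "power_growth (\<lambda>z. h z * exp (poly P z)) t"
    by (intro power_growth_times_exp_poly[OF power_growth_of_growth_order[OF h t1(1)]]) auto
  moreover have "0 \<le> t" using \<open>real (degree P) < t1\<close> \<open>t1 < t\<close> of_nat_0_le_iff[of "degree P", where 'a = real] by linarith
  ultimately have "growth_order (\<lambda>z. h z * exp (poly P z)) \<le> ereal t"
    by (intro growth_order_le) (auto intro!: holomorphic_intros h)
  with t(2) show "growth_order (\<lambda>z. h z * exp (poly P z)) \<le> y" by simp
qed

section \<open>The sector in which the coefficient blows up\<close>

lemma delta_eq: "delta P \<theta> = Re (lead_coeff P * cis \<theta> ^ degree P)"
  by (simp only: delta_def times_complex.sel cos_n_Re_cis_pow_n sin_n_Im_cis_pow_n)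

lemma exp_Complex: "exp (Complex x y) = of_real (exp x) * cis y"
  by (simp add: complex_eq_iff Re_exp Im_exp)

lemma blow_up_on_ray:
  assumes up: "exponentially_blows_up_in h (E_minus P)" and neg: "delta P \<theta> < 0" and s: "ereal s < growth_order h"
  shows "\<forall>\<^sub>F x in at_top. exp (exp (s * x)) \<le> norm (h (exp (Complex x \<theta>)))"
proof -
  \<comment> \<open>\<open>E_minus\<close> contains only angles in \<open>[0, 2 * pi]\<close>,
    whereas the sector used later may reach outside. Since \<open>delta P\<close> and the ray depend
    on the angle only through \<open>cis\<close>, it may be replaced by its representative.\<close>
  define \<phi> where "\<phi> = Arg2pi (cis \<theta>)"
  have \<phi>: "cis \<phi> = cis \<theta>" "\<phi> \<in> {0..2 * pi}"
  proof -
    have a: "is_Arg (cis \<theta>) \<phi>" "0 \<le> \<phi>" "\<phi> < 2 * pi" using Arg2pi[of "cis \<theta>"] unfolding \<phi>_def by auto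
    have "cis \<theta> = of_real (norm (cis \<theta>)) * cis \<phi>" using a(1) unfolding is_Arg_def cis_conv_exp .
    then show "cis \<phi> = cis \<theta>" by simp
    show "\<phi> \<in> {0..2 * pi}" using a by simp
  qed
  then have "\<phi> \<in> E_minus P" using neg unfolding E_minus_def delta_eq by auto
  then have ev: "\<forall>\<^sub>F r in at_top. 1 < norm (h (of_real r * cis \<theta>))"
    and lim: "((\<lambda>r. ereal (ln (ln (norm (h (of_real r * cis \<theta>)))) / ln r)) \<longlongrightarrow> growth_order h) at_top"
    using up unfolding exponentially_blows_up_in_def by (auto simp: \<phi>(1))
  have "\<forall>\<^sub>F r in at_top. ereal s < ereal (ln (ln (norm (h (of_real r * cis \<theta>)))) / ln r)"
    using lim s by (rule order_tendstoD(1))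
  then have "\<forall>\<^sub>F r in at_top. s < ln (ln (norm (h (of_real r * cis \<theta>)))) / ln r \<and> 1 < norm (h (of_real r * cis \<theta>))"
    using ev by eventually_elim auto
  then have "\<forall>\<^sub>F x in at_top. s < ln (ln (norm (h (of_real (exp x) * cis \<theta>)))) / ln (exp x) \<and> 1 < norm (h (of_real (exp x) * cis \<theta>))"
    by (rule eventually_compose_filterlim) (rule exp_at_top)
  then show ?thesis using eventually_gt_at_top[of 0]
  proof eventually_elim
    case (elim x)
    let ?M = "norm (h (exp (Complex x \<theta>)))"
    have M: "1 < ?M" "s < ln (ln ?M) / x" using elim unfolding exp_Complex by auto
    have "0 < ln ?M" using M(1) by (rule ln_gt_zero)
    have "s * x < ln (ln ?M)" using M(2) elim(2) by (simp add: less_divide_eq)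
    then have "exp (s * x) < exp (ln (ln ?M))" by (subst exp_less_cancel_iff)
    then have "exp (s * x) < ln ?M" using \<open>0 < ln ?M\<close> by simp
    then have "exp (exp (s * x)) < exp (ln ?M)" by (subst exp_less_cancel_iff)
    moreover have "exp (ln ?M) = ?M" using M(1) by (intro exp_ln) linarith
    ultimately show ?case by linarith
  qed
qed

text \<open>The blow-up of \<open>h\<close> with an exponent \<open>s1\<close> strictly between
  \<open>s\<close> and the order outweighs the possible loss
  \<open>exp (- (Q * r ^ degree P))\<close> from the polynomial factor, because the degree is below
  \<open>s1\<close>.\<close>

lemma blow_up_times_exp_poly_on_ray:
  assumes up: "exponentially_blows_up_in h (E_minus P)" and neg: "delta P \<theta> < 0"
    and s: "ereal s < growth_order h" "real (degree P) < s"
  shows "\<forall>\<^sub>F x in at_top. exp (exp (s * x)) \<le> norm (h (exp (Complex x \<theta>)) * exp (poly P (exp (Complex x \<theta>))))"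
proof -
  obtain s1 where s1: "ereal s < ereal s1" "ereal s1 < growth_order h" using ereal_dense2[OF s(1)] by blast
  obtain Q where Q: "Q > 0" "\<And>x z. 0 \<le> x \<Longrightarrow> norm z \<le> exp x \<Longrightarrow> exp (- (Q * exp (real (degree P) * x))) \<le> norm (exp (poly P z))"
    using norm_exp_poly_bounds[of P] by blast
  have "0 \<le> real (degree P)" by simp
  then have "\<forall>\<^sub>F x in at_top. 1 * exp (s * x) + 0 \<le> (1/2) * exp (s1 * x)"
    "\<forall>\<^sub>F x in at_top. Q * exp (real (degree P) * x) + 0 \<le> (1/2) * exp (s1 * x)"
    using s s1 by (intro eventually_exp_dominates; force)+
  then show ?thesis using blow_up_on_ray[OF up neg s1(2)] eventually_ge_at_top[of 0]
  proof eventually_elim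
    case (elim x)
    let ?z = "exp (Complex x \<theta>)"
    have "exp (exp (s * x)) \<le> exp (exp (s1 * x)) * exp (- (Q * exp (real (degree P) * x)))"
      unfolding exp_add[symmetric] using elim by simp
    also have "\<dots> \<le> norm (h ?z) * norm (exp (poly P ?z))"
      using elim(3) Q(2)[of x ?z] elim(4) by (intro mult_mono) auto
    finally show ?case by (simp add: norm_mult)
  qed
qed

text \<open>At the angle \<open>c\<close> the leading term of \<open>P\<close> is a negative real
  number, and at \<open>c + u / n\<close> it is that number rotated by \<open>u\<close>, so its real
  part stays negative while \<open>\<bar>u\<bar> < pi / 2\<close>. The sector obtained has opening
  \<open>pi / n\<close>.\<close>

lemma delta_neg_interval:
  assumes "degree P = n" "1 \<le> n"
  shows "\<exists>c. \<forall>\<theta>. \<bar>\<theta> - c\<bar> < pi / (2 * n) \<longrightarrow> delta P \<theta> < 0"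
proof -
  define a where "a = lead_coeff P"
  have "a \<noteq> 0" using assms unfolding a_def by auto
  define c where "c = (pi - Arg a) / n"
  have "delta P \<theta> < 0" if "\<bar>\<theta> - c\<bar> < pi / (2 * n)" for \<theta>
  proof -
    define u where "u = real n * (\<theta> - c)"
    have "\<bar>u\<bar> < pi / 2"
    proof -
      have "real n * \<bar>\<theta> - c\<bar> < real n * (pi / (2 * n))" using that assms(2) by (intro mult_strict_left_mono) auto
      then show ?thesis using assms(2) unfolding u_def by (simp add: abs_mult)
    qed
    then have "0 < cos u" by (intro cos_gt_zero_pi) auto
    have n\<theta>: "real n * \<theta> = pi - Arg a + u" using assms(2) unfolding u_def c_def by (simp add: field_simps)
    have "a = of_real (norm a) * cis (Arg a)" using rcis_cmod_Arg[of a] by (simp add: rcis_def)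
    then have "a * cis \<theta> ^ n = of_real (norm a) * cis (Arg a) * cis (real n * \<theta>)"
      by (metis Complex.DeMoivre)
    also have "\<dots> = of_real (norm a) * cis (Arg a + real n * \<theta>)" by (simp add: mult.assoc cis_mult)
    also have "Arg a + real n * \<theta> = pi + u" using n\<theta> by simp
    finally have eq: "a * cis \<theta> ^ n = of_real (norm a) * cis (pi + u)" .
    have "delta P \<theta> = Re (a * cis \<theta> ^ n)" by (simp only: delta_eq a_def assms(1))
    also have "\<dots> = - (norm a * cos u)" unfolding eq by simp
    finally show ?thesis using \<open>0 < cos u\<close> \<open>a \<noteq> 0\<close> by simp
  qed
  then show ?thesis by blast
qed

text \<open>Cut \<open>{a..b}\<close> into cells of length \<open>k <= w / 2\<close> and choose a
  member of \<open>D\<close> in each; neighbouring members, with the end points added, are then at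
  most \<open>2 * k\<close> apart.\<close>

lemma finite_net_of_rays:
  fixes D :: "real set"
  assumes D: "\<And>\<alpha> \<beta>. a \<le> \<alpha> \<Longrightarrow> \<alpha> < \<beta> \<Longrightarrow> \<beta> \<le> b \<Longrightarrow> \<exists>\<theta>\<in>D. \<alpha> < \<theta> \<and> \<theta> < \<beta>"
    and ab: "a \<in> D" "b \<in> D" "a < b" and "0 < w"
  shows "\<exists>T. finite T \<and> T \<subseteq> D \<inter> {a..b} \<and> a \<in> T \<and> b \<in> T \<and>
     (\<forall>y\<in>{a..b}. \<exists>y0\<in>T. \<exists>y1\<in>T. y0 \<le> y \<and> y \<le> y1 \<and> y1 - y0 \<le> w)"
proof -
  define N where "N = nat \<lceil>2 * (b - a) / w\<rceil> + 1"
  define k where "k = (b - a) / N"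
  have "0 < real N" unfolding N_def by simp
  have "2 * (b - a) / w \<le> real N" unfolding N_def by linarith
  then have k: "0 < k" "2 * k \<le> w" using ab \<open>0 < w\<close> \<open>0 < real N\<close> unfolding k_def by (auto simp: field_simps)
  have Nk: "N * k = b - a" using \<open>0 < real N\<close> unfolding k_def by simp
  have "\<exists>\<theta>\<in>D. a + real j * k < \<theta> \<and> \<theta> < a + (real j + 1) * k" if "j < N" for j :: nat
  proof (rule D)
    have "(real j + 1) * k \<le> N * k" using that k by (intro mult_right_mono) auto
    then show "a + (real j + 1) * k \<le> b" using Nk by linarith
  qed (use k in \<open>auto simp: algebra_simps\<close>)
  then obtain t where t: "\<And>j. j < N \<Longrightarrow> t j \<in> D \<and> a + real j * k < t j \<and> t j < a + (real j + 1) * k"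
    by metis
  define T where "T = {a, b} \<union> t ` {..<N}"
  have tab: "t j \<in> {a..b}" if "j < N" for j
  proof -
    have "(real j + 1) * k \<le> N * k" using that k by (intro mult_right_mono) auto
    moreover have "0 \<le> real j * k" using k by simp
    ultimately show ?thesis using t[OF that] Nk by auto
  qed
  have "\<exists>y0\<in>T. \<exists>y1\<in>T. y0 \<le> y \<and> y \<le> y1 \<and> y1 - y0 \<le> w" if y: "y \<in> {a..b}" for y
  proof -
    define j where "j = nat \<lfloor>(y - a) / k\<rfloor>"
    have "0 \<le> (y - a) / k" using y k by simp
    then have "real j \<le> (y - a) / k" "(y - a) / k < real j + 1" unfolding j_def by linarith+
    then have j: "a + real j * k \<le> y" "y < a + (real j + 1) * k" using k by (auto simp: field_simps)
    \<comment> \<open>With \<open>y\<close> in cell \<open>j\<close>, its neighbours are the chosen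
      point of that cell and one of an adjacent cell, or an end point where there is none. The index
      \<open>N\<close> occurs only for \<open>y = b\<close>.\<close>
    define y0 where "y0 = (if j < N \<and> t j \<le> y then t j else if 0 < j \<and> j \<le> N then t (j - 1) else a)"
    define y1 where "y1 = (if j < N \<and> y \<le> t j then t j else if j + 1 < N then t (j + 1) else b)"
    have "real j * k \<le> N * k" using j(1) y Nk by auto
    then have jN: "j \<le> N" using k by simp
    have jN': "j = N \<Longrightarrow> y = b" using j(1) y Nk by auto
    have pred: "t (j - 1) < a + real j * k" "a + (real j - 1) * k < t (j - 1)" if "0 < j"
      using t[of "j - 1"] that jN by (auto simp: of_nat_diff)
    have succ: "a + (real j + 1) * k < t (j + 1)" "t (j + 1) < a + (real j + 2) * k" if "j + 1 < N"
      using t[of "j + 1"] that by (auto simp: algebra_simps)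
    have last: "b = a + (real j + 1) * k" if "j < N" "\<not> j + 1 < N"
    proof -
      have "real N = real j + 1" using that by simp
      then show ?thesis using Nk by simp
    qed
    have kk: "(real j + 1) * k = real j * k + k" "(real j + 2) * k = real j * k + 2 * k" "(real j - 1) * k = real j * k - k"
      by (simp_all add: algebra_simps)
    have y0: "y0 \<in> T" "y0 \<le> y" unfolding y0_def T_def using pred j y jN by (auto simp: less_imp_le intro: order_trans)
    have y1: "y1 \<in> T" "y \<le> y1" unfolding y1_def T_def using succ j y by (auto simp: less_imp_le intro: order_trans)
    have "y1 - y0 \<le> 2 * k"
    proof (cases "j < N")
      case True
      have jj: "a + real j * k < t j" "t j < a + real j * k + k" using t[OF True] kk by auto
      show ?thesis unfolding y0_def y1_def
        using True jj pred succ last kk k y j by (cases "j = 0") (auto split: if_splits)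
    next
      case False
      then have "j = N" "y = b" using jN jN' by auto
      moreover have "0 < j" using \<open>j = N\<close> \<open>0 < real N\<close> by simp
      moreover have "y0 = t (j - 1)" "y1 = b" unfolding y0_def y1_def using False \<open>0 < j\<close> jN by auto
      moreover have "real j * k = b - a" using Nk \<open>j = N\<close> by simp
      ultimately show ?thesis using pred(2) kk(3) k(1) by linarith
    qed
    then show ?thesis using y0 y1 k(2) by force
  qed
  moreover have "finite T" "T \<subseteq> D \<inter> {a..b}" "a \<in> T" "b \<in> T" unfolding T_def using t tab ab by auto
  ultimately show ?thesis by blast
qed

text \<open>The bound on the logarithmic derivative makes
  \<open>norm F ^ 2 * exp (- 2 * \<delta> * x)\<close> nonincreasing and
  \<open>norm F ^ 2 * exp (2 * \<delta> * x)\<close> nondecreasing along the segment. The square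
  keeps the norm differentiable at zeros.\<close>

lemma gronwall_segment:
  fixes F :: "complex \<Rightarrow> complex"
  assumes F: "F holomorphic_on UNIV" and "x0 \<le> x1"
    and bd: "\<And>x. x \<in> {x0..x1} \<Longrightarrow> norm (deriv F (Complex x y)) \<le> \<delta> * norm (F (Complex x y))"
  shows "norm (F (Complex x1 y)) \<le> norm (F (Complex x0 y)) * exp (\<delta> * (x1 - x0))"
    and "norm (F (Complex x0 y)) \<le> norm (F (Complex x1 y)) * exp (\<delta> * (x1 - x0))"
proof -
  define u where "u x = F (Complex x y)" for x
  have der: "(u has_vector_derivative deriv F (Complex x y)) (at x)" for x
  proof -
    have "((\<lambda>x. Complex x y) has_vector_derivative 1) (at x)"
      unfolding Complex_eq by (auto intro!: derivative_eq_intros)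
    moreover have "(F has_field_derivative deriv F (Complex x y)) (at (Complex x y))"
      using holomorphic_derivI[OF F] by auto
    ultimately show ?thesis unfolding u_def[abs_def]
      using field_vector_diff_chain_at[of "\<lambda>x. Complex x y" 1 x F] by (simp add: o_def)
  qed
  define v where "v x = (norm (u x))\<^sup>2" for x
  define v' where "v' x = 2 * (u x \<bullet> deriv F (Complex x y))" for x
  have dv: "(v has_real_derivative v' x) (at x)" for x
  proof -
    have "((\<lambda>x. u x \<bullet> u x) has_vector_derivative (u x \<bullet> deriv F (Complex x y) + deriv F (Complex x y) \<bullet> u x)) (at x)"
      by (rule bounded_bilinear.has_vector_derivative[OF bounded_bilinear_inner der der])
    then show ?thesis unfolding v_def v'_def power2_norm_eq_inner has_real_derivative_iff_has_vector_derivative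
      by (simp add: inner_commute)
  qed
  have v': "\<bar>v' x\<bar> \<le> 2 * \<delta> * v x" if "x \<in> {x0..x1}" for x
  proof -
    have "\<bar>v' x\<bar> \<le> 2 * (norm (u x) * norm (deriv F (Complex x y)))"
      unfolding v'_def by (simp add: abs_mult Cauchy_Schwarz_ineq2)
    also have "\<dots> \<le> 2 * (norm (u x) * (\<delta> * norm (u x)))"
      using bd[OF that] unfolding u_def by (intro mult_left_mono) auto
    finally show ?thesis unfolding v_def by (simp add: power2_eq_square algebra_simps)
  qed
  have "v x1 * exp (- 2 * \<delta> * x1) \<le> v x0 * exp (- 2 * \<delta> * x0)"
  proof (rule DERIV_nonpos_imp_nonincreasing[OF \<open>x0 \<le> x1\<close>])
    fix x assume x: "x0 \<le> x" "x \<le> x1"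
    have "((\<lambda>x. v x * exp (- 2 * \<delta> * x)) has_real_derivative (v' x - 2 * \<delta> * v x) * exp (- 2 * \<delta> * x)) (at x)"
      by (auto intro!: derivative_eq_intros dv simp: algebra_simps)
    moreover have "(v' x - 2 * \<delta> * v x) * exp (- 2 * \<delta> * x) \<le> 0"
      using v'[of x] x by (intro mult_nonpos_nonneg) auto
    ultimately show "\<exists>D. ((\<lambda>x. v x * exp (- 2 * \<delta> * x)) has_real_derivative D) (at x) \<and> D \<le> 0" by blast
  qed
  then have up: "v x1 \<le> v x0 * exp (\<delta> * (x1 - x0)) ^ 2"
    by (simp add: exp_diff exp_minus field_simps flip: exp_of_nat_mult exp_add)
  have "v x0 * exp (2 * \<delta> * x0) \<le> v x1 * exp (2 * \<delta> * x1)"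
  proof (rule DERIV_nonneg_imp_nondecreasing[OF \<open>x0 \<le> x1\<close>])
    fix x assume x: "x0 \<le> x" "x \<le> x1"
    have "((\<lambda>x. v x * exp (2 * \<delta> * x)) has_real_derivative (v' x + 2 * \<delta> * v x) * exp (2 * \<delta> * x)) (at x)"
      by (auto intro!: derivative_eq_intros dv simp: algebra_simps)
    moreover have "0 \<le> (v' x + 2 * \<delta> * v x) * exp (2 * \<delta> * x)"
      using v'[of x] x by (intro mult_nonneg_nonneg) auto
    ultimately show "\<exists>D. ((\<lambda>x. v x * exp (2 * \<delta> * x)) has_real_derivative D) (at x) \<and> 0 \<le> D" by blast
  qed
  then have low: "v x0 \<le> v x1 * exp (\<delta> * (x1 - x0)) ^ 2"
    by (simp add: exp_diff exp_minus field_simps flip: exp_of_nat_mult exp_add)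
  show "norm (F (Complex x1 y)) \<le> norm (F (Complex x0 y)) * exp (\<delta> * (x1 - x0))"
    using up unfolding v_def u_def power_mult_distrib[symmetric] by (rule power2_le_imp_le) auto
  show "norm (F (Complex x0 y)) \<le> norm (F (Complex x1 y)) * exp (\<delta> * (x1 - x0))"
    using low unfolding v_def u_def power_mult_distrib[symmetric] by (rule power2_le_imp_le) auto
qed

section \<open>Passing between the plane and the logarithmic coordinate\<close>

lemma holomorphic_comp_exp:
  assumes "g holomorphic_on UNIV"
  shows "(\<lambda>\<zeta>. g (exp \<zeta>)) holomorphic_on UNIV"
  using holomorphic_on_compose_gen[OF holomorphic_on_exp assms, of UNIV] by (simp add: o_def)

text \<open>The identity theorem is used twice: for \<open>g \<circ> exp\<close>, starting from a
  rectangle in the strip, and for \<open>g\<close>, starting from the disc around 1, each of whose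
  points is the exponential of its logarithm.\<close>

lemma entire_eq_0_of_strip:
  fixes g :: "complex \<Rightarrow> complex"
  assumes g: "g holomorphic_on UNIV" and "y0 < y1"
    and 0: "\<And>x y. x0 < x \<Longrightarrow> y0 < y \<Longrightarrow> y < y1 \<Longrightarrow> g (exp (Complex x y)) = 0"
  shows "g z = 0"
proof -
  have ge: "(\<lambda>\<zeta>. g (exp \<zeta>)) holomorphic_on UNIV" by (rule holomorphic_comp_exp[OF g])
  let ?S = "box (Complex x0 y0) (Complex (x0 + 1) y1)"
  have mem: "Complex (x0 + 1/2) ((y0 + y1) / 2) \<in> ?S" using \<open>y0 < y1\<close> by (simp add: in_box_complex_iff)
  have gexp: "g (exp \<zeta>) = 0" for \<zeta>
  proof (rule analytic_continuation_open[of ?S UNIV "\<lambda>\<zeta>. g (exp \<zeta>)" "\<lambda>_. 0"])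
    show "g (exp w) = 0" if "w \<in> ?S" for w
      using 0[of "Re w" "Im w"] that by (simp add: in_box_complex_iff)
  qed (use mem ge in auto)
  show ?thesis
  proof (rule analytic_continuation_open[of "ball 1 1" UNIV g "\<lambda>_. 0"])
    show "g w = 0" if "w \<in> ball 1 1" for w
    proof -
      have "w \<noteq> 0" using that by auto
      then show ?thesis using gexp[of "Ln w"] by simp
    qed
  qed (use g in auto)
qed

lemma deriv_comp_exp:
  assumes "g holomorphic_on UNIV"
  shows "deriv (\<lambda>\<zeta>. g (exp \<zeta>)) \<zeta> = deriv g (exp \<zeta>) * exp \<zeta>"
proof -
  have "(g has_field_derivative deriv g (exp \<zeta>)) (at (exp \<zeta>))" using holomorphic_derivI[OF assms] by auto
  then have "((\<lambda>\<zeta>. g (exp \<zeta>)) has_field_derivative deriv g (exp \<zeta>) * exp \<zeta>) (at \<zeta>)"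
    by (rule DERIV_chain2) (auto intro!: derivative_eq_intros)
  then show ?thesis by (rule DERIV_imp_deriv)
qed

section \<open>The differential equation\<close>

lemma eventually_linear_le_exp:
  fixes \<beta> k :: real
  assumes "0 < \<beta>" "0 < k"
  shows "\<forall>\<^sub>F x in at_top. K * x + b \<le> k * exp (\<beta> * x)"
proof -
  have "\<forall>\<^sub>F x in at_top. (\<bar>K\<bar> * (2 / \<beta>)) * exp ((\<beta> / 2) * x) + b \<le> k * exp (\<beta> * x)"
    using assms by (intro eventually_exp_dominates) auto
  then show ?thesis using eventually_ge_at_top[of 0]
  proof eventually_elim
    case (elim x)
    have "(\<beta> / 2) * x \<le> exp ((\<beta> / 2) * x)" using exp_ge_add_one_self[of "(\<beta> / 2) * x"] by linarith
    then have "x \<le> (2 / \<beta>) * exp ((\<beta> / 2) * x)" using assms by (simp add: field_simps)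
    then have "\<bar>K\<bar> * x \<le> \<bar>K\<bar> * ((2 / \<beta>) * exp ((\<beta> / 2) * x))" by (intro mult_left_mono) auto
    moreover have "K * x \<le> \<bar>K\<bar> * x" using elim(2) by (intro mult_right_mono) auto
    ultimately show ?case using elim(1) by (simp add: mult.assoc)
  qed
qed

lemma frequently_at_top_scale:
  fixes k :: real
  assumes "\<exists>\<^sub>F X in at_top. P (k * X)" "0 < k"
  shows "\<exists>\<^sub>F X in at_top. P X"
  unfolding frequently_def
proof
  assume "\<forall>\<^sub>F X in at_top. \<not> P X"
  moreover have "filterlim (\<lambda>X. k * X) at_top at_top"
    using assms(2) by (intro filterlim_tendsto_pos_mult_at_top[OF tendsto_const] filterlim_ident)
  ultimately have "\<forall>\<^sub>F X in at_top. \<not> P (k * X)" by (rule eventually_compose_filterlim)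
  with assms(1) show False unfolding frequently_def by blast
qed

text \<open>The thin-rectangle estimate between two neighbouring rays. When \<open>x\<close> is so
  far from both ends that the gain there is at least \<open>4 * E\<close>, each end contributes at
  most 1/2 to the exponent.\<close>

lemma norm_le_between_net_rays:
  fixes g :: "complex \<Rightarrow> complex"
  assumes g: "g holomorphic_on UNIV" and q: "q > 0" "q * w \<le> 2 * pi / 3"
    and T: "T \<subseteq> {a..b}" "\<And>y. y \<in> {a..b} \<Longrightarrow> \<exists>y0\<in>T. \<exists>y1\<in>T. y0 \<le> y \<and> y \<le> y1 \<and> y1 - y0 \<le> w"
    and E: "0 \<le> E" "4 * E \<le> exp (q * (x - x0))" "4 * E \<le> exp (q * (x1 - x))"
    and rays: "\<And>\<theta> x. \<theta> \<in> T \<Longrightarrow> x \<in> {x0..x1} \<Longrightarrow> norm (g (Complex x \<theta>)) \<le> exp m"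
    and ends: "\<And>y. y \<in> {a..b} \<Longrightarrow> norm (g (Complex x0 y)) \<le> exp (m + E) \<and> norm (g (Complex x1 y)) \<le> exp (m + E)"
    and xy: "x \<in> {x0..x1}" "y \<in> {a..b}"
  shows "norm (g (Complex x y)) \<le> exp (m + 1)"
proof -
  obtain y0 y1 where y: "y0 \<in> T" "y1 \<in> T" "y0 \<le> y" "y \<le> y1" "y1 - y0 \<le> w" using T(2)[OF xy(2)] by blast
  have "q * (y1 - y0) \<le> q * w" using y(5) q(1) by (intro mult_left_mono) auto
  then have qy: "q * (y1 - y0) \<le> 2 * pi / 3" using q(2) by linarith
  have "norm (g (Complex x y)) \<le> exp (m + 2 * E * (exp (- (q * (x - x0))) + exp (- (q * (x1 - x)))))"
  proof (rule norm_le_in_thin_rectangle[OF g q(1) qy E(1)])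
    show "norm (g (Complex x0 t)) \<le> exp (m + E) \<and> norm (g (Complex x1 t)) \<le> exp (m + E)" if "t \<in> {y0..y1}" for t
      using that y(1,2) T(1) by (intro ends) auto
  qed (use rays y xy in auto)
  also have "\<dots> \<le> exp (m + 1)"
  proof -
    have "4 * E * exp (- u) \<le> 1" if "4 * E \<le> exp u" for u
      using that mult_right_mono[OF that, of "exp (- u)"] by (simp flip: exp_add)
    from this[OF E(2)] this[OF E(3)] show ?thesis by (simp add: algebra_simps)
  qed
  finally show ?thesis .
qed

text \<open>On the rays of a net the equation, solved for \<open>f'\<close>, makes \<open>f'\<close>
  at most \<open>exp (- (exp (s * x) / 2))\<close> for \<open>X / 2 <= x <= X\<close>, the range in
  which \<open>B\<close> is controlled. Interpolation at \<open>3/4 * X\<close>, midway between the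
  ends, yields arcs on which \<open>f'\<close> decays with an exponent \<open>\<nu>\<close> above
  its growth exponent \<open>\<sigma>\<close>, which forces it to vanish.\<close>

lemma deriv_eq_0_if_coefficient_of_infinite_order:
  fixes A B f :: "complex \<Rightarrow> complex"
  assumes f: "f holomorphic_on UNIV" "power_growth f C" "0 < C"
    and ode: "\<And>z. deriv (deriv f) z + A z * deriv f z + B z * f z = 0"
    and "\<alpha> < \<beta>"
    and big: "\<And>\<theta> s. \<alpha> < \<theta> \<Longrightarrow> \<theta> < \<beta> \<Longrightarrow> \<forall>\<^sub>F x in at_top. exp (exp (s * x)) \<le> norm (A (exp (Complex x \<theta>)))"
    and B: "\<exists>\<^sub>F X in at_top. \<forall>z. norm z \<le> exp X \<longrightarrow> norm (B z) \<le> exp (exp (\<mu> * X))" and "0 \<le> \<mu>"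
  shows "deriv f z = 0"
proof -
  define y0 where "y0 = (2 * \<alpha> + \<beta>) / 3"
  define y1 where "y1 = (\<alpha> + 2 * \<beta>) / 3"
  have y01: "\<alpha> < y0" "y0 < y1" "y1 < \<beta>" using \<open>\<alpha> < \<beta>\<close> unfolding y0_def y1_def by auto
  define \<sigma> where "\<sigma> = C + 2 + pi / (y1 - y0)"
  have "0 < pi / (y1 - y0)" using y01 by simp
  then have \<sigma>: "C + 2 \<le> \<sigma>" "pi / (y1 - y0) \<le> \<sigma>" "0 < \<sigma>" using f(3) unfolding \<sigma>_def by auto
  define \<nu> where "\<nu> = \<sigma> + 1"
  \<comment> \<open>The smallness known from \<open>X / 2\<close> on must beat
    \<open>exp (\<nu> * (3/4 * X))\<close>, so \<open>s / 2\<close> has to exceed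
    \<open>3/4 * \<nu>\<close>. The term \<open>2 * \<mu>\<close> arises because a bound for
    \<open>B\<close> with \<open>exp (\<mu> * X)\<close> turns into one with
    \<open>exp (2 * \<mu> * x)\<close> for \<open>x >= X / 2\<close>.\<close>
  define s where "s = 2 * \<nu> + 2 * \<mu> + 1"
  have s: "0 < s" "\<sigma> < s" "2 * \<mu> < s" using \<sigma> \<open>0 \<le> \<mu>\<close> unfolding s_def \<nu>_def by auto
  \<comment> \<open>The distance from \<open>3/4 * X\<close> to either end is \<open>X / 4\<close>,
    and \<open>exp (q * (X / 4))\<close> has to be at least
    \<open>4 * exp ((\<sigma> + s) * X)\<close>.\<close>
  define q where "q = 4 * (\<sigma> + s + 1)"
  have q: "0 < q" using \<sigma> s unfolding q_def by simp
  define w where "w = 2 * pi / (3 * q)"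
  have w: "0 < w" "q * w \<le> 2 * pi / 3" using q unfolding w_def by auto
  have df: "deriv f holomorphic_on UNIV" using f(1) holomorphic_deriv by blast
  have pg1': "power_growth (deriv f) (C + 1)" using power_growth_deriv[OF f(1,2)] f(3) by simp
  have pg: "power_growth f \<sigma>" "power_growth (deriv f) \<sigma>" "power_growth (deriv (deriv f)) \<sigma>"
    using power_growth_mono[OF f(2), of \<sigma>] power_growth_mono[OF pg1', of \<sigma>]
      power_growth_mono[OF power_growth_deriv[OF df pg1', of "C + 2"], of \<sigma>] \<sigma> f(3) by auto
  obtain T where T: "finite T" "T \<subseteq> {\<alpha><..<\<beta>} \<inter> {y0..y1}" "y0 \<in> T" "y1 \<in> T"
    "\<forall>y\<in>{y0..y1}. \<exists>u\<in>T. \<exists>v\<in>T. u \<le> y \<and> y \<le> v \<and> v - u \<le> w"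
  proof -
    have "\<exists>\<theta>\<in>{\<alpha><..<\<beta>}. u < \<theta> \<and> \<theta> < v" if "y0 \<le> u" "u < v" "v \<le> y1" for u v
      using that y01 by (intro bexI[of _ "(u + v) / 2"]) auto
    moreover have "y0 \<in> {\<alpha><..<\<beta>}" "y1 \<in> {\<alpha><..<\<beta>}" using y01 by auto
    ultimately show ?thesis using finite_net_of_rays[of y0 y1 "{\<alpha><..<\<beta>}" w] y01(2) w(1) that by metis
  qed
  have "\<forall>\<^sub>F x in at_top. \<forall>\<theta>\<in>T. exp (exp (s * x)) \<le> norm (A (exp (Complex x \<theta>)))"
    using T big by (intro eventually_ball_finite) auto
  moreover have "\<forall>\<^sub>F x in at_top. 1 * exp (\<sigma> * x) + ln 2 \<le> (1/4) * exp (s * x)"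
    "\<forall>\<^sub>F x in at_top. 1 * exp (2 * \<mu> * x) + 0 \<le> (1/4) * exp (s * x)"
    using s by (intro eventually_exp_dominates; simp)+
  ultimately have "\<forall>\<^sub>F x in at_top. \<forall>\<theta>\<in>T. norm (B (exp (Complex x \<theta>))) \<le> exp (exp (2 * \<mu> * x)) \<longrightarrow>
      norm (deriv f (exp (Complex x \<theta>))) \<le> exp (- (exp (s * x) / 2))"
    using pg(1,3) unfolding power_growth_def
  proof eventually_elim
    case (elim x)
    show ?case
    proof (intro ballI impI)
      fix \<theta> assume \<theta>: "\<theta> \<in> T" and Bx: "norm (B (exp (Complex x \<theta>))) \<le> exp (exp (2 * \<mu> * x))"
      let ?z = "exp (Complex x \<theta>)" and ?e = "exp (s * x)"
      have "exp ?e * norm (deriv f ?z) \<le> norm (A ?z) * norm (deriv f ?z)"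
        using elim(1) \<theta> by (intro mult_right_mono) auto
      also have "\<dots> = norm (deriv (deriv f) ?z + B ?z * f ?z)"
      proof -
        have "A ?z * deriv f ?z = - (deriv (deriv f) ?z + B ?z * f ?z)" using ode[of ?z] by (simp add: algebra_simps add_eq_0_iff)
        then have "norm (A ?z * deriv f ?z) = norm (deriv (deriv f) ?z + B ?z * f ?z)" by (metis norm_minus_cancel)
        then show ?thesis by (simp add: norm_mult)
      qed
      also have "\<dots> \<le> norm (deriv (deriv f) ?z) + norm (B ?z) * norm (f ?z)"
        using norm_triangle_ineq[of "deriv (deriv f) ?z" "B ?z * f ?z"] by (simp add: norm_mult)
      also have "\<dots> \<le> exp (exp (\<sigma> * x)) + exp (exp (2 * \<mu> * x)) * exp (exp (\<sigma> * x))"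
        using elim Bx by (intro add_mono mult_mono) auto
      also have "\<dots> \<le> exp (?e / 2) / 2 + exp (?e / 2) / 2"
      proof (intro add_mono)
        have "exp (\<sigma> * x) \<le> ?e / 2 - ln 2" using elim(2) exp_gt_zero[of "s * x"] by linarith
        then have "exp (exp (\<sigma> * x)) \<le> exp (?e / 2 - ln 2)" by (subst exp_le_cancel_iff)
        then show "exp (exp (\<sigma> * x)) \<le> exp (?e / 2) / 2" by (simp add: exp_diff)
        have "exp (2 * \<mu> * x) + exp (\<sigma> * x) \<le> ?e / 2 - ln 2" using elim(2,3) by linarith
        then have "exp (exp (2 * \<mu> * x)) * exp (exp (\<sigma> * x)) \<le> exp (?e / 2 - ln 2)"
          unfolding exp_add[symmetric] by (subst exp_le_cancel_iff)
        then show "exp (exp (2 * \<mu> * x)) * exp (exp (\<sigma> * x)) \<le> exp (?e / 2) / 2" by (simp add: exp_diff)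
      qed
      finally have "exp ?e * norm (deriv f ?z) \<le> exp ?e * exp (- (?e / 2))" by (simp flip: exp_add)
      then show "norm (deriv f ?z) \<le> exp (- (?e / 2))" by simp
    qed
  qed
  then obtain N where N: "\<And>x \<theta>. N \<le> x \<Longrightarrow> \<theta> \<in> T \<Longrightarrow> norm (B (exp (Complex x \<theta>))) \<le> exp (exp (2 * \<mu> * x)) \<Longrightarrow>
      norm (deriv f (exp (Complex x \<theta>))) \<le> exp (- (exp (s * x) / 2))"
    unfolding eventually_at_top_linorder by blast
  have "\<forall>\<^sub>F X in at_top. (\<forall>z. norm z \<le> exp X \<longrightarrow> norm (B z) \<le> exp (exp (\<mu> * X))) \<longrightarrow>
      (\<forall>y\<in>{y0..y1}. norm (deriv f (exp (Complex (3/4 * X) y))) \<le> exp (- exp (\<nu> * (3/4 * X))))"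
  proof -
    have 1: "\<forall>\<^sub>F X in at_top. 1 * exp (\<sigma> * X) + 0 \<le> (1/2) * exp ((\<sigma> + s) * X)"
      "\<forall>\<^sub>F X in at_top. 1 * exp ((s / 2) * X) + 0 \<le> (1/2) * exp ((\<sigma> + s) * X)"
      using \<sigma> s by (intro eventually_exp_dominates; simp)+
    have 2: "\<forall>\<^sub>F X in at_top. 1 * exp ((\<nu> * (3/4)) * X) + 1 \<le> (1/2) * exp ((s / 2) * X)"
      using \<sigma> s \<open>0 \<le> \<mu>\<close> by (intro eventually_exp_dominates) (auto simp: s_def \<nu>_def)
    have 3: "\<forall>\<^sub>F X in at_top. max 2 (2 * N) \<le> X" by (rule eventually_ge_at_top)
    show ?thesis using 1 2 3 pg(2) unfolding power_growth_def
    proof eventually_elim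
      case (elim X)
      have X: "2 \<le> X" "N \<le> X / 2" using elim(4) by auto
      define m where "m = - (exp ((s / 2) * X) / 2)"
      define E where "E = exp ((\<sigma> + s) * X)"
      have "4 \<le> exp (2::real)" using two_power_le_exp[of 2] by simp
      also have "\<dots> \<le> exp X" using X by simp
      finally have eX: "4 \<le> exp X" .
      have E4: "4 * E \<le> exp (q * (X / 4))"
      proof -
        have "4 * E \<le> exp X * exp ((\<sigma> + s) * X)" unfolding E_def using eX by (intro mult_right_mono) auto
        also have "\<dots> = exp (q * (X / 4))" unfolding q_def exp_add[symmetric] by (simp add: algebra_simps)
        finally show ?thesis .
      qed
      show ?case
      proof (intro impI ballI)
        assume BX: "\<forall>z. norm z \<le> exp X \<longrightarrow> norm (B z) \<le> exp (exp (\<mu> * X))"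
        fix y assume y: "y \<in> {y0..y1}"
        have "norm (deriv f (exp (Complex (3/4 * X) y))) \<le> exp (m + 1)"
        proof (rule norm_le_between_net_rays[OF holomorphic_comp_exp[OF df] q w(2), of T y0 y1 E "3/4 * X" "X / 2" X m y])
          show "norm (deriv f (exp (Complex x \<theta>))) \<le> exp m" if \<theta>: "\<theta> \<in> T" and x: "x \<in> {X / 2..X}" for \<theta> x
          proof -
            have "norm (B (exp (Complex x \<theta>))) \<le> exp (exp (\<mu> * X))" using BX x by auto
            also have "\<dots> \<le> exp (exp (2 * \<mu> * x))"
              using x \<open>0 \<le> \<mu>\<close> mult_left_mono[of X "2 * x" \<mu>] by (simp add: mult_ac)
            finally have "norm (deriv f (exp (Complex x \<theta>))) \<le> exp (- (exp (s * x) / 2))"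
              using x X by (intro N \<theta>) auto
            also have "\<dots> \<le> exp m" unfolding m_def using x s mult_left_mono[of "X / 2" x s] by simp
            finally show ?thesis .
          qed
          have e: "norm (deriv f (exp (Complex x t))) \<le> exp (m + E)" if "x \<le> X" for x t
          proof -
            have "norm (deriv f (exp (Complex x t))) \<le> exp (exp (\<sigma> * X))" using elim(5) that by auto
            also have "\<dots> \<le> exp (m + E)" unfolding m_def E_def exp_le_cancel_iff using elim(1,2) exp_gt_zero[of "s / 2 * X"] by linarith
            finally show ?thesis .
          qed
          show "norm (deriv f (exp (Complex (X / 2) t))) \<le> exp (m + E) \<and> norm (deriv f (exp (Complex X t))) \<le> exp (m + E)" for t
            using e X by auto
          show "4 * E \<le> exp (q * (3/4 * X - X / 2))" "4 * E \<le> exp (q * (X - 3/4 * X))"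
            using E4 by (simp_all add: algebra_simps)
        qed (use T y X in \<open>auto simp: E_def\<close>)
        also have "\<dots> \<le> exp (- exp (\<nu> * (3/4 * X)))" unfolding m_def exp_le_cancel_iff using elim(3) by (simp add: mult.assoc)
        finally show "norm (deriv f (exp (Complex (3/4 * X) y))) \<le> exp (- exp (\<nu> * (3/4 * X)))" .
      qed
    qed
  qed
  then have "\<exists>\<^sub>F X in at_top. \<forall>y\<in>{y0..y1}. norm (deriv f (exp (Complex (3/4 * X) y))) \<le> exp (- exp (\<nu> * (3/4 * X)))"
    using B by (rule frequently_rev_mp[rotated])
  then have arcs: "\<exists>\<^sub>F X in at_top. \<forall>y\<in>{y0..y1}. norm (deriv f (exp (Complex X y))) \<le> exp (- exp (\<nu> * X))"
    by (rule frequently_at_top_scale) simp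
  obtain x0 where x0: "\<And>x z. x0 \<le> x \<Longrightarrow> norm z \<le> exp x \<Longrightarrow> norm (deriv f z) \<le> exp (exp (\<sigma> * x))"
    using pg(2) unfolding power_growth_def eventually_at_top_linorder by blast
  have 0: "deriv f (exp (Complex x y)) = 0" if "x0 < x" "y0 < y" "y < y1" for x y
    by (rule zero_in_strip_of_rapid_decay[OF holomorphic_comp_exp[OF df] y01(2) \<sigma>(2), of \<nu> x0])
       (use that arcs x0 in \<open>auto simp: \<nu>_def\<close>)
  show ?thesis by (rule entire_eq_0_of_strip[OF df y01(2) 0])
qed

text \<open>To be read with \<open>u\<close>, \<open>v\<close>, \<open>w\<close>, \<open>a\<close>,
  \<open>b\<close> the values of \<open>f\<close>, \<open>f'\<close>, \<open>f''\<close>,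
  \<open>A\<close>, \<open>B\<close> at a point: \<open>w\<close> costs at most half of
  \<open>exp (exp (s * x)) * norm v\<close> and is absorbed on the left, which leaves
  \<open>norm v\<close> against \<open>norm b * norm u\<close>.\<close>

lemma small_deriv_of_large_coefficient:
  assumes "0 < s" "\<mu> < s"
  shows "\<forall>\<^sub>F x in at_top. \<forall>a b u v w :: complex. w + a * v + b * u = 0 \<longrightarrow> norm w \<le> exp (K * x) * norm v \<longrightarrow>
     exp (exp (s * x)) \<le> norm a \<longrightarrow> norm b \<le> exp (exp (\<mu> * x)) \<longrightarrow> norm v \<le> exp (- (exp (s * x) / 2)) * norm u"
proof -
  have "\<forall>\<^sub>F x in at_top. K * x + ln 2 \<le> 1 * exp (s * x)" using assms by (intro eventually_linear_le_exp) auto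
  moreover have "\<forall>\<^sub>F x in at_top. 1 * exp (\<mu> * x) + ln 2 \<le> (1/2) * exp (s * x)"
    using assms by (intro eventually_exp_dominates) auto
  ultimately show ?thesis
  proof eventually_elim
    case (elim x)
    show ?case
    proof (intro allI impI)
      fix a b u v w :: complex
      assume ode: "w + a * v + b * u = 0" and w: "norm w \<le> exp (K * x) * norm v"
        and a: "exp (exp (s * x)) \<le> norm a" and b: "norm b \<le> exp (exp (\<mu> * x))"
      let ?e = "exp (s * x)"
      have "exp ?e * norm v \<le> norm a * norm v" using a by (intro mult_right_mono) auto
      also have "\<dots> = norm (w + b * u)"
      proof -
        have "a * v = - (w + b * u)" using ode by (simp add: algebra_simps add_eq_0_iff)
        then have "norm (a * v) = norm (w + b * u)" by (metis norm_minus_cancel)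
        then show ?thesis by (simp add: norm_mult)
      qed
      also have "\<dots> \<le> norm w + norm b * norm u" using norm_triangle_ineq[of w "b * u"] by (simp add: norm_mult)
      also have "\<dots> \<le> exp ?e / 2 * norm v + exp (?e / 2) / 2 * norm u"
      proof (intro add_mono)
        have "exp (K * x) \<le> exp (?e - ln 2)" using elim(1) by simp
        then have "exp (K * x) \<le> exp ?e / 2" by (simp add: exp_diff)
        then show "norm w \<le> exp ?e / 2 * norm v" using w by (meson mult_right_mono norm_ge_zero order_trans)
        have "exp (exp (\<mu> * x)) \<le> exp (?e / 2 - ln 2)" using elim(2) by simp
        then have "exp (exp (\<mu> * x)) \<le> exp (?e / 2) / 2" by (simp add: exp_diff)
        then show "norm b * norm u \<le> exp (?e / 2) / 2 * norm u" using b by (intro mult_right_mono) auto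
      qed
      finally have "exp ?e * norm v \<le> exp (?e / 2) * norm u" by simp
      also have "\<dots> = exp ?e * (exp (- (?e / 2)) * norm u)" by (simp flip: exp_add mult.assoc)
      finally show "norm v \<le> exp (- (?e / 2)) * norm u" by simp
    qed
  qed
qed

text \<open>Along the ray at angle \<open>\<theta>\<close> the function \<open>F = f \<circ> exp\<close> is constant up to a factor 2 on
  \<open>k0 * X \<le> x \<le> X\<close>, and \<open>M\<close> is its largest value among the rays of the net. The thin rectangles are used
  twice: starting at \<open>k0 * X\<close> they give \<open>norm F \<ge> M / 4\<close> in the whole sector, and starting at
  \<open>(k2 - \<epsilon>) * X\<close> they give the sharp smallness of \<open>G = f' \<circ> exp\<close> at \<open>k2 * X\<close>, which the wide rectangle
  carries to \<open>k1 * X\<close>.\<close>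

lemma coefficient_small_on_arcs:
  fixes A B f :: "complex \<Rightarrow> complex"
  assumes f: "f holomorphic_on UNIV" "power_growth f C" "0 < C" and fz: "f \<zeta>0 \<noteq> 0"
    and ode: "\<And>z. deriv (deriv f) z + A z * deriv f z + B z * f z = 0"
    and A: "power_growth A t" "0 < t"
    and T: "finite T" "a \<in> T" "T \<subseteq> {a..b}" "\<And>y. y \<in> {a..b} \<Longrightarrow> \<exists>y0\<in>T. \<exists>y1\<in>T. y0 \<le> y \<and> y \<le> y1 \<and> y1 - y0 \<le> w"
    and rays: "\<And>\<theta>. \<theta> \<in> T \<Longrightarrow> \<forall>\<^sub>F x in at_top. f (exp (Complex x \<theta>)) \<noteq> 0 \<and>
        norm (deriv f (exp (Complex x \<theta>))) \<le> exp (K * x) * norm (f (exp (Complex x \<theta>))) \<and>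
        norm (deriv (deriv f) (exp (Complex x \<theta>))) \<le> exp (K * x) * norm (deriv f (exp (Complex x \<theta>))) \<and>
        exp (exp (s * x)) \<le> norm (A (exp (Complex x \<theta>)))"
    and K: "0 < K" and s: "0 < s" and \<mu>: "0 \<le> \<mu>" "\<mu> / k0 < s"
    and k: "0 < k0" "0 < \<epsilon>" "\<epsilon> \<le> d" "k1 = k0 + 2 * d" "k2 = k0 + 4 * d" "k2 + d \<le> 1"
    and q: "0 < q" "q * w \<le> 2 * pi / 3" "C + K + s + 6 \<le> q * \<epsilon>"
    and p: "0 < p" "a \<le> c - pi / (2 * p)" "c + pi / (2 * p) \<le> b"
    and inner: "c - pi / (2 * p) < ya" "ya < yb" "yb < c + pi / (2 * p)"
    and \<Lambda>: "\<nu> * k1 < s * (k2 - \<epsilon>) - p * (k2 - k1)" and "t < \<nu>"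
  shows "\<forall>\<^sub>F X in at_top. (\<forall>z. norm z \<le> exp X \<longrightarrow> norm (B z) \<le> exp (exp (\<mu> * X))) \<longrightarrow>
      (\<forall>y\<in>{ya..yb}. norm (B (exp (Complex (k1 * X) y))) \<le> exp (- exp (\<nu> * (k1 * X))))"
proof -
  define F where "F \<zeta> = f (exp \<zeta>)" for \<zeta>
  define G where "G \<zeta> = deriv f (exp \<zeta>)" for \<zeta>
  define C1 where "C1 = C + 1"
  \<comment> \<open>\<open>exp (C2 * X)\<close> will be the excess at the ends of thin rectangles:
    it dominates the growth of \<open>f'\<close>, the lower bound for \<open>M\<close> and the
    smallness \<open>exp (s * X)\<close>. The hypothesis on \<open>q * \<epsilon>\<close> asks for
    \<open>C2 + 1\<close>, the spare 1 paying for a factor 4.\<close>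
  define C2 where "C2 = C + K + s + 5"
  \<comment> \<open>Exponent left at \<open>k1 * X\<close>: \<open>s * (k2 - \<epsilon>)\<close> is
    available on the right end \<open>k2 * X\<close>, and the wide strip loses
    \<open>p * (k2 - k1)\<close>.\<close>
  define \<Lambda>' where "\<Lambda>' = s * (k2 - \<epsilon>) - p * (k2 - k1)"
  define half where "half = pi / (2 * p)"
  \<comment> \<open>At most half the margin of the inner arc, so that discs of radius
    \<open>r\<close> around its points keep distance \<open>r\<close> from the sides of the strip;
    there the cosine is at least \<open>c1\<close>.\<close>
  define r where "r = min 1 (min (half - (c - ya)) (half - (yb - c)) / 2)"
  define c1 where "c1 = cos (p * (half - r))"
  define c2 where "c2 = c1 * exp (- p) / 4"
  have df: "deriv f holomorphic_on UNIV" using f(1) holomorphic_deriv by blast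
  have Fh: "F holomorphic_on UNIV" unfolding F_def[abs_def] by (rule holomorphic_comp_exp[OF f(1)])
  have Gh: "G holomorphic_on UNIV" unfolding G_def[abs_def] by (rule holomorphic_comp_exp[OF df])
  have dF: "deriv F \<zeta> = G \<zeta> * exp \<zeta>" for \<zeta>
    unfolding F_def[abs_def] G_def by (rule deriv_comp_exp[OF f(1)])
  have dG: "deriv G \<zeta> = deriv (deriv f) (exp \<zeta>) * exp \<zeta>" for \<zeta>
    unfolding G_def[abs_def] by (rule deriv_comp_exp[OF df])
  have "0 < half" using p(1) unfolding half_def by simp
  have ph: "p * half = pi / 2" using p(1) unfolding half_def by simp
  have r: "0 < r" "r \<le> 1" "c - half + 2 * r \<le> ya" "yb \<le> c + half - 2 * r"
    using inner unfolding r_def half_def[symmetric] by (auto simp: min_def field_simps)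
  have "r < half" using r inner by linarith
  have "0 < c1"
  proof -
    have "p * (half - r) < p * half" using p(1) r(1) by (intro mult_strict_left_mono) auto
    moreover have "0 < p * (half - r)" using p(1) \<open>r < half\<close> by simp
    ultimately show ?thesis unfolding c1_def ph by (intro cos_gt_zero) simp_all
  qed
  then have "0 < c2" unfolding c2_def by simp
  have pg1: "power_growth (deriv f) C1" unfolding C1_def using power_growth_deriv[OF f(1,2)] f(3) by simp
  have kk: "k0 + \<epsilon> < k1" "k0 \<le> k2 - \<epsilon>" "k1 < k2" "k2 \<le> 1 - \<epsilon>" "0 < k1" "k2 < 1" "k0 < 1" "0 < d" using k by auto

  have "\<forall>\<^sub>F x in at_top. \<forall>\<theta>\<in>T. F (Complex x \<theta>) \<noteq> 0 \<and> norm (G (Complex x \<theta>)) \<le> exp (K * x) * norm (F (Complex x \<theta>)) \<and>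
      (norm (B (exp (Complex x \<theta>))) \<le> exp (exp (\<mu> / k0 * x)) \<longrightarrow>
        norm (G (Complex x \<theta>)) \<le> exp (- (exp (s * x) / 2)) * norm (F (Complex x \<theta>)))"
    (is "eventually ?Q _")
  proof -
    have "\<forall>\<^sub>F x in at_top. \<forall>\<theta>\<in>T. f (exp (Complex x \<theta>)) \<noteq> 0 \<and>
        norm (deriv f (exp (Complex x \<theta>))) \<le> exp (K * x) * norm (f (exp (Complex x \<theta>))) \<and>
        norm (deriv (deriv f) (exp (Complex x \<theta>))) \<le> exp (K * x) * norm (deriv f (exp (Complex x \<theta>))) \<and>
        exp (exp (s * x)) \<le> norm (A (exp (Complex x \<theta>)))"
      using T(1) rays by (intro eventually_ball_finite) auto
    then show ?thesis using small_deriv_of_large_coefficient[OF s \<mu>(2), of K]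
    proof eventually_elim
      case (elim x)
      show ?case unfolding F_def G_def using elim(1) elim(2)[rule_format, OF ode] by blast
    qed
  qed
  then obtain N where N: "\<And>x. N \<le> x \<Longrightarrow> ?Q x" unfolding eventually_at_top_linorder by blast
  define N1 where "N1 = max 0 N"
  \<comment> \<open>A fixed reference value on the ray at angle \<open>a\<close>; following
    \<open>F\<close> along that ray prevents \<open>M\<close> from being too small as
    \<open>X\<close> grows.\<close>
  define \<beta> where "\<beta> = norm (F (Complex N1 a))"
  have "0 < \<beta>" using N[of N1] T(2) unfolding \<beta>_def N1_def by auto

  have ev1: "\<forall>\<^sub>F X in at_top. 2 * X + 1 \<le> (1/2) * exp ((s * k0) * X)"
    using s k by (intro eventually_linear_le_exp) auto
  have ev2: "\<forall>\<^sub>F X in at_top. 1 * exp (C1 * X) + 0 \<le> (1/4) * exp (C2 * X)"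
    "\<forall>\<^sub>F X in at_top. 1 * exp ((K + 2) * X) + 0 \<le> (1/4) * exp (C2 * X)"
    "\<forall>\<^sub>F X in at_top. (1/2) * exp (s * X) + 0 \<le> (1/4) * exp (C2 * X)"
    "\<forall>\<^sub>F X in at_top. 0 * exp (0 * X) + (- ln (2 * \<beta>)) \<le> (1/4) * exp (C2 * X)"
    using f(3) K s by (intro eventually_exp_dominates; simp add: C1_def C2_def)+
  have ev3: "\<forall>\<^sub>F X in at_top. 1 * X + (1 + \<bar>ln (8 * (b - a) + 1)\<bar>) \<le> (1/2) * exp ((s * k0) * X)"
    using s k by (intro eventually_linear_le_exp) auto
  have ev4: "\<forall>\<^sub>F X in at_top. 1 * exp ((t * k1) * X) + (ln (16 / r) + 1) \<le> (c2 / 2) * exp (\<Lambda>' * X)"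
  proof (intro eventually_exp_dominates)
    have "t * k1 < \<nu> * k1" using \<open>t < \<nu>\<close> kk by simp
    then show "t * k1 < \<Lambda>'" using \<Lambda> unfolding \<Lambda>'_def by linarith
    moreover have "0 < t * k1" using A(2) kk by simp
    ultimately show "0 < \<Lambda>'" by linarith
  qed (use \<open>0 < c2\<close> in auto)
  have ev5: "\<forall>\<^sub>F X in at_top. 1 * exp ((\<nu> * k1) * X) + 0 \<le> (c2 / 2) * exp (\<Lambda>' * X)"
  proof (intro eventually_exp_dominates)
    show "\<nu> * k1 < \<Lambda>'" using \<Lambda> unfolding \<Lambda>'_def .
    moreover have "0 < \<nu> * k1" using A(2) \<open>t < \<nu>\<close> kk by simp
    ultimately show "0 < \<Lambda>'" by linarith
  qed (use \<open>0 < c2\<close> in auto)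
  have "filterlim (\<lambda>X. k1 * X) at_top at_top"
    using kk by (intro filterlim_tendsto_pos_mult_at_top[OF tendsto_const] filterlim_ident)
  then have ev6: "\<forall>\<^sub>F X in at_top. \<forall>z. norm z \<le> exp (k1 * X) \<longrightarrow> norm (A z) \<le> exp (exp (t * (k1 * X)))"
    using A(1) unfolding power_growth_def by (rule eventually_compose_filterlim[rotated])
  have ev7: "\<forall>\<^sub>F X in at_top. max 2 (max (N1 / k0) (max (2 / d) (1 / (p * d) + 2 / d))) \<le> X" by (rule eventually_ge_at_top)
  show ?thesis using ev1 ev2 ev3 ev4 ev5 ev6 ev7 pg1 unfolding power_growth_def
  proof eventually_elim
    case (elim X)
    note e1 = elim(1) and e2 = elim(2-5) and e3 = elim(6) and e4 = elim(7) and e5 = elim(8) and e6 = elim(9)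
      and pgX = elim(11)
    have X: "2 \<le> X" "N1 \<le> k0 * X" "2 \<le> d * X" "1 / p + 2 \<le> d * X"
    proof -
      have "2 \<le> X" "N1 / k0 \<le> X" "2 / d \<le> X" "1 / (p * d) + 2 / d \<le> X" using elim(10) by auto
      moreover have "d * (1 / (p * d) + 2 / d) = 1 / p + 2" using kk p(1) by (simp add: field_simps)
      moreover have "d * (1 / (p * d) + 2 / d) \<le> d * X" using calculation(4) kk by (intro mult_left_mono) auto
      ultimately show "2 \<le> X" "N1 \<le> k0 * X" "2 \<le> d * X" "1 / p + 2 \<le> d * X"
        using kk k by (auto simp: field_simps)
    qed
    have "0 \<le> N1" "N \<le> N1" unfolding N1_def by auto
    have mul: "u * X \<le> v * X" if "u \<le> v" for u v using X(1) that by (intro mult_right_mono) auto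
    show ?case
    proof (intro impI)
      assume BX: "\<forall>z. norm z \<le> exp X \<longrightarrow> norm (B z) \<le> exp (exp (\<mu> * X))"
      have ray: "norm (G (Complex x \<theta>)) \<le> exp (- (exp (s * x) / 2)) * norm (F (Complex x \<theta>))"
        if \<theta>: "\<theta> \<in> T" and x: "x \<in> {k0 * X..X}" for \<theta> x
      proof -
        have "norm (B (exp (Complex x \<theta>))) \<le> exp (exp (\<mu> * X))" using BX x by auto
        also have "\<dots> \<le> exp (exp (\<mu> / k0 * x))"
        proof -
          have "\<mu> / k0 * (k0 * X) \<le> \<mu> / k0 * x" using x \<mu> k by (intro mult_left_mono) auto
          then show ?thesis using k by simp
        qed
        finally have "norm (B (exp (Complex x \<theta>))) \<le> exp (exp (\<mu> / k0 * x))" .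
        moreover have "N \<le> x" using x X(2) \<open>N \<le> N1\<close> by auto
        ultimately show ?thesis using N[of x] \<theta> by auto
      qed
      \<comment> \<open>Bound for the logarithmic derivative of \<open>F\<close> on the rays of the
        net: the factor \<open>exp X\<close> bounds the modulus of \<open>exp \<zeta>\<close> that
        comes from the chain rule.\<close>
      define \<delta> where "\<delta> = exp (X - exp (s * (k0 * X)) / 2)"
      have "\<delta> * X \<le> 1 / 2"
      proof -
        have "X \<le> exp X" using exp_ge_add_one_self[of X] by linarith
        then have "\<delta> * X \<le> \<delta> * exp X" unfolding \<delta>_def by (intro mult_left_mono) auto
        also have "\<dots> = exp (2 * X - exp (s * (k0 * X)) / 2)" unfolding \<delta>_def exp_add[symmetric] by (simp add: algebra_simps)
        also have "\<dots> \<le> exp (- 1)" using e1 by (simp add: mult.assoc)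
        also have "\<dots> \<le> 1 / 2" using two_power_le_exp[of 1] by (simp add: exp_minus field_simps)
        finally show ?thesis .
      qed
      then have e\<delta>: "exp (\<delta> * (x - k0 * X)) \<le> 2" if "x \<in> {k0 * X..X}" for x
      proof -
        have "0 \<le> k0 * X" using k(1) X(1) by simp
        then have "x - k0 * X \<le> X" using that by auto
        then have "\<delta> * (x - k0 * X) \<le> \<delta> * X" unfolding \<delta>_def by (intro mult_left_mono) auto
        then have "\<delta> * (x - k0 * X) \<le> 1 / 2" using \<open>\<delta> * X \<le> 1 / 2\<close> by linarith
        then have "exp (\<delta> * (x - k0 * X)) \<le> exp (1 / 2)" by simp
        also have "\<dots> \<le> 1 + 1/2 + (1/2)\<^sup>2" by (intro exp_bound) auto
        also have "\<dots> \<le> 2" by (simp add: power2_eq_square)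
        finally show ?thesis .
      qed
      have gr: "norm (F (Complex x \<theta>)) \<le> 2 * norm (F (Complex (k0 * X) \<theta>))"
        "norm (F (Complex (k0 * X) \<theta>)) \<le> 2 * norm (F (Complex x \<theta>))"
        if \<theta>: "\<theta> \<in> T" and x: "x \<in> {k0 * X..X}" for \<theta> x
      proof -
        have bd: "norm (deriv F (Complex u \<theta>)) \<le> \<delta> * norm (F (Complex u \<theta>))" if u: "u \<in> {k0 * X..x}" for u
        proof -
          have "norm (deriv F (Complex u \<theta>)) = norm (G (Complex u \<theta>)) * exp u" unfolding dF by (simp add: norm_mult)
          also have "\<dots> \<le> exp (- (exp (s * u) / 2)) * norm (F (Complex u \<theta>)) * exp X"
            using ray[OF \<theta>, of u] u x by (intro mult_mono) auto
          also have "\<dots> \<le> exp (- (exp (s * (k0 * X)) / 2)) * norm (F (Complex u \<theta>)) * exp X"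
            using u s by (intro mult_right_mono) auto
          also have "\<dots> = \<delta> * norm (F (Complex u \<theta>))" unfolding \<delta>_def diff_conv_add_uminus exp_add by (simp add: mult_ac)
          finally show ?thesis .
        qed
        have le: "k0 * X \<le> x" using x by simp
        note g = gronwall_segment[OF Fh le bd]
        show "norm (F (Complex x \<theta>)) \<le> 2 * norm (F (Complex (k0 * X) \<theta>))"
          using g(1) mult_left_mono[OF e\<delta>[OF x], of "norm (F (Complex (k0 * X) \<theta>))"] by simp
        show "norm (F (Complex (k0 * X) \<theta>)) \<le> 2 * norm (F (Complex x \<theta>))"
          using g(2) mult_left_mono[OF e\<delta>[OF x], of "norm (F (Complex x \<theta>))"] by simp
      qed

      define M where "M = Max ((\<lambda>\<theta>. norm (F (Complex (k0 * X) \<theta>))) ` T)"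
      have M_ge: "norm (F (Complex (k0 * X) \<theta>)) \<le> M" if "\<theta> \<in> T" for \<theta>
        unfolding M_def using T(1) that by (intro Max_ge) auto
      have "M \<in> (\<lambda>\<theta>. norm (F (Complex (k0 * X) \<theta>))) ` T" unfolding M_def using T(1,2) by (intro Max_in) auto
      then obtain \<theta>s where \<theta>s: "\<theta>s \<in> T" "norm (F (Complex (k0 * X) \<theta>s)) = M" by auto
      \<comment> \<open>Gronwall's inequality between \<open>N1\<close> and \<open>k0 * X\<close>,
        with the bound \<open>exp (K * x)\<close> for \<open>f'/f\<close>, which holds on the whole
        ray and not only where \<open>B\<close> is controlled.\<close>
      have "\<beta> \<le> M * exp (exp ((K + 2) * X))"
      proof -
        have bd: "norm (deriv F (Complex u a)) \<le> exp ((K + 1) * X) * norm (F (Complex u a))" if u: "u \<in> {N1..k0 * X}" for u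
        proof -
          have "u \<le> X" using u kk mul[of k0 1] by auto
          have "norm (deriv F (Complex u a)) = norm (G (Complex u a)) * exp u" unfolding dF by (simp add: norm_mult)
          also have "\<dots> \<le> (exp (K * u) * norm (F (Complex u a))) * exp u"
            using N[of u] T(2) u \<open>N \<le> N1\<close> by (intro mult_right_mono) auto
          also have "\<dots> = exp ((K + 1) * u) * norm (F (Complex u a))"
          proof -
            have "exp ((K + 1) * u) = exp (K * u) * exp u" unfolding exp_add[symmetric] by (simp add: algebra_simps)
            then show ?thesis by simp
          qed
          also have "\<dots> \<le> exp ((K + 1) * X) * norm (F (Complex u a))"
            using \<open>u \<le> X\<close> K by (intro mult_right_mono) auto
          finally show ?thesis .
        qed
        have "\<beta> \<le> norm (F (Complex (k0 * X) a)) * exp (exp ((K + 1) * X) * (k0 * X - N1))"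
          unfolding \<beta>_def by (rule gronwall_segment(2)[OF Fh X(2) bd])
        also have "\<dots> \<le> M * exp (exp ((K + 2) * X))"
        proof (intro mult_mono)
          have "k0 * X - N1 \<le> X" using mul[of k0 1] kk \<open>0 \<le> N1\<close> by simp
          also have "X \<le> exp X" using exp_ge_add_one_self[of X] by linarith
          finally have "exp ((K + 1) * X) * (k0 * X - N1) \<le> exp ((K + 1) * X) * exp X" by (intro mult_left_mono) auto
          also have "\<dots> = exp ((K + 2) * X)" unfolding exp_add[symmetric] by (simp add: algebra_simps)
          finally show "exp (exp ((K + 1) * X) * (k0 * X - N1)) \<le> exp (exp ((K + 2) * X))" by simp
          have "0 \<le> norm (F (Complex (k0 * X) \<theta>s))" by simp
          then show "0 \<le> M" unfolding \<theta>s(2) .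
        qed (use M_ge[OF T(2)] in auto)
        finally show ?thesis .
      qed
      then have "0 < M" using \<open>0 < \<beta>\<close> by (smt (verit) exp_gt_zero mult_nonpos_nonneg)
      \<comment> \<open>The interpolated bounds are relative to \<open>2 * M\<close>, while at the
        ends only the absolute growth of \<open>f'\<close> is known; this inequality lets the excess
        cover the difference.\<close>
      have lnM: "- ln (2 * M) \<le> exp ((K + 2) * X) - ln (2 * \<beta>)"
      proof -
        have "2 * \<beta> \<le> (2 * M) * exp (exp ((K + 2) * X))" using \<open>\<beta> \<le> M * exp (exp ((K + 2) * X))\<close> by simp
        then have "ln (2 * \<beta>) \<le> ln ((2 * M) * exp (exp ((K + 2) * X)))" using \<open>0 < \<beta>\<close> \<open>0 < M\<close> by (subst ln_le_cancel_iff) auto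
        also have "\<dots> = ln (2 * M) + exp ((K + 2) * X)" using \<open>0 < M\<close> by (subst ln_mult) auto
        finally show ?thesis by simp
      qed
      have e2M: "exp (ln (2 * M)) = 2 * M" using \<open>0 < M\<close> by simp

      have thin: "norm (G (Complex x y)) \<le> exp (ln (2 * M) - exp (s * (\<kappa> * X)) / 2 + 1)"
        if \<kappa>: "k0 \<le> \<kappa>" and x: "(\<kappa> + \<epsilon>) * X \<le> x" "x \<le> (1 - \<epsilon>) * X" and y: "y \<in> {a..b}" for \<kappa> x y
      proof -
        define E where "E = exp (C2 * X)"
        have "0 \<le> \<epsilon> * X" using k(2) X(1) by simp
        then have x': "\<epsilon> * X \<le> x - \<kappa> * X" "\<epsilon> * X \<le> X - x" using x by (auto simp: algebra_simps)
        then have \<kappa>X: "k0 * X \<le> \<kappa> * X" "\<kappa> * X \<le> X" using mul[OF \<kappa>] \<open>0 \<le> \<epsilon> * X\<close> by auto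
        have E4: "4 * E \<le> exp (q * v)" if "\<epsilon> * X \<le> v" for v
        proof -
          have "4 \<le> exp (2::real)" using two_power_le_exp[of 2] by simp
          also have "\<dots> \<le> exp X" using X(1) by simp
          finally have "4 * E \<le> exp X * E" unfolding E_def by (intro mult_right_mono) auto
          also have "\<dots> = exp ((C + K + s + 6) * X)" unfolding E_def C2_def exp_add[symmetric] by (simp add: algebra_simps)
          also have "\<dots> \<le> exp (q * v)"
          proof -
            have "(C + K + s + 6) * X \<le> (q * \<epsilon>) * X" by (rule mul[OF q(3)])
            also have "\<dots> \<le> q * v" using that q(1) by (simp add: mult.assoc)
            finally show ?thesis by simp
          qed
          finally show ?thesis .
        qed
        have "norm (G (Complex x y)) \<le> exp ((ln (2 * M) - exp (s * (\<kappa> * X)) / 2) + 1)"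
        proof (rule norm_le_between_net_rays[OF Gh q(1,2) T(3,4), of E x "\<kappa> * X" X _ y])
          show "norm (G (Complex u \<theta>)) \<le> exp (ln (2 * M) - exp (s * (\<kappa> * X)) / 2)" if \<theta>: "\<theta> \<in> T" and u: "u \<in> {\<kappa> * X..X}" for \<theta> u
          proof -
            have u': "u \<in> {k0 * X..X}" using u \<kappa>X by auto
            have "norm (G (Complex u \<theta>)) \<le> exp (- (exp (s * u) / 2)) * norm (F (Complex u \<theta>))" by (rule ray[OF \<theta> u'])
            also have "\<dots> \<le> exp (- (exp (s * (\<kappa> * X)) / 2)) * (2 * M)"
              using gr(1)[OF \<theta> u'] M_ge[OF \<theta>] u s by (intro mult_mono) auto
            also have "\<dots> = exp (ln (2 * M) - exp (s * (\<kappa> * X)) / 2)"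
              unfolding diff_conv_add_uminus exp_add e2M by simp
            finally show ?thesis .
          qed
          have ends: "norm (G (Complex u v)) \<le> exp (ln (2 * M) - exp (s * (\<kappa> * X)) / 2 + E)" if "u \<le> X" for u v
          proof -
            have "norm (G (Complex u v)) \<le> exp (exp (C1 * X))" unfolding G_def using pgX that by auto
            also have "\<dots> \<le> exp (ln (2 * M) - exp (s * (\<kappa> * X)) / 2 + E)"
            proof (subst exp_le_cancel_iff)
              have "exp (s * (\<kappa> * X)) \<le> exp (s * X)" using \<kappa>X(2) s by simp
              then show "exp (C1 * X) \<le> ln (2 * M) - exp (s * (\<kappa> * X)) / 2 + E"
                using e2 lnM unfolding E_def by linarith
            qed
            finally show ?thesis .
          qed
          show "norm (G (Complex (\<kappa> * X) v)) \<le> exp (ln (2 * M) - exp (s * (\<kappa> * X)) / 2 + E) \<and>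
             norm (G (Complex X v)) \<le> exp (ln (2 * M) - exp (s * (\<kappa> * X)) / 2 + E)" for v
            using ends \<kappa>X by auto
          show "x \<in> {\<kappa> * X..X}" using x' \<open>0 \<le> \<epsilon> * X\<close> by auto
        qed (use E4 x' y in \<open>auto simp: E_def\<close>)
        then show ?thesis .
      qed

      have zone: "(k0 + \<epsilon>) * X \<le> x" "x \<le> (1 - \<epsilon>) * X" "k0 * X \<le> x" "x \<le> X" if "(k0 + d) * X \<le> x" "x \<le> k2 * X" for x
        using that mul[of "k0 + \<epsilon>" "k0 + d"] mul[of k2 "1 - \<epsilon>"] mul[of k0 "k0 + d"] mul[of k2 1] k kk by auto

      have F_ge: "M / 4 \<le> norm (F (Complex x y))" if x: "(k0 + d) * X \<le> x" "x \<le> k2 * X" and y: "y \<in> {a..b}" for x y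
      proof -
        note z = zone[OF x]
        \<comment> \<open>A degenerate box: the vertical segment at abscissa \<open>x\<close>, along
          which \<open>F\<close> is compared with its value on the ray \<open>\<theta>s\<close>,
          where it is at least \<open>M / 2\<close>.\<close>
        define S where "S = cbox (Complex x a) (Complex x b)"
        define V where "V = exp (ln (2 * M) - exp (s * (k0 * X)) / 2 + 1) * exp X"
        have "norm (F (Complex x \<theta>s) - F (Complex x y)) \<le> V * norm (Complex x \<theta>s - Complex x y)"
        proof (rule field_differentiable_bound[of S F "deriv F"])
          show "convex S" unfolding S_def by (rule convex_box)
          show "(F has_field_derivative deriv F v) (at v within S)" if "v \<in> S" for v
            using holomorphic_derivI[OF Fh open_UNIV UNIV_I] has_field_derivative_at_within by blast
          show "norm (deriv F v) \<le> V" if v: "v \<in> S" for v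
          proof -
            have v': "v = Complex x (Im v)" "Im v \<in> {a..b}" using v unfolding S_def by (auto simp: in_cbox_complex_iff complex_eq_iff)
            have "norm (G (Complex x (Im v))) \<le> exp (ln (2 * M) - exp (s * (k0 * X)) / 2 + 1)"
              by (rule thin[OF order_refl z(1,2) v'(2)])
            then have "norm (G v) \<le> exp (ln (2 * M) - exp (s * (k0 * X)) / 2 + 1)" using v'(1) by simp
            moreover have "Re v \<le> X" using v'(1) z(4) by (metis complex.sel(1))
            ultimately show ?thesis unfolding dF V_def norm_mult norm_exp_eq_Re by (intro mult_mono) auto
          qed
          show "Complex x \<theta>s \<in> S" "Complex x y \<in> S" using \<theta>s(1) T(3) y unfolding S_def by (auto simp: in_cbox_complex_iff)
        qed
        also have "norm (Complex x \<theta>s - Complex x y) \<le> b - a"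
        proof -
          have "norm (Complex x \<theta>s - Complex x y) = \<bar>\<theta>s - y\<bar>" by (simp add: cmod_def)
          moreover have "\<theta>s \<in> {a..b}" using \<theta>s(1) T(3) by blast
          ultimately show ?thesis using y by (simp add: abs_le_iff)
        qed
        finally have diff: "norm (F (Complex x \<theta>s) - F (Complex x y)) \<le> V * (b - a)"
          unfolding V_def by (simp add: mult_left_mono)
        have "V * (b - a) \<le> M / 4"
        proof -
          have ab: "0 \<le> b - a" using y by auto
          have "8 * (b - a) + 1 = exp (ln (8 * (b - a) + 1))" using ab by simp
          also have "\<dots> \<le> exp \<bar>ln (8 * (b - a) + 1)\<bar>" by simp
          finally have "8 * (b - a) \<le> exp \<bar>ln (8 * (b - a) + 1)\<bar>" by linarith
          then have "V * (8 * (b - a)) \<le> V * exp \<bar>ln (8 * (b - a) + 1)\<bar>" unfolding V_def by (intro mult_left_mono) auto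
          also have "\<dots> = 2 * M * exp (X + 1 - exp (s * (k0 * X)) / 2 + \<bar>ln (8 * (b - a) + 1)\<bar>)"
          proof -
            have "V * exp \<bar>ln (8 * (b - a) + 1)\<bar> = exp (ln (2 * M)) * exp (X + 1 - exp (s * (k0 * X)) / 2 + \<bar>ln (8 * (b - a) + 1)\<bar>)"
              unfolding V_def exp_add[symmetric] by (rule arg_cong[where f = exp]) simp
            then show ?thesis unfolding e2M .
          qed
          also have "\<dots> \<le> 2 * M * 1"
            using e3 \<open>0 < M\<close> by (intro mult_left_mono) (auto simp: mult.assoc)
          finally have "V * (8 * (b - a)) \<le> 2 * M * 1" .
          moreover have "V * (8 * (b - a)) = 8 * (V * (b - a))" by simp
          ultimately show ?thesis by linarith
        qed
        moreover have "M / 2 \<le> norm (F (Complex x \<theta>s))" using gr(2)[OF \<theta>s(1), of x] z \<theta>s(2) by auto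
        ultimately show ?thesis using diff norm_triangle_ineq2[of "F (Complex x \<theta>s)" "F (Complex x y)"] by linarith
      qed

      have sub: "y \<in> {a..b}" if "y \<in> {c - half..c + half}" for y
        using that p unfolding half_def by auto
      have width: "c - half < c + half" "p = pi / ((c + half) - (c - half))" "c = ((c - half) + (c + half)) / 2"
        using \<open>0 < half\<close> p(1) unfolding half_def by auto
      define E where "E = exp (s * ((k2 - \<epsilon>) * X)) / 2"
      have wide: "norm (G (Complex x y)) \<le> exp (ln (2 * M) + 1 - c2 * exp (\<Lambda>' * X))"
        if x: "\<bar>x - k1 * X\<bar> \<le> 1" and y: "\<bar>y - c\<bar> \<le> half - r" for x y
      proof -
        have dX: "k1 * X = (k0 + d) * X + d * X" "k2 * X = k1 * X + 2 * (d * X)" unfolding k(4,5) by (simp_all add: algebra_simps)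
        have x': "(k0 + d) * X \<le> x" "x \<le> k2 * X" using x X(3) dX unfolding abs_le_iff by linarith+
        have y': "y \<in> {c - half..c + half}" using y r(1) by auto
        have "norm (G (Complex x y)) \<le> exp ((ln (2 * M) + 1) - E * ((exp (- (p * (k2 * X - x))) - exp (- (p * (x + k2 * X - 2 * ((k0 + d) * X))))) * cos (p * (y - c))))"
        proof (rule norm_le_in_wide_rectangle[OF Gh width])
          show "0 \<le> E" unfolding E_def by simp
          show "norm (G (Complex u v)) \<le> exp (ln (2 * M) + 1)" if u: "u \<in> {(k0 + d) * X..k2 * X}" and v: "v \<in> {c - half..c + half}" for u v
          proof -
            have "norm (G (Complex u v)) \<le> exp (ln (2 * M) - exp (s * (k0 * X)) / 2 + 1)"
              using zone[of u] u sub[OF v] by (intro thin) auto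
            also have "\<dots> \<le> exp (ln (2 * M) + 1)" by simp
            finally show ?thesis .
          qed
          show "norm (G (Complex (k2 * X) v)) \<le> exp (ln (2 * M) + 1 - E)" if v: "v \<in> {c - half..c + half}" for v
          proof -
            have "norm (G (Complex (k2 * X) v)) \<le> exp (ln (2 * M) - exp (s * ((k2 - \<epsilon>) * X)) / 2 + 1)"
              using kk(2) mul[OF kk(4)] sub[OF v] by (intro thin) auto
            moreover have "ln (2 * M) + 1 - E = ln (2 * M) - exp (s * ((k2 - \<epsilon>) * X)) / 2 + 1" unfolding E_def by simp
            ultimately show ?thesis by (simp only:)
          qed
        qed (use x' y' in auto)
        also have "\<dots> \<le> exp (ln (2 * M) + 1 - c2 * exp (\<Lambda>' * X))"
        proof -
          let ?e1 = "exp (- (p * (k2 * X - x)))" and ?e2 = "exp (- (p * (x + k2 * X - 2 * ((k0 + d) * X))))"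
          have cy: "c1 \<le> cos (p * (y - c))"
          proof -
            have "p * \<bar>y - c\<bar> \<le> p * (half - r)" using y p(1) by (intro mult_left_mono) auto
            moreover have "p * (half - r) \<le> p * half" using p(1) r(1) by (intro mult_left_mono) auto
            then have "p * (half - r) \<le> pi" using ph pi_gt_zero by linarith
            ultimately have "c1 \<le> cos (p * \<bar>y - c\<bar>)" unfolding c1_def using p(1) by (intro cos_monotone_0_pi_le) auto
            moreover have "cos (p * \<bar>y - c\<bar>) = cos (p * (y - c))" using p(1) cos_abs_real[of "p * (y - c)"] by (simp add: abs_mult)
            ultimately show ?thesis by simp
          qed
          \<comment> \<open>The reflected exponential is at most half the main one once
            \<open>x\<close> is at distance at least \<open>1 / p\<close> from the left end, which
            \<open>1 / p + 2 \<le> d * X\<close> ensures.\<close>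
          have e21: "?e2 \<le> ?e1 / 2"
          proof -
            have "1 \<le> p * (x - (k0 + d) * X)"
            proof -
              have "1 / p \<le> x - (k0 + d) * X" using x X(4) dX by auto
              then have "p * (1 / p) \<le> p * (x - (k0 + d) * X)" using p(1) by (intro mult_left_mono) auto
              then show ?thesis using p(1) by simp
            qed
            moreover have "- (p * (x + k2 * X - 2 * ((k0 + d) * X))) = - (p * (k2 * X - x)) - 2 * (p * (x - (k0 + d) * X))"
              by (simp add: algebra_simps)
            ultimately have "- (p * (x + k2 * X - 2 * ((k0 + d) * X))) \<le> - (p * (k2 * X - x)) - 1" by linarith
            then have "?e2 \<le> exp (- (p * (k2 * X - x)) - 1)" by (subst exp_le_cancel_iff)
            also have "\<dots> = ?e1 / exp 1" by (simp add: exp_diff)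
            also have "\<dots> \<le> ?e1 / 2" using two_power_le_exp[of 1] by (intro divide_left_mono) auto
            finally show ?thesis .
          qed
          have e1: "exp (- (p * ((k2 - k1) * X) + p)) \<le> ?e1"
          proof -
            have "p * (k2 * X - x) \<le> p * ((k2 - k1) * X + 1)" using x p(1) by (intro mult_left_mono) (auto simp: algebra_simps)
            then show ?thesis by (simp add: algebra_simps)
          qed
          have "c2 * exp (\<Lambda>' * X) = E * ((exp (- (p * ((k2 - k1) * X) + p)) / 2) * c1)"
          proof -
            have "exp (\<Lambda>' * X) * exp (- p) = exp (s * ((k2 - \<epsilon>) * X)) * exp (- (p * ((k2 - k1) * X) + p))"
              unfolding \<Lambda>'_def exp_add[symmetric] by (simp add: algebra_simps)
            moreover have "c2 * exp (\<Lambda>' * X) = c1 / 4 * (exp (\<Lambda>' * X) * exp (- p))" by (simp add: c2_def)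
            ultimately show ?thesis by (simp add: E_def)
          qed
          also have "\<dots> \<le> E * ((?e1 - ?e2) * cos (p * (y - c)))"
          proof -
            have st: "exp (- (p * ((k2 - k1) * X) + p)) / 2 \<le> ?e1 - ?e2" using e1 e21 by linarith
            have "0 \<le> ?e1 - ?e2" by (rule order.trans[OF _ st]) simp
            moreover have "0 \<le> c1" "0 \<le> E" using \<open>0 < c1\<close> unfolding E_def by simp_all
            ultimately show ?thesis by (intro mult_left_mono[OF mult_mono[OF st cy]])
          qed
          finally show ?thesis by simp
        qed
        finally show ?thesis .
      qed

      show "\<forall>y\<in>{ya..yb}. norm (B (exp (Complex (k1 * X) y))) \<le> exp (- exp (\<nu> * (k1 * X)))"
      proof
        fix y assume y: "y \<in> {ya..yb}"
        let ?z = "Complex (k1 * X) y"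
        define W where "W = exp (ln (2 * M) + 1 - c2 * exp (\<Lambda>' * X))"
        have yc: "\<bar>y - c\<bar> \<le> half - 2 * r" using y r by (auto simp: abs_le_iff)
        have G0: "norm (G ?z) \<le> W" unfolding W_def using yc r(1) by (intro wide) auto
        \<comment> \<open>Cauchy's estimate on the disc of radius \<open>r\<close>; for its sake
          \<open>wide\<close> was proved in a neighbourhood of the arc.\<close>
        have "norm (deriv G ?z) \<le> W / r"
        proof (rule norm_deriv_le_entire[OF Gh r(1)])
          fix v assume v: "dist ?z v = r"
          have "\<bar>Re v - k1 * X\<bar> \<le> r" "\<bar>Im v - y\<bar> \<le> r"
            using v abs_Re_le_cmod[of "?z - v"] abs_Im_le_cmod[of "?z - v"] by (auto simp: dist_norm)
          then have "norm (G (Complex (Re v) (Im v))) \<le> W" unfolding W_def using yc r by (intro wide) auto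
          then show "norm (G v) \<le> W" by simp
        qed
        moreover have k1X: "0 \<le> k1 * X" using kk X by simp
        ultimately have d2: "norm (deriv (deriv f) (exp ?z)) \<le> W / r"
        proof -
          have "norm (deriv (deriv f) (exp ?z)) * 1 \<le> norm (deriv (deriv f) (exp ?z)) * exp (k1 * X)"
            using k1X by (intro mult_left_mono) auto
          also have "\<dots> = norm (deriv G ?z)" unfolding dG by (simp add: norm_mult)
          finally show ?thesis using \<open>norm (deriv G ?z) \<le> W / r\<close> by simp
        qed
        have y_ab: "y \<in> {a..b}" using yc r(1) by (intro sub) auto
        have "k1 * X = (k0 + d) * X + d * X" unfolding k(4) by (simp add: algebra_simps)
        then have Fl: "M / 4 \<le> norm (F ?z)" using X(3) mul[of k1 k2] kk y_ab by (intro F_ge) auto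
        have Az: "norm (A (exp ?z)) \<le> exp (exp (t * (k1 * X)))" using e6 by auto
        \<comment> \<open>The equation solved for \<open>B\<close>. The factor \<open>M\<close> also
          occurs in \<open>W\<close> and cancels, and the growth of \<open>A\<close>, whose exponent
          \<open>t * k1\<close> is below \<open>\<Lambda>'\<close>, is absorbed.\<close>
        have "norm (B (exp ?z)) * (M / 4) \<le> norm (B (exp ?z)) * norm (F ?z)" using Fl by (intro mult_left_mono) auto
        also have "\<dots> = norm (deriv (deriv f) (exp ?z) + A (exp ?z) * G ?z)"
        proof -
          have "B (exp ?z) * F ?z = - (deriv (deriv f) (exp ?z) + A (exp ?z) * G ?z)"
            using ode[of "exp ?z"] unfolding F_def G_def by (simp add: algebra_simps add_eq_0_iff)
          then have "norm (B (exp ?z) * F ?z) = norm (deriv (deriv f) (exp ?z) + A (exp ?z) * G ?z)" by (metis norm_minus_cancel)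
          then show ?thesis by (simp add: norm_mult)
        qed
        also have "\<dots> \<le> norm (deriv (deriv f) (exp ?z)) + norm (A (exp ?z)) * norm (G ?z)"
          using norm_triangle_ineq[of "deriv (deriv f) (exp ?z)" "A (exp ?z) * G ?z"] by (simp add: norm_mult)
        also have "\<dots> \<le> W / r + exp (exp (t * (k1 * X))) * W"
          using d2 Az G0 by (intro add_mono mult_mono) auto
        also have "\<dots> \<le> W * (2 / r * exp (exp (t * (k1 * X))))"
        proof -
          have "1 * (1 / r) \<le> exp (exp (t * (k1 * X))) * (1 / r)" using r(1) by (intro mult_right_mono) auto
          moreover have "exp (exp (t * (k1 * X))) * 1 \<le> exp (exp (t * (k1 * X))) * (1 / r)"
            using r(1,2) by (intro mult_left_mono) auto
          ultimately have "1 / r + exp (exp (t * (k1 * X))) \<le> 2 / r * exp (exp (t * (k1 * X)))" by (simp add: field_simps)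
          then have "W * (1 / r + exp (exp (t * (k1 * X)))) \<le> W * (2 / r * exp (exp (t * (k1 * X))))"
            unfolding W_def by (intro mult_left_mono) auto
          then show ?thesis by (simp add: algebra_simps)
        qed
        also have "\<dots> = (M / 4) * exp (ln (16 / r) + 1 - c2 * exp (\<Lambda>' * X) + exp (t * (k1 * X)))"
        proof -
          have "W = exp (ln (2 * M)) * exp (1 - c2 * exp (\<Lambda>' * X))" unfolding W_def exp_add[symmetric] by simp
          then have "W = 2 * M * exp (1 - c2 * exp (\<Lambda>' * X))" unfolding e2M .
          moreover have "exp (ln (16 / r)) = 16 / r" using r(1) by simp
          ultimately show ?thesis by (simp add: exp_add exp_diff)
        qed
        finally have "norm (B (exp ?z)) \<le> exp (ln (16 / r) + 1 - c2 * exp (\<Lambda>' * X) + exp (t * (k1 * X)))"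
          using \<open>0 < M\<close> by simp
        also have "\<dots> \<le> exp (- exp (\<nu> * (k1 * X)))" using e4 e5 by (simp add: mult.assoc)
        finally show "norm (B (exp ?z)) \<le> exp (- exp (\<nu> * (k1 * X)))" .
      qed
    qed
  qed
qed

text \<open>Inside the sector of half-opening \<open>pi / (2 * n)\<close> lie good rays
  \<open>a\<close>, \<open>b\<close> just outside the sector for \<open>p\<close>, with
  \<open>p\<close> slightly above \<open>n\<close>, and good rays \<open>ya\<close>,
  \<open>yb\<close> between the sectors for \<open>p\<close> and \<open>\<rho>\<close>. Between
  \<open>ya\<close> and \<open>yb\<close> the coefficient \<open>B\<close> is tiny on arbitrarily
  distant arcs, while the equation bounds it on these two rays; as their opening exceeds
  \<open>pi / \<rho>\<close>, it vanishes.\<close>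

lemma coefficient_eq_0_of_finite_order:
  fixes A B f :: "complex \<Rightarrow> complex" and n \<rho> \<mu> :: real
  assumes f: "f holomorphic_on UNIV" "power_growth f C" "0 < C" and nz: "f \<zeta>0 \<noteq> 0" "deriv f \<zeta>1 \<noteq> 0"
    and ode: "\<And>z. deriv (deriv f) z + A z * deriv f z + B z * f z = 0"
    and Bh: "B holomorphic_on UNIV"
    and n: "0 < n" "n < \<rho>" and \<mu>: "0 \<le> \<mu>" "\<mu> < \<rho>"
    and big: "\<And>\<theta> s. \<bar>\<theta> - c\<bar> < pi / (2 * n) \<Longrightarrow> n < s \<Longrightarrow> s < \<rho> \<Longrightarrow>
      \<forall>\<^sub>F x in at_top. exp (exp (s * x)) \<le> norm (A (exp (Complex x \<theta>)))"
    and up: "\<And>t. \<rho> < t \<Longrightarrow> power_growth A t"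
    and B: "\<exists>\<^sub>F X in at_top. \<forall>z. norm z \<le> exp X \<longrightarrow> norm (B z) \<le> exp (exp (\<mu> * X))"
  shows "B z = 0"
proof -
  \<comment> \<open>The mean of \<open>\<mu> / \<rho>\<close> and 1, so that
    \<open>\<mu> / k0 < \<rho>\<close>: a bound for \<open>B\<close> with exponent
    \<open>\<mu>\<close> at \<open>X\<close> becomes one with exponent \<open>\<mu> / k0\<close> for
    \<open>x >= k0 * X\<close>.\<close>
  define k0 where "k0 = (\<mu> / \<rho> + 1) / 2"
  have "0 < \<rho>" using n by simp
  have "\<mu> / \<rho> < 1" "0 \<le> \<mu> / \<rho>" using \<mu> \<open>0 < \<rho>\<close> by auto
  then have k0: "0 < k0" "k0 < 1" unfolding k0_def by auto
  have "\<mu> < \<rho> * k0" using \<mu> \<open>0 < \<rho>\<close> unfolding k0_def by (simp add: field_simps)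
  then have \<mu>k0: "\<mu> / k0 < \<rho>" using k0 by (simp add: divide_less_eq)
  define d where "d = (1 - k0) / 5"
  define k1 where "k1 = k0 + 2 * d"
  define k2 where "k2 = k0 + 4 * d"
  have d: "0 < d" "k2 + d = 1" using k0 unfolding d_def k2_def by (auto simp: field_simps)
  have k12: "k1 < k2" "0 < k1" using d(1) k0 unfolding k1_def k2_def by auto
  \<comment> \<open>At \<open>\<epsilon> = 0\<close> the required gap equals
    \<open>(\<rho> - n) * (k2 - k1)\<close>, which is positive because the transport loses only the
    rate \<open>n\<close>, less than \<open>\<rho>\<close>. By continuity the gap persists for small
    positive \<open>\<epsilon>\<close>.\<close>
  have "((\<lambda>\<epsilon>. (\<rho> - \<epsilon>) * (k2 - \<epsilon>) - (n + \<epsilon>) * (k2 - k1) - (\<rho> + 2 * \<epsilon>) * k1) \<longlongrightarrow>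
      (\<rho> - 0) * (k2 - 0) - (n + 0) * (k2 - k1) - (\<rho> + 2 * 0) * k1) (at_right 0)"
    by (intro tendsto_intros)
  moreover have "0 < (\<rho> - n) * (k2 - k1)" using n k12 by simp
  then have "0 < (\<rho> - 0) * (k2 - 0) - (n + 0) * (k2 - k1) - (\<rho> + 2 * 0) * k1" by (simp add: algebra_simps)
  ultimately have "\<forall>\<^sub>F \<epsilon> in at_right 0. 0 < (\<rho> - \<epsilon>) * (k2 - \<epsilon>) - (n + \<epsilon>) * (k2 - k1) - (\<rho> + 2 * \<epsilon>) * k1"
    by (rule order_tendstoD(1))
  moreover have lt: "\<forall>\<^sub>F \<epsilon> in at_right 0. \<epsilon> < u" if "0 < u" for u :: real
    using order_tendstoD(2)[OF tendsto_ident_at that] .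
  have "0 < min d (min (\<rho> - n) (\<rho> - \<mu> / k0))" using d n \<mu>k0 by simp
  note lt[OF this]
  moreover have "\<forall>\<^sub>F \<epsilon> in at_right (0::real). 0 < \<epsilon>" by (rule eventually_at_right_less)
  ultimately have "\<forall>\<^sub>F \<epsilon> in at_right 0. 0 < (\<rho> - \<epsilon>) * (k2 - \<epsilon>) - (n + \<epsilon>) * (k2 - k1) - (\<rho> + 2 * \<epsilon>) * k1 \<and>
     \<epsilon> < min d (min (\<rho> - n) (\<rho> - \<mu> / k0)) \<and> 0 < \<epsilon>" by eventually_elim auto
  then obtain \<epsilon> where "0 < (\<rho> - \<epsilon>) * (k2 - \<epsilon>) - (n + \<epsilon>) * (k2 - k1) - (\<rho> + 2 * \<epsilon>) * k1 \<and>
     \<epsilon> < min d (min (\<rho> - n) (\<rho> - \<mu> / k0)) \<and> 0 < \<epsilon>"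
    using eventually_happens'[OF trivial_limit_at_right_real] by blast
  then have \<epsilon>: "0 < \<epsilon>" "\<epsilon> \<le> d" "\<epsilon> < \<rho> - n" "\<mu> / k0 < \<rho> - \<epsilon>"
    and gap: "(\<rho> + 2 * \<epsilon>) * k1 < (\<rho> - \<epsilon>) * (k2 - \<epsilon>) - (n + \<epsilon>) * (k2 - k1)" by auto
  define p where "p = n + \<epsilon>"
  have p: "0 < p" "p < \<rho>" "n < p" using n \<epsilon> unfolding p_def by auto
  have pi_less: "pi / (2 * v) < pi / (2 * u)" if "0 < u" "u < v" for u v :: real
    using that by (intro divide_strict_left_mono mult_pos_pos) auto
  note order = pi_less[OF n(1) p(3)] pi_less[OF p(1,2)]

  obtain K where K: "0 < K" and good: "\<And>\<alpha> \<beta>. \<alpha> < \<beta> \<Longrightarrow> \<exists>\<theta>\<in>{\<alpha><..<\<beta>}. \<forall>\<^sub>F x in at_top.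
     f (exp (Complex x \<theta>)) \<noteq> 0 \<and>
     norm (deriv f (exp (Complex x \<theta>))) \<le> exp (K * x) * norm (f (exp (Complex x \<theta>))) \<and>
     norm (deriv (deriv f) (exp (Complex x \<theta>))) \<le> exp (K * x) * norm (deriv f (exp (Complex x \<theta>)))"
    using exists_good_ray[OF f nz] by blast
  define D where "D = {\<theta>. \<forall>\<^sub>F x in at_top.
     f (exp (Complex x \<theta>)) \<noteq> 0 \<and>
     norm (deriv f (exp (Complex x \<theta>))) \<le> exp (K * x) * norm (f (exp (Complex x \<theta>))) \<and>
     norm (deriv (deriv f) (exp (Complex x \<theta>))) \<le> exp (K * x) * norm (deriv f (exp (Complex x \<theta>)))}"
  have dense: "\<exists>\<theta>\<in>D. \<alpha> < \<theta> \<and> \<theta> < \<beta>" if "\<alpha> < \<beta>" for \<alpha> \<beta>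
    using good[OF that] unfolding D_def by auto
  obtain a where a: "a \<in> D" "c - pi / (2 * n) < a" "a < c - pi / (2 * p)" using dense[of "c - pi / (2 * n)" "c - pi / (2 * p)"] order by auto
  obtain b where b: "b \<in> D" "c + pi / (2 * p) < b" "b < c + pi / (2 * n)" using dense[of "c + pi / (2 * p)" "c + pi / (2 * n)"] order by auto
  obtain ya where ya: "ya \<in> D" "c - pi / (2 * p) < ya" "ya < c - pi / (2 * \<rho>)" using dense[of "c - pi / (2 * p)" "c - pi / (2 * \<rho>)"] order by auto
  obtain yb where yb: "yb \<in> D" "c + pi / (2 * \<rho>) < yb" "yb < c + pi / (2 * p)" using dense[of "c + pi / (2 * \<rho>)" "c + pi / (2 * p)"] order by auto
  have "0 < pi / (2 * \<rho>)" using \<open>0 < \<rho>\<close> by simp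
  then have "ya < yb" "a < b" using a b ya yb order by linarith+

  define s where "s = \<rho> - \<epsilon>"
  have s: "0 < s" "n < s" "s < \<rho>" "\<mu> / k0 < s" using \<epsilon> n unfolding s_def by auto
  define q where "q = (C + K + s + 6) / \<epsilon>"
  have q: "0 < q" "C + K + s + 6 \<le> q * \<epsilon>" using \<epsilon>(1) f(3) K s unfolding q_def by auto
  define w where "w = 2 * pi / (3 * q)"
  have w: "0 < w" "q * w \<le> 2 * pi / 3" using q unfolding w_def by auto
  have "\<exists>T. finite T \<and> T \<subseteq> D \<inter> {a..b} \<and> a \<in> T \<and> b \<in> T \<and>
     (\<forall>y\<in>{a..b}. \<exists>y0\<in>T. \<exists>y1\<in>T. y0 \<le> y \<and> y \<le> y1 \<and> y1 - y0 \<le> w)"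
    by (rule finite_net_of_rays[OF dense a(1) b(1) \<open>a < b\<close> w(1)])
  then obtain T where T: "finite T" "T \<subseteq> D \<inter> {a..b}" "a \<in> T"
     "\<And>y. y \<in> {a..b} \<Longrightarrow> \<exists>y0\<in>T. \<exists>y1\<in>T. y0 \<le> y \<and> y \<le> y1 \<and> y1 - y0 \<le> w" by blast
  define t where "t = \<rho> + \<epsilon> / 2"
  define \<sigma> where "\<sigma> = \<rho> + \<epsilon>"
  define \<nu> where "\<nu> = \<rho> + 2 * \<epsilon>"
  have t: "\<rho> < t" "0 < t" "t < \<sigma>" "\<sigma> < \<nu>" "t < \<nu>" using \<epsilon> \<open>0 < \<rho>\<close> unfolding t_def \<sigma>_def \<nu>_def by auto
  have rays: "\<forall>\<^sub>F x in at_top. f (exp (Complex x \<theta>)) \<noteq> 0 \<and>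
        norm (deriv f (exp (Complex x \<theta>))) \<le> exp (K * x) * norm (f (exp (Complex x \<theta>))) \<and>
        norm (deriv (deriv f) (exp (Complex x \<theta>))) \<le> exp (K * x) * norm (deriv f (exp (Complex x \<theta>))) \<and>
        exp (exp (s * x)) \<le> norm (A (exp (Complex x \<theta>)))" if "\<theta> \<in> T" for \<theta>
  proof -
    have "\<theta> \<in> D" "a \<le> \<theta>" "\<theta> \<le> b" using that T(2) by auto
    then have "\<bar>\<theta> - c\<bar> < pi / (2 * n)" using a b by (simp add: abs_less_iff)
    from big[OF this s(2,3)] \<open>\<theta> \<in> D\<close>[unfolded D_def mem_Collect_eq] show ?thesis
      by eventually_elim auto
  qed
  have "\<forall>\<^sub>F X in at_top. (\<forall>z. norm z \<le> exp X \<longrightarrow> norm (B z) \<le> exp (exp (\<mu> * X))) \<longrightarrow>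
      (\<forall>y\<in>{ya..yb}. norm (B (exp (Complex (k1 * X) y))) \<le> exp (- exp (\<nu> * (k1 * X))))"
  proof (rule coefficient_small_on_arcs[OF f nz(1) ode up[OF t(1)] t(2) T(1,3) _ T(4) rays K s(1) \<mu>(1) s(4) k0(1) \<epsilon>(1,2) k1_def k2_def _ q(1) w(2) q(2) p(1) _ _ ya(2) \<open>ya < yb\<close> yb(3) _ t(5)])
    show "\<nu> * k1 < s * (k2 - \<epsilon>) - p * (k2 - k1)" using gap unfolding \<nu>_def s_def p_def .
  qed (use T(2) a b d in auto)
  then have "\<exists>\<^sub>F X in at_top. \<forall>y\<in>{ya..yb}. norm (B (exp (Complex (k1 * X) y))) \<le> exp (- exp (\<nu> * (k1 * X)))"
    using B by (rule frequently_rev_mp[rotated])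
  then have arcs: "\<exists>\<^sub>F X in at_top. \<forall>y\<in>{ya..yb}. norm (B (exp (Complex X y))) \<le> exp (- exp (\<nu> * X))"
    by (rule frequently_at_top_scale) (rule k12(2))
  \<comment> \<open>On good rays \<open>B = - (f'' + A * f') / f\<close> is bounded by the growth of
    \<open>A\<close> and powers of \<open>exp x\<close>. This holds for all large \<open>x\<close>,
    whereas the hypothesis on \<open>B\<close> speaks only of arbitrarily large
    \<open>X\<close>.\<close>
  have side: "\<forall>\<^sub>F x in at_top. norm (B (exp (Complex x \<theta>))) \<le> exp (exp (\<sigma> * x))" if "\<theta> \<in> D" for \<theta>
  proof -
    have "\<forall>\<^sub>F x in at_top. 2 * K * x + ln 2 \<le> 1 * exp (\<sigma> * x)" "\<forall>\<^sub>F x in at_top. K * x + ln 2 \<le> (1/2) * exp (\<sigma> * x)"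
      using t by (intro eventually_linear_le_exp; simp)+
    moreover have "\<forall>\<^sub>F x in at_top. 1 * exp (t * x) + 0 \<le> (1/2) * exp (\<sigma> * x)"
      using t by (intro eventually_exp_dominates) auto
    ultimately show ?thesis using up[OF t(1)] that unfolding power_growth_def D_def mem_Collect_eq
    proof eventually_elim
      case (elim x)
      let ?z = "exp (Complex x \<theta>)"
      have fz: "0 < norm (f ?z)" using elim(5) by simp
      have d1: "norm (deriv f ?z) \<le> exp (K * x) * norm (f ?z)" using elim(5) by simp
      have "norm (deriv (deriv f) ?z) \<le> exp (K * x) * norm (deriv f ?z)" using elim(5) by simp
      also have "\<dots> \<le> exp (K * x) * (exp (K * x) * norm (f ?z))" using d1 by (intro mult_left_mono) auto
      finally have d2: "norm (deriv (deriv f) ?z) \<le> exp (2 * K * x) * norm (f ?z)" by (simp flip: exp_add mult.assoc)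
      have "norm (B ?z) * norm (f ?z) = norm (deriv (deriv f) ?z + A ?z * deriv f ?z)"
      proof -
        have "B ?z * f ?z = - (deriv (deriv f) ?z + A ?z * deriv f ?z)" using ode[of ?z] by (simp add: algebra_simps add_eq_0_iff)
        then have "norm (B ?z * f ?z) = norm (deriv (deriv f) ?z + A ?z * deriv f ?z)" by (metis norm_minus_cancel)
        then show ?thesis by (simp add: norm_mult)
      qed
      also have "\<dots> \<le> norm (deriv (deriv f) ?z) + norm (A ?z) * norm (deriv f ?z)"
        using norm_triangle_ineq[of "deriv (deriv f) ?z" "A ?z * deriv f ?z"] by (simp add: norm_mult)
      also have "\<dots> \<le> exp (2 * K * x) * norm (f ?z) + exp (exp (t * x)) * (exp (K * x) * norm (f ?z))"
        using d1 d2 elim(4) by (intro add_mono mult_mono) auto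
      also have "\<dots> = (exp (2 * K * x) + exp (exp (t * x) + K * x)) * norm (f ?z)" by (simp add: exp_add algebra_simps)
      also have "\<dots> \<le> (exp (exp (\<sigma> * x)) / 2 + exp (exp (\<sigma> * x)) / 2) * norm (f ?z)"
      proof (intro mult_right_mono add_mono)
        have "exp (2 * K * x) \<le> exp (exp (\<sigma> * x) - ln 2)" using elim(1) by (subst exp_le_cancel_iff) linarith
        then show "exp (2 * K * x) \<le> exp (exp (\<sigma> * x)) / 2" by (simp add: exp_diff)
        have "exp (exp (t * x) + K * x) \<le> exp (exp (\<sigma> * x) - ln 2)" using elim(2,3) by (subst exp_le_cancel_iff) linarith
        then show "exp (exp (t * x) + K * x) \<le> exp (exp (\<sigma> * x)) / 2" by (simp add: exp_diff)
      qed auto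
      finally show ?case using fz by simp
    qed
  qed
  obtain x0 where x0: "\<And>x. x0 \<le> x \<Longrightarrow> norm (B (exp (Complex x ya))) \<le> exp (exp (\<sigma> * x)) \<and> norm (B (exp (Complex x yb))) \<le> exp (exp (\<sigma> * x))"
    using eventually_conj[OF side[OF ya(1)] side[OF yb(1)]] unfolding eventually_at_top_linorder by blast
  have "pi / (yb - ya) \<le> \<sigma>"
  proof -
    have "pi / \<rho> = pi / (2 * \<rho>) + pi / (2 * \<rho>)" by simp
    then have "pi / \<rho> \<le> yb - ya" using ya yb by linarith
    then have "pi \<le> \<rho> * (yb - ya)" using \<open>0 < \<rho>\<close> by (simp add: pos_divide_le_eq mult.commute)
    then have "pi / (yb - ya) \<le> \<rho>" using \<open>ya < yb\<close> by (simp add: pos_divide_le_eq)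
    then show ?thesis using t by linarith
  qed
  then have 0: "B (exp (Complex x y)) = 0" if "x0 < x" "ya < y" "y < yb" for x y
    by (rule zero_in_strip_of_rapid_decay[OF holomorphic_comp_exp[OF Bh] \<open>ya < yb\<close> _ t(4) x0 arcs that])
  show ?thesis by (rule entire_eq_0_of_strip[OF Bh \<open>ya < yb\<close> 0])
qed

section \<open>Reduction to the cases of finite and infinite order of \<open>h\<close>\<close>

theorem theorem3:
  fixes A B h :: "complex \<Rightarrow> complex" and P :: "complex poly" and n :: nat
  assumes "transcendental_entire A"
    and "\<And>z. A z = h z * exp (poly P z)"
    and "degree P = n" and "n \<ge> 1"
    and "h holomorphic_on UNIV" and "growth_order h > ereal (real n)"
    and "bounded_away_from_zero_in h (E_plus P)"
    and "exponentially_blows_up_in h (E_minus P)"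
    and "transcendental_entire B"
    and "growth_order B < growth_order A \<or> lower_growth_order B < growth_order A"
  shows "\<forall>f :: complex \<Rightarrow> complex.
           f holomorphic_on UNIV \<and>
           (\<forall>z. deriv (deriv f) z + A z * deriv f z + B z * f z = 0) \<and>
           (\<exists>z. f z \<noteq> 0) \<longrightarrow> infinite_order f"
proof (intro allI impI, elim conjE exE)
  fix f :: "complex \<Rightarrow> complex" and z0
  assume f: "f holomorphic_on UNIV" and ode: "\<forall>z. deriv (deriv f) z + A z * deriv f z + B z * f z = 0" and z0: "f z0 \<noteq> 0"
  have Aeq: "A = (\<lambda>z. h z * exp (poly P z))" using assms(2) by blast
  have B: "B holomorphic_on UNIV" and Bnz: "\<not> (\<forall>z. B z = 0)"
    using assms(9) poly_0 unfolding transcendental_entire_def by metis+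
  \<comment> \<open>For a nonzero constant \<open>f\<close> the equation would give
    \<open>B = 0\<close>, contrary to the transcendence of \<open>B\<close>.\<close>
  have "\<not> (\<forall>z. deriv f z = 0)"
  proof
    assume d0: "\<forall>z. deriv f z = 0"
    then have "deriv f = (\<lambda>_. 0)" by blast
    then have "deriv (deriv f) z = 0" for z by simp
    then have Bf: "B z * f z = 0" for z using ode d0 by simp
    have "(f has_field_derivative 0) (at z)" for z
      using holomorphic_derivI[OF f open_UNIV UNIV_I, of z] d0 by simp
    then have "\<exists>k. \<forall>z\<in>UNIV. f z = k" by (intro has_field_derivative_zero_constant) auto
    then have "f z = f z0" for z by (metis UNIV_I)
    then have "B z = 0" for z using Bf[of z] z0 by (metis mult_eq_0_iff)
    with Bnz show False by blast
  qed
  then obtain z1 where z1: "deriv f z1 \<noteq> 0" by blast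
  have Ah: "growth_order A \<le> growth_order h"
    unfolding Aeq using growth_order_times_exp_poly_le[OF assms(5)] assms(3,6) by simp
  have "lower_growth_order B < growth_order A"
    using assms(10) lower_growth_order_le[of B] by (auto intro: le_less_trans)
  then have "lower_growth_order B < growth_order h" using Ah by (rule less_le_trans)
  then obtain \<mu>0 where \<mu>0: "lower_growth_order B < ereal \<mu>0" "ereal \<mu>0 < growth_order h" using ereal_dense2 by blast
  \<comment> \<open>The exponent is made nonnegative, so that enlarging \<open>\<mu> * X\<close> to
    \<open>\<mu> / k0 * x\<close> or \<open>2 * \<mu> * x\<close> is legitimate later.\<close>
  define \<mu> where "\<mu> = max 0 \<mu>0"
  have "ereal 0 \<le> ereal (real n)" by simp
  then have "ereal 0 < growth_order h" using assms(6) by (rule le_less_trans)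
  then have \<mu>: "0 \<le> \<mu>" "ereal \<mu> < growth_order h" using \<mu>0(2) unfolding \<mu>_def by (auto simp: max_def)
  have "ereal \<mu>0 \<le> ereal \<mu>" unfolding \<mu>_def by simp
  then have "lower_growth_order B < ereal \<mu>" using \<mu>0(1) by (rule less_le_trans[rotated])
  then have Bf: "\<exists>\<^sub>F X in at_top. \<forall>z. norm z \<le> exp X \<longrightarrow> norm (B z) \<le> exp (exp (\<mu> * X))"
    by (rule frequently_growth_of_lower_growth_order[OF B])
  obtain c where c: "\<And>\<theta>. \<bar>\<theta> - c\<bar> < pi / (2 * real n) \<Longrightarrow> delta P \<theta> < 0"
    using delta_neg_interval[OF assms(3,4)] by auto
  have big: "\<forall>\<^sub>F x in at_top. exp (exp (s * x)) \<le> norm (A (exp (Complex x \<theta>)))"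
    if "\<bar>\<theta> - c\<bar> < pi / (2 * real n)" "real n < s" "ereal s < growth_order h" for \<theta> s
    unfolding Aeq by (rule blow_up_times_exp_poly_on_ray[OF assms(8) c[OF that(1)] that(3)]) (use assms(3) that(2) in simp)
  show "infinite_order f"
  proof (rule ccontr)
    assume "\<not> infinite_order f"
    then have "growth_order f < \<infinity>" unfolding infinite_order_def by simp
    then obtain C0 where C0: "growth_order f < ereal C0" using ereal_dense2 by blast
    define C where "C = max 1 C0"
    have "power_growth f C"
      using power_growth_mono[OF power_growth_of_growth_order[OF f C0], of C] unfolding C_def by simp
    have "0 < C" unfolding C_def by simp
    note fC = f \<open>power_growth f C\<close> \<open>0 < C\<close>
    have npos: "0 < pi / (2 * real n)" using assms(4) by simp
    show False
    proof (cases "growth_order h")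
      case (real \<rho>)
      have "B z = 0" for z
      proof (rule coefficient_eq_0_of_finite_order[OF fC z0 z1 _ B, of A "real n" \<rho> \<mu> c])
        show "power_growth A t" if "\<rho> < t" for t
        proof -
          have "power_growth h ((\<rho> + t) / 2)" by (rule power_growth_of_growth_order[OF assms(5)]) (use that real in simp)
          moreover have "real (degree P) < t" using that assms(3,6) real by simp
          ultimately show ?thesis unfolding Aeq using that by (intro power_growth_times_exp_poly[where t = "(\<rho> + t) / 2"]) auto
        qed
      qed (use ode assms(4,6) \<mu> Bf big real in auto)
      with Bnz show False by blast
    next
      case PInf
      have "deriv f z = 0" for z
      proof (rule deriv_eq_0_if_coefficient_of_infinite_order[OF fC, of A B "c - pi / (2 * real n)" "c + pi / (2 * real n)" \<mu>])
        fix \<theta> s assume \<theta>: "c - pi / (2 * real n) < \<theta>" "\<theta> < c + pi / (2 * real n)"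
        \<comment> \<open>\<open>big\<close> is available for exponents above \<open>n\<close>;
          smaller ones follow from a larger one for \<open>x >= 0\<close>.\<close>
        define s' where "s' = max s (real n + 1)"
        have s': "s \<le> s'" "real n < s'" unfolding s'_def by auto
        have "\<forall>\<^sub>F x in at_top. exp (exp (s' * x)) \<le> norm (A (exp (Complex x \<theta>)))"
          by (rule big) (use \<theta> PInf s' in \<open>auto simp: abs_less_iff\<close>)
        then show "\<forall>\<^sub>F x in at_top. exp (exp (s * x)) \<le> norm (A (exp (Complex x \<theta>)))"
          using eventually_ge_at_top[of 0]
        proof eventually_elim
          case (elim x)
          have "s * x \<le> s' * x" using elim(2) s' by (intro mult_right_mono) auto
          then have "exp (exp (s * x)) \<le> exp (exp (s' * x))" by simp
          then show ?case using elim(1) by linarith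
        qed
      qed (use ode Bf \<mu>(1) npos in auto)
      with z1 show False by blast
    next
      case MInf
      then show False using assms(6) by simp
    qed
  qed
qed

end
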